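(* Let $n \geq 2$, and let $T \subset \mathbb{R}^n$ be a closed set which meets every sphere $S(r) = \{x \in \mathbb{R}^n : |x| = r\}$ centred at the origin of radius $r \geq 0$. Suppose that $(r_k)_{k\in \mathbb{N}}$ is a sequence of positive real numbers tending to infinity, and that $\epsilon \in (0,1)$. Define $$E_{\epsilon} = \bigcup_{k \in \mathbb{N}} (\epsilon r_k, r_k), \quad\text{and}\quad S_{\epsilon} = \bigcup_{r\in E_{\epsilon}} S(r).$$ Then there exists a transcendental-type quasiregular map $h:\mathbb{R}^n \to \mathbb{R}^n$ with the property that $T \setminus S_{\epsilon} = \mathcal{M}(h) \setminus S_{\epsilon}$.
   Context: Here $|\cdot|$ is the Euclidean norm; a singleton is regarded as a (degenerate) sphere of radius zero, so the hypothesis with $r=0$ says $0 \in T$. Quasiregular maps are understood in the standard sense: a continuous map $f:\mathbb{R}^n \to \mathbb{R}^n$ in the Sobolev space $W^{1,n}_{\mathrm{loc}}$ is quasiregular if there is $K_0 \geq 1$ with $|Df(x)|^n \leq K_0 J_f(x)$ for almost every $x$, where $|Df(x)|$ is the operator norm of the derivative and $J_f$ is the Jacobian determinant. A (non-constant) quasiregular map $f:\mathbb{R}^n\to\mathbb{R}^n$ is of polynomial type if it has finite degree, where the degree is the maximal number of preimages of a point, $\sup_{y} \#f^{-1}(y)$; otherwise it is of transcendental type. For a quasiregular map $f : \mathbb{R}^n \to \mathbb{R}^n$, the maximum modulus function is $M(r,f) = \max_{|x|=r} |f(x)|$ for $r \geq 0$, and the maximum modulus set is $\mathcal{M}(f)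 = \{ x \in \mathbb{R}^n : |f(x)| = M(|x|,f) \}$. *)

theory Defs
  imports "HOL-Analysis.Analysis" "HOL-Library.Extended_Nat"
begin

primrec Ck_function :: "nat \<Rightarrow> ((real^'n) \<Rightarrow> real) \<Rightarrow> bool" where
  "Ck_function 0 \<phi> \<longleftrightarrow> continuous_on UNIV \<phi>"
| "Ck_function (Suc k) \<phi> \<longleftrightarrow> \<phi> differentiable_on UNIV \<and>
     (\<forall>j. Ck_function k (\<lambda>x. frechet_derivative \<phi> (at x) (axis j 1)))"

definition test_function :: "((real^'n) \<Rightarrow> real) \<Rightarrow> bool" where
  "test_function \<phi> \<longleftrightarrow> (\<forall>k. Ck_function k \<phi>) \<and> compact (closure {x. \<phi> x \<noteq> 0})"

definition Lp_loc :: "nat \<Rightarrow> ((real^'n) \<Rightarrow> 'b::euclidean_space) \<Rightarrow> bool" where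
  "Lp_loc p g \<longleftrightarrow> g \<in> borel_measurable lebesgue \<and>
     (\<forall>C. compact C \<longrightarrow> set_integrable lebesgue C (\<lambda>x. norm (g x) ^ p))"

text \<open>The entry \<open>D x $ i $ j\<close> is the weak partial derivative of the component \<open>f\<^sub>i\<close> in the
  direction of the j-th coordinate, so that \<open>D x\<close> is the matrix of the (a.e. defined)
  derivative.  Local integrability makes both sides of the integration by parts
  identity genuine Lebesgue integrals.\<close>

definition weak_derivative :: "((real^'n) \<Rightarrow> (real^'n)) \<Rightarrow> ((real^'n) \<Rightarrow> (real^'n^'n)) \<Rightarrow> bool" where
  "weak_derivative f D \<longleftrightarrow> Lp_loc 1 f \<and> Lp_loc 1 D \<and>
     (\<forall>\<phi>. test_function \<phi> \<longrightarrow>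
        (\<forall>i j. integral\<^sup>L lebesgue (\<lambda>x. f x $ i * frechet_derivative \<phi> (at x) (axis j 1))
             = - integral\<^sup>L lebesgue (\<lambda>x. D x $ i $ j * \<phi> x)))"

text \<open>\<open>f\<close> lies in \<open>W\<^sup>1\<^sup>,\<^sup>p\<close> locally, with weak derivative \<open>D\<close>
  (which is determined up to a null set by \<open>f\<close>).\<close>

definition W1p_loc :: "nat \<Rightarrow> ((real^'n) \<Rightarrow> (real^'n)) \<Rightarrow> ((real^'n) \<Rightarrow> (real^'n^'n)) \<Rightarrow> bool" where
  "W1p_loc p f D \<longleftrightarrow> weak_derivative f D \<and> Lp_loc p f \<and> Lp_loc p D"

definition quasiregular :: "((real^'n) \<Rightarrow> (real^'n)) \<Rightarrow> bool" where
  "quasiregular f \<longleftrightarrow> continuous_on UNIV f \<and>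
     (\<exists>D. W1p_loc CARD('n) f D \<and>
        (\<exists>K\<^sub>0\<ge>1. AE x in lebesgue. onorm (\<lambda>v. D x *v v) ^ CARD('n) \<le> K\<^sub>0 * det (D x)))"

definition num_elements :: "'a set \<Rightarrow> enat" where
  "num_elements A = (if finite A then enat (card A) else \<infinity>)"

definition map_degree :: "('a \<Rightarrow> 'b) \<Rightarrow> enat" where
  "map_degree f = (SUP y. num_elements (f -` {y}))"

text \<open>Constant maps have infinite degree but are neither of polynomial nor of
  transcendental type.\<close>

definition transcendental_type :: "((real^'n) \<Rightarrow> (real^'n)) \<Rightarrow> bool" where
  "transcendental_type f \<longleftrightarrow> quasiregular f \<and> \<not> f constant_on UNIV \<and> map_degree f = \<infinity>"

definition max_modulus :: "real \<Rightarrow> ((real^'n) \<Rightarrow> (real^'n)) \<Rightarrow> real" where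
  "max_modulus r f = (SUP x\<in>sphere 0 r. norm (f x))"

text \<open>The supremum is a maximum.\<close>

lemma max_modulus_attained:
  fixes f :: "real^'n \<Rightarrow> real^'n"
  assumes "continuous_on UNIV f" "0 \<le> r"
  shows "\<exists>x\<in>sphere 0 r. norm (f x) = max_modulus r f \<and> (\<forall>y\<in>sphere 0 r. norm (f y) \<le> norm (f x))"
proof -
  have "r *\<^sub>R axis undefined 1 \<in> sphere (0::real^'n) r"
    using assms(2) by (simp add: norm_axis_1)
  then have "sphere (0::real^'n) r \<noteq> {}" by blast
  moreover have "continuous_on (sphere 0 r) (\<lambda>x. norm (f x))"
    using assms(1) by (intro continuous_on_norm) (rule continuous_on_subset, auto)
  ultimately obtain x where x: "x \<in> sphere 0 r" "\<forall>y\<in>sphere 0 r. norm (f y) \<le> norm (f x)"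
    using continuous_attains_sup[OF compact_sphere] by blast
  then have "max_modulus r f = norm (f x)"
    unfolding max_modulus_def by (intro cSup_eq_maximum) auto
  with x show ?thesis by metis
qed

definition max_modulus_set :: "((real^'n) \<Rightarrow> (real^'n)) \<Rightarrow> (real^'n) set" where
  "max_modulus_set f = {x. norm (f x) = max_modulus (norm x) f}"

definition E_eps :: "real \<Rightarrow> (nat \<Rightarrow> real) \<Rightarrow> real set" where
  "E_eps \<epsilon> r = (\<Union>k. {\<epsilon> * r k <..< r k})"

definition S_eps :: "real \<Rightarrow> (nat \<Rightarrow> real) \<Rightarrow> (real^'n) set" where
  "S_eps \<epsilon> r = (\<Union>\<rho>\<in>E_eps \<epsilon> r. sphere 0 \<rho>)"

end

theory Submission
  imports Defs
begin

text \<open>The map has the form \<open>h = round_map \<circ> g \<circ> cone_map w\<close>. The middle factor \<open>g\<close> is a quasiregular map of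
infinite degree that takes level sets of the norm \<open>cnorm\<close> to level sets, except in thin parts
of infinitely many of the given shells. The inner factor moves points along rays such that
\<open>cnorm (cone_map w x) = w x * norm x\<close>; the outer factor carries level sets of \<open>cnorm\<close> back to
spheres. Here \<open>w = 1 - v\<close>, where \<open>v \<ge> 0\<close> is differentiable with zero set \<open>T\<close>, small, and slowly varying
on every scale. On a sphere of radius \<open>\<rho>\<close> outside the shells this gives \<open>norm (h x) = C * (w x * \<rho>) ^ d\<close>
with \<open>C\<close> and \<open>d\<close> depending on \<open>\<rho>\<close> only, and as \<open>T\<close> meets the sphere, the maximum is attained exactly
where \<open>w x = 1\<close>, that is, on \<open>T\<close>.

The degree of \<open>g\<close> on level sets has to tend to infinity while its distortion stays bounded. Winding
around an axis is too expensive for this in dimension at least three. Instead, logarithmic coordinates turn the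
upper half space into the beam over a cube, and \<open>power_map d\<close> multiplies them by an odd number \<open>d\<close> and
folds the enlarged beam back by reflections in the walls of the subbeams, as the maps of Zorich do.
Scaling is conformal and reflections are isometries, so the distortion does not depend on \<open>d\<close>
(\<open>ae_distortion_power_map\<close>), while the degree grows with \<open>d\<close>. Moreover \<open>power_map d\<close> raises \<open>cnorm\<close> to
the power \<open>d\<close>, is positively homogeneous, and satisfies
\<open>power_map a \<circ> power_map d = power_map (a * d)\<close> for odd \<open>a\<close> and \<open>d\<close>. The norm
\<open>cnorm\<close> is adapted to the folding: its unit ball is a double pyramid over the cube.

The degree is changed by one fixed map, \<open>transition_map\<close>, which is \<open>3 * x\<close> near the origin and a multiple
of \<open>power_map 3\<close> far away. Thus \<open>x \<mapsto> transition_map (lam *\<^sub>R power_map d x)\<close> is a multiple of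
\<open>power_map d\<close> for small \<open>cnorm x\<close> and of \<open>power_map (3 * d)\<close> for large \<open>cnorm x\<close>. The change takes place
in a shell whose ratio of radii is \<open>8\<close> to the power \<open>1 / d\<close>, so it fits into a given shell as soon as
\<open>d\<close> is large; \<open>transition_chain\<close> joins infinitely many of these changes. The transition map is an
analogue of a Chebyshev polynomial: its charts of the half space open the flat cube at height zero
into the bottom of a beam, so that tripling the beam folds the flat cube onto itself.
Near the centre of the cube this is multiplication by three, and far away it is the power map.

On the analytic side everything is reduced to pointwise statements. A locally Lipschitz map that is
differentiable almost everywhere has its pointwise derivative as weak derivative
(\<open>quasiregular_if_ae_distortion\<close>). Almost everywhere differentiability with positive
determinant and bounded distortion is inherited by compositions, because preimages of null sets under such maps are null
(\<open>negligible_preimage\<close>). The elementary maps are of two kinds, controlled by a planar Jacobian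
(\<open>profile_distortion\<close>) or by a radial derivative (\<open>radial_distortion\<close>).\<close>

section \<open>Locally Lipschitz functions\<close>

text \<open>Lipschitz continuity on bounded sets is the form in which the property is used; in finite dimension
it is equivalent to the existence of Lipschitz neighbourhoods (\<open>locally_lipschitz_if_near_points\<close>).\<close>

definition locally_lipschitz :: "('a::euclidean_space \<Rightarrow> 'b::metric_space) \<Rightarrow> bool" where
  "locally_lipschitz f \<longleftrightarrow> (\<forall>R. \<exists>L. L-lipschitz_on (cball 0 R) f)"

lemma locally_lipschitzE:
  assumes "locally_lipschitz f"
  obtains L where "L-lipschitz_on (cball 0 R) f" "L > 0"
proof -
  obtain L where L: "L-lipschitz_on (cball 0 R) f"
    using assms unfolding locally_lipschitz_def by blast
  then have "(\<bar>L\<bar> + 1)-lipschitz_on (cball 0 R) f"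
    by (rule lipschitz_on_mono) auto
  then show thesis using that[of "\<bar>L\<bar> + 1"] by simp
qed

lemma locally_lipschitz_continuous_on:
  assumes "locally_lipschitz f"
  shows "continuous_on S f"
proof -
  have "isCont f x" for x
  proof -
    obtain L where "L-lipschitz_on (cball 0 (norm x + 1)) f"
      using assms unfolding locally_lipschitz_def by blast
    then have "continuous_on (cball 0 (norm x + 1)) f"
      by (rule lipschitz_on_continuous_on)
    moreover have "x \<in> interior (cball 0 (norm x + 1))" by simp
    ultimately show "isCont f x" by (rule continuous_on_interior)
  qed
  then show ?thesis by (simp add: continuous_at_imp_continuous_on)
qed

lemma locally_lipschitz_bounded:
  fixes f :: "'a::euclidean_space \<Rightarrow> 'b::real_normed_vector"
  assumes "locally_lipschitz f"
  obtains B where "B > 0" "\<And>x. norm x \<le> R \<Longrightarrow> norm (f x) \<le> B"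
proof -
  have "compact (f ` cball 0 R)"
    by (intro compact_continuous_image locally_lipschitz_continuous_on assms compact_cball)
  then obtain B where "B > 0" "\<forall>y\<in>f ` cball 0 R. norm y \<le> B"
    using compact_imp_bounded bounded_pos by blast
  then show thesis using that by (force simp: dist_norm)
qed

lemma locally_lipschitz_if_near_points:
  fixes f :: "'a::euclidean_space \<Rightarrow> 'b::metric_space"
  assumes "\<And>x. \<exists>e>0. \<exists>L. L-lipschitz_on (ball x e) f"
  shows "locally_lipschitz f"
  unfolding locally_lipschitz_def
proof
  fix R :: real
  have "local_lipschitz {0::real} (cball 0 R) (\<lambda>_. f)"
    unfolding local_lipschitz_def
  proof (intro ballI)
    fix x :: 'a and t :: real
    obtain e L where e: "e > 0" "L-lipschitz_on (ball x e) f" using assms by blast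
    have "L-lipschitz_on (cball x (e/2) \<inter> cball 0 R) f"
      using e by (intro lipschitz_on_subset[OF e(2)]) (auto simp: dist_norm)
    then show "\<exists>u>0. \<exists>L. \<forall>s\<in>cball t u \<inter> {0}. L-lipschitz_on (cball x u \<inter> cball 0 R) f"
      using e(1) by (intro exI[of _ "e/2"]) auto
  qed
  then obtain L where "\<And>t. t \<in> {0::real} \<Longrightarrow> L-lipschitz_on (cball 0 R) f"
    by (rule local_lipschitz_compact_implies_lipschitz) auto
  then show "\<exists>L. L-lipschitz_on (cball 0 R) f" by blast
qed

lemma locally_lipschitz_if_locally_equal:
  fixes f :: "'a::euclidean_space \<Rightarrow> 'b::metric_space"
  assumes "\<And>x. \<exists>U g. open U \<and> x \<in> U \<and> locally_lipschitz g \<and> (\<forall>y\<in>U. f y = g y)"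
  shows "locally_lipschitz f"
proof (rule locally_lipschitz_if_near_points)
  fix x
  obtain U g where U: "open U" "x \<in> U" "locally_lipschitz g" "\<forall>y\<in>U. f y = g y"
    using assms by blast
  then obtain e where e: "e > 0" "ball x e \<subseteq> U" by (meson openE)
  obtain L where L: "L-lipschitz_on (cball 0 (norm x + e)) g"
    using U(3) unfolding locally_lipschitz_def by blast
  have sub: "ball x e \<subseteq> cball 0 (norm x + e)"
  proof
    fix y assume "y \<in> ball x e"
    then have "norm (y - x) < e" by (simp add: dist_norm norm_minus_commute)
    then show "y \<in> cball 0 (norm x + e)"
      using norm_triangle_sub[of y x] by simp
  qed
  have "L-lipschitz_on (ball x e) g" by (rule lipschitz_on_subset[OF L sub])
  then have "L-lipschitz_on (ball x e) f"
    by (rule lipschitz_on_transform) (use U e in auto)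
  then show "\<exists>e>0. \<exists>L. L-lipschitz_on (ball x e) f" using e by blast
qed

lemma locally_lipschitz_const: "locally_lipschitz (\<lambda>_. c)"
  unfolding locally_lipschitz_def using lipschitz_on_constant by blast

lemma locally_lipschitz_bounded_linear:
  "bounded_linear f \<Longrightarrow> locally_lipschitz f"
  unfolding locally_lipschitz_def by (metis bounded_linear.lipschitz_boundE)

lemma locally_lipschitz_global: "L-lipschitz_on UNIV f \<Longrightarrow> locally_lipschitz f"
  unfolding locally_lipschitz_def by (meson lipschitz_on_subset subset_UNIV)

lemma locally_lipschitz_add:
  fixes f g :: "'a::euclidean_space \<Rightarrow> 'b::real_normed_vector"
  shows "locally_lipschitz f \<Longrightarrow> locally_lipschitz g \<Longrightarrow> locally_lipschitz (\<lambda>x. f x + g x)"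
  unfolding locally_lipschitz_def by (metis lipschitz_on_add)

lemma locally_lipschitz_diff:
  fixes f g :: "'a::euclidean_space \<Rightarrow> 'b::real_normed_vector"
  shows "locally_lipschitz f \<Longrightarrow> locally_lipschitz g \<Longrightarrow> locally_lipschitz (\<lambda>x. f x - g x)"
  unfolding locally_lipschitz_def by (metis lipschitz_on_diff)

lemma locally_lipschitz_compose:
  fixes f :: "'a::euclidean_space \<Rightarrow> 'b::euclidean_space" and g :: "'b \<Rightarrow> 'c::metric_space"
  assumes "locally_lipschitz g" "locally_lipschitz f"
  shows "locally_lipschitz (\<lambda>x. g (f x))"
  unfolding locally_lipschitz_def
proof
  fix R
  obtain L where L: "L-lipschitz_on (cball 0 R) f" "L > 0"
    using assms(2) by (rule locally_lipschitzE)
  obtain B where B: "\<And>x. norm x \<le> R \<Longrightarrow> norm (f x) \<le> B"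
    using assms(2) by (rule locally_lipschitz_bounded) blast
  obtain M where M: "M-lipschitz_on (cball 0 B) g" "M > 0"
    using assms(1) by (rule locally_lipschitzE)
  have "M-lipschitz_on (f ` cball 0 R) g"
    by (rule lipschitz_on_subset[OF M(1)]) (use B in auto)
  from lipschitz_on_compose2[OF L(1) this]
  show "\<exists>L. L-lipschitz_on (cball 0 R) (\<lambda>x. g (f x))" by blast
qed

lemma locally_lipschitz_compose_global:
  fixes f :: "'a::euclidean_space \<Rightarrow> 'b::metric_space" and g :: "'b \<Rightarrow> 'c::metric_space"
  assumes "M-lipschitz_on UNIV g" "locally_lipschitz f"
  shows "locally_lipschitz (\<lambda>x. g (f x))"
  unfolding locally_lipschitz_def
proof
  fix R
  obtain L where L: "L-lipschitz_on (cball 0 R) f" "L > 0"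
    using assms(2) by (rule locally_lipschitzE)
  have "M-lipschitz_on (f ` cball 0 R) g"
    by (rule lipschitz_on_subset[OF assms(1)]) auto
  from lipschitz_on_compose2[OF L(1) this]
  show "\<exists>L. L-lipschitz_on (cball 0 R) (\<lambda>x. g (f x))" by blast
qed

lemma locally_lipschitz_scaleR:
  fixes f :: "'a::euclidean_space \<Rightarrow> 'b::real_normed_vector"
  assumes u: "locally_lipschitz u" and f: "locally_lipschitz f"
  shows "locally_lipschitz (\<lambda>x. u x *\<^sub>R f x)"
  unfolding locally_lipschitz_def
proof
  fix R
  obtain L where L: "L-lipschitz_on (cball 0 R) u" "L > 0" using u by (rule locally_lipschitzE)
  obtain M where M: "M-lipschitz_on (cball 0 R) f" "M > 0" using f by (rule locally_lipschitzE)
  obtain B where B: "B > 0" "\<And>x. norm x \<le> R \<Longrightarrow> norm (u x) \<le> B"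
    using u by (rule locally_lipschitz_bounded) blast
  obtain C where C: "C > 0" "\<And>x. norm x \<le> R \<Longrightarrow> norm (f x) \<le> C"
    using f by (rule locally_lipschitz_bounded) blast
  have "(B * M + C * L)-lipschitz_on (cball 0 R) (\<lambda>x. u x *\<^sub>R f x)"
  proof (rule lipschitz_onI)
    fix x y :: 'a assume x: "x \<in> cball 0 R" and y: "y \<in> cball 0 R"
    have "norm (u x *\<^sub>R f x - u y *\<^sub>R f y) = norm (u x *\<^sub>R (f x - f y) + (u x - u y) *\<^sub>R f y)"
      by (simp add: algebra_simps)
    also have "\<dots> \<le> \<bar>u x\<bar> * norm (f x - f y) + \<bar>u x - u y\<bar> * norm (f y)"
      using norm_triangle_ineq[of "u x *\<^sub>R (f x - f y)" "(u x - u y) *\<^sub>R f y"] by simp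
    also have "\<dots> \<le> B * (M * dist x y) + (L * dist x y) * C"
      using B(2)[of x] C(2)[of y] x y lipschitz_onD[OF M(1) x y] lipschitz_onD[OF L(1) x y] B(1) C(1) L(2) M(2)
      by (intro add_mono mult_mono) (auto simp: dist_norm)
    finally show "dist (u x *\<^sub>R f x) (u y *\<^sub>R f y) \<le> (B * M + C * L) * dist x y"
      by (simp add: dist_norm algebra_simps)
  qed (use B C L M in auto)
  then show "\<exists>L. L-lipschitz_on (cball 0 R) (\<lambda>x. u x *\<^sub>R f x)" by blast
qed

lemmas locally_lipschitz_mult = locally_lipschitz_scaleR[where 'b=real, simplified]

lemma locally_lipschitz_power:
  fixes f :: "'a::euclidean_space \<Rightarrow> real"
  shows "locally_lipschitz f \<Longrightarrow> locally_lipschitz (\<lambda>x. f x ^ k)"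
  by (induction k) (simp_all add: locally_lipschitz_const locally_lipschitz_mult)

lemma abs_lipschitz: "1-lipschitz_on S (abs :: real \<Rightarrow> real)"
  by (rule lipschitz_onI) (auto simp: dist_real_def)

lemma locally_lipschitz_abs:
  fixes f :: "'a::euclidean_space \<Rightarrow> real"
  shows "locally_lipschitz f \<Longrightarrow> locally_lipschitz (\<lambda>x. \<bar>f x\<bar>)"
  by (rule locally_lipschitz_compose_global[OF abs_lipschitz])

lemma locally_lipschitz_max:
  fixes f g :: "'a::euclidean_space \<Rightarrow> real"
  assumes "locally_lipschitz f" "locally_lipschitz g"
  shows "locally_lipschitz (\<lambda>x. max (f x) (g x))"
proof -
  have eq: "(\<lambda>x. max (f x) (g x)) = (\<lambda>x. (1/2) * ((f x + g x) + \<bar>f x - g x\<bar>))"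
    by (auto simp: max_def abs_if)
  show ?thesis unfolding eq
    by (intro locally_lipschitz_mult locally_lipschitz_const locally_lipschitz_add
        locally_lipschitz_abs locally_lipschitz_diff assms)
qed

lemma locally_lipschitz_min:
  fixes f g :: "'a::euclidean_space \<Rightarrow> real"
  assumes "locally_lipschitz f" "locally_lipschitz g"
  shows "locally_lipschitz (\<lambda>x. min (f x) (g x))"
proof -
  have eq: "(\<lambda>x. min (f x) (g x)) = (\<lambda>x. (1/2) * ((f x + g x) - \<bar>f x - g x\<bar>))"
    by (auto simp: min_def abs_if)
  show ?thesis unfolding eq
    by (intro locally_lipschitz_mult locally_lipschitz_const locally_lipschitz_add
        locally_lipschitz_abs locally_lipschitz_diff assms)
qed

lemma locally_lipschitz_inverse:
  fixes f :: "'a::euclidean_space \<Rightarrow> real"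
  assumes f: "locally_lipschitz f" and c: "c > 0" "\<And>x. f x \<ge> c"
  shows "locally_lipschitz (\<lambda>x. inverse (f x))"
  unfolding locally_lipschitz_def
proof
  fix R
  obtain L where L: "L-lipschitz_on (cball 0 R) f" "L > 0" using f by (rule locally_lipschitzE)
  have "(L / (c * c))-lipschitz_on (cball 0 R) (\<lambda>x. inverse (f x))"
  proof (rule lipschitz_onI)
    fix x y :: 'a assume x: "x \<in> cball 0 R" and y: "y \<in> cball 0 R"
    have pos: "f x > 0" "f y > 0" using c(2)[of x] c(2)[of y] c(1) by auto
    have "\<bar>inverse (f x) - inverse (f y)\<bar> = \<bar>f x - f y\<bar> / (f x * f y)"
    proof -
      have "inverse (f x) - inverse (f y) = (f y - f x) / (f x * f y)"
        using pos by (simp add: field_simps)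
      then show ?thesis using pos by (simp add: abs_minus_commute abs_mult)
    qed
    also have "\<dots> \<le> (L * dist x y) / (c * c)"
      using lipschitz_onD[OF L(1) x y] c pos L
      by (intro frac_le mult_mono) (auto simp: dist_real_def less_imp_le)
    finally show "dist (inverse (f x)) (inverse (f y)) \<le> L / (c * c) * dist x y"
      by (simp add: dist_real_def)
  qed (use L c in simp)
  then show "\<exists>L. L-lipschitz_on (cball 0 R) (\<lambda>x. inverse (f x))" by blast
qed

lemma locally_lipschitz_vec:
  fixes f :: "'a::euclidean_space \<Rightarrow> real^'n"
  assumes "\<And>i. locally_lipschitz (\<lambda>x. f x $ i)"
  shows "locally_lipschitz f"
proof -
  have sum: "locally_lipschitz (\<lambda>x. \<Sum>i\<in>I. (f x $ i) *\<^sub>R axis i (1::real))" if "finite I" for I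
    using that
    by (induction I) (auto intro!: locally_lipschitz_add locally_lipschitz_const
        locally_lipschitz_scaleR assms)
  have "f = (\<lambda>x. \<Sum>i\<in>UNIV. (f x $ i) *\<^sub>R axis i (1::real))"
    by (rule ext) (simp add: vec_eq_iff axis_def if_distrib cong: if_cong)
  then show ?thesis using sum[of UNIV] by simp
qed

lemma locally_lipschitz_nth:
  fixes f :: "'a::euclidean_space \<Rightarrow> real^'n"
  shows "locally_lipschitz f \<Longrightarrow> locally_lipschitz (\<lambda>x. f x $ i)"
  by (rule locally_lipschitz_compose[where g = "\<lambda>x. x $ i", OF locally_lipschitz_bounded_linear])
     (auto intro: bounded_linear_vec_nth)

text \<open>Two Lipschitz pieces that agree on the interface form a Lipschitz function, since a segment between
points of the two sides meets the interface.\<close>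

lemma locally_lipschitz_If:
  fixes f g :: "'a::euclidean_space \<Rightarrow> 'b::metric_space" and u :: "'a \<Rightarrow> real"
  assumes f: "locally_lipschitz f" and g: "locally_lipschitz g"
    and u: "continuous_on UNIV u" and eq: "\<And>x. u x = c \<Longrightarrow> f x = g x"
  shows "locally_lipschitz (\<lambda>x. if u x \<le> c then f x else g x)"
  unfolding locally_lipschitz_def
proof
  fix R
  obtain L where L: "L-lipschitz_on (cball 0 R) f" "L > 0" using f by (rule locally_lipschitzE)
  obtain M where M: "M-lipschitz_on (cball 0 R) g" "M > 0" using g by (rule locally_lipschitzE)
  let ?h = "\<lambda>x. if u x \<le> c then f x else g x"
  have mixed: "dist (f x) (g y) \<le> max L M * dist x y"
    if x: "x \<in> cball 0 R" and y: "y \<in> cball 0 R" and ux: "u x \<le> c" and uy: "\<not> u y \<le> c" for x y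
  proof -
    have "connected (u ` closed_segment x y)"
      by (intro connected_continuous_image continuous_on_subset[OF u]) auto
    moreover have "u x \<in> u ` closed_segment x y" "u y \<in> u ` closed_segment x y" by auto
    ultimately have "c \<in> u ` closed_segment x y"
      using ux uy by (meson connectedD_interval linear not_le)
    then obtain z where z: "z \<in> closed_segment x y" "u z = c" by auto
    have zR: "z \<in> cball 0 R"
      using z(1) x y convex_cball convex_contains_segment by blast
    have d: "dist x z + dist z y = dist x y" using z(1) by (simp add: between_mem_segment[symmetric] between)
    have "dist (f x) (g y) \<le> dist (f x) (f z) + dist (g z) (g y)"
      using dist_triangle[of "f x" "g y" "f z"] eq[OF z(2)] by simp
    also have "\<dots> \<le> L * dist x z + M * dist z y"
      using lipschitz_onD[OF L(1) x zR] lipschitz_onD[OF M(1) zR y] by (rule add_mono)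
    also have "\<dots> \<le> max L M * dist x z + max L M * dist z y"
      by (intro add_mono mult_right_mono) auto
    also have "\<dots> = max L M * dist x y" by (simp add: d[symmetric] distrib_left)
    finally show ?thesis .
  qed
  have "(max L M)-lipschitz_on (cball 0 R) ?h"
  proof (rule lipschitz_onI)
    fix x y :: 'a assume x: "x \<in> cball 0 R" and y: "y \<in> cball 0 R"
    have ff: "dist (f x) (f y) \<le> max L M * dist x y"
      using lipschitz_onD[OF L(1) x y] by (rule order_trans) (intro mult_right_mono, auto)
    have gg: "dist (g x) (g y) \<le> max L M * dist x y"
      using lipschitz_onD[OF M(1) x y] by (rule order_trans) (intro mult_right_mono, auto)
    show "dist (?h x) (?h y) \<le> max L M * dist x y"
      using ff gg mixed[OF x y] mixed[OF y x] by (auto simp: dist_commute)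
  qed (use L in simp)
  then show "\<exists>L. L-lipschitz_on (cball 0 R) ?h" by blast
qed

text \<open>A sign may jump at the zeros of a Lipschitz function \<open>w\<close>: if a segment contains a zero of \<open>w\<close>, then
both end values are bounded by the distances from that zero, and otherwise the sign is the same
at both ends. All reflections below are glued in this way.\<close>

lemma locally_lipschitz_sign_switch:
  fixes w \<sigma> :: "'a::euclidean_space \<Rightarrow> real"
  assumes w: "locally_lipschitz w" and bd: "\<And>x. \<bar>\<sigma> x\<bar> \<le> 1"
    and sw: "\<And>x y. (\<forall>z\<in>closed_segment x y. w z \<noteq> 0) \<Longrightarrow> \<sigma> x = \<sigma> y"
  shows "locally_lipschitz (\<lambda>x. \<sigma> x * w x)"
  unfolding locally_lipschitz_def
proof
  fix R
  obtain L where L: "L-lipschitz_on (cball 0 R) w" "L > 0" using w by (rule locally_lipschitzE)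
  have small: "\<bar>\<sigma> x * w x\<bar> \<le> \<bar>w x\<bar>" for x
    using mult_right_mono[OF bd, of "\<bar>w x\<bar>" x] by (simp add: abs_mult)
  have "L-lipschitz_on (cball 0 R) (\<lambda>x. \<sigma> x * w x)"
  proof (rule lipschitz_onI)
    fix x y :: 'a assume x: "x \<in> cball 0 R" and y: "y \<in> cball 0 R"
    show "dist (\<sigma> x * w x) (\<sigma> y * w y) \<le> L * dist x y"
    proof (cases "\<forall>z\<in>closed_segment x y. w z \<noteq> 0")
      case True
      then have "dist (\<sigma> x * w x) (\<sigma> y * w y) = \<bar>\<sigma> y\<bar> * dist (w x) (w y)"
        using sw[OF True] by (simp add: dist_real_def right_diff_distrib[symmetric] abs_mult)
      also have "\<dots> \<le> 1 * (L * dist x y)"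
        by (intro mult_mono bd lipschitz_onD[OF L(1) x y]) auto
      finally show ?thesis by simp
    next
      case False
      then obtain z where z: "z \<in> closed_segment x y" "w z = 0" by auto
      have zR: "z \<in> cball 0 R"
        using z(1) x y convex_cball convex_contains_segment by blast
      have d: "dist x z + dist z y = dist x y" using z(1) by (simp add: between_mem_segment[symmetric] between)
      have "dist (\<sigma> x * w x) (\<sigma> y * w y) \<le> \<bar>w x\<bar> + \<bar>w y\<bar>"
        using small[of x] small[of y] by (simp add: dist_real_def)
      also have "\<dots> \<le> L * dist x z + L * dist z y"
        using lipschitz_onD[OF L(1) x zR] lipschitz_onD[OF L(1) zR y] z(2)
        by (simp add: dist_real_def)
      also have "\<dots> = L * dist x y" by (simp add: d[symmetric] distrib_left)
      finally show ?thesis .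
    qed
  qed (use L in simp)
  then show "\<exists>L. L-lipschitz_on (cball 0 R) (\<lambda>x. \<sigma> x * w x)" by blast
qed

text \<open>Projecting to the level set \<open>p = 1\<close> is not Lipschitz near the origin, but its Lipschitz constant is of
order \<open>1 / p\<close>, which the factor \<open>u\<close> of order \<open>p\<close> compensates. Where \<open>p\<close> vanishes,
which happens at the origin at most, so does \<open>u\<close>, and the value of \<open>\<psi>\<close> given by the convention \<open>inverse 0 = 0\<close> is
multiplied by zero.\<close>

lemma locally_lipschitz_polar:
  fixes u p :: "'a::euclidean_space \<Rightarrow> real" and \<psi> :: "'a \<Rightarrow> 'b::real_normed_vector"
  assumes u: "locally_lipschitz u" and p: "locally_lipschitz p"
    and c: "c > 0" "\<And>x. c * norm x \<le> p x"
    and up: "\<And>R. \<exists>C. \<forall>x. norm x \<le> R \<longrightarrow> \<bar>u x\<bar> \<le> C * p x"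
    and \<psi>: "locally_lipschitz \<psi>"
  shows "locally_lipschitz (\<lambda>x. u x *\<^sub>R \<psi> (x /\<^sub>R p x))"
  unfolding locally_lipschitz_def
proof
  fix R
  obtain L where L: "L-lipschitz_on (cball 0 R) u" "L > 0" using u by (rule locally_lipschitzE)
  obtain K where K: "K-lipschitz_on (cball 0 R) p" "K > 0" using p by (rule locally_lipschitzE)
  obtain M where M: "M-lipschitz_on (cball 0 (1/c)) \<psi>" "M > 0" using \<psi> by (rule locally_lipschitzE)
  obtain B where B: "B > 0" "\<And>x. norm x \<le> 1/c \<Longrightarrow> norm (\<psi> x) \<le> B"
    using \<psi> by (rule locally_lipschitz_bounded) blast
  obtain C0 where C0: "\<And>x. norm x \<le> R \<Longrightarrow> \<bar>u x\<bar> \<le> C0 * p x" using up by blast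
  define C where "C = max C0 0"
  have p0: "0 \<le> p x" for x
    using c(2)[of x] c(1) by (meson less_imp_le mult_nonneg_nonneg norm_ge_zero order_trans)
  have C: "\<bar>u x\<bar> \<le> C * p x" if "norm x \<le> R" for x
    using C0[OF that] mult_right_mono[of C0 C "p x"] p0[of x] unfolding C_def by simp
  have unit: "norm (x /\<^sub>R p x) \<le> 1/c" for x
  proof (cases "p x = 0")
    case False
    then have "p x > 0" using p0[of x] by simp
    then show ?thesis using c(2)[of x] c(1) by (simp add: field_simps)
  qed (use c in simp)
  \<comment> \<open>differences of directions, weighted by \<open>p y\<close>, which is the order of \<open>u y\<close>\<close>
  have tang: "p y * norm (x /\<^sub>R p x - y /\<^sub>R p y) \<le> (K / c + 1) * dist x y"
    if x: "x \<in> cball 0 R" and y: "y \<in> cball 0 R" for x y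
  proof (cases "p y = 0")
    case True
    then show ?thesis using K c by simp
  next
    case False
    then have "p y *\<^sub>R (x /\<^sub>R p x - y /\<^sub>R p y) = (p y - p x) *\<^sub>R (x /\<^sub>R p x) + (x - y)"
    proof (cases "p x = 0")
      case True
      then have "x = 0" using c(2)[of x] c(1) by (simp add: mult_le_0_iff)
      then show ?thesis using False by simp
    next
      case px: False
      then show ?thesis using False by (simp add: algebra_simps)
    qed
    then have "p y * norm (x /\<^sub>R p x - y /\<^sub>R p y) = norm ((p y - p x) *\<^sub>R (x /\<^sub>R p x) + (x - y))"
      using p0[of y] by (metis abs_of_nonneg norm_scaleR)
    also have "\<dots> \<le> \<bar>p y - p x\<bar> * norm (x /\<^sub>R p x) + norm (x - y)"
      using norm_triangle_ineq[of "(p y - p x) *\<^sub>R (x /\<^sub>R p x)" "x - y"]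
      unfolding norm_scaleR[of "p y - p x"] .
    also have "\<dots> \<le> (K * dist x y) * (1/c) + dist x y"
      using lipschitz_onD[OF K(1) x y] unit[of x] K c
      by (intro add_mono mult_mono) (auto simp: dist_norm abs_minus_commute)
    finally show ?thesis by (simp add: algebra_simps)
  qed
  have "(L * B + C * (M * (K / c + 1)))-lipschitz_on (cball 0 R) (\<lambda>x. u x *\<^sub>R \<psi> (x /\<^sub>R p x))"
  proof (rule lipschitz_onI)
    fix x y :: 'a assume x: "x \<in> cball 0 R" and y: "y \<in> cball 0 R"
    let ?x = "x /\<^sub>R p x" and ?y = "y /\<^sub>R p y"
    have "norm (u x *\<^sub>R \<psi> ?x - u y *\<^sub>R \<psi> ?y) = norm ((u x - u y) *\<^sub>R \<psi> ?x + u y *\<^sub>R (\<psi> ?x - \<psi> ?y))"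
      by (simp add: algebra_simps)
    also have "\<dots> \<le> \<bar>u x - u y\<bar> * norm (\<psi> ?x) + \<bar>u y\<bar> * norm (\<psi> ?x - \<psi> ?y)"
      using norm_triangle_ineq[of "(u x - u y) *\<^sub>R \<psi> ?x" "u y *\<^sub>R (\<psi> ?x - \<psi> ?y)"] by simp
    also have "\<dots> \<le> (L * dist x y) * B + (C * p y) * (M * norm (?x - ?y))"
      using lipschitz_onD[OF L(1) x y] B unit[of x] unit[of y] C[of y] y L p0[of y]
        lipschitz_onD[OF M(1), of ?x ?y]
      by (intro add_mono mult_mono) (auto simp: dist_norm C_def)
    also have "(C * p y) * (M * norm (?x - ?y)) = (C * M) * (p y * norm (?x - ?y))" by simp
    also have "\<dots> \<le> (C * M) * ((K / c + 1) * dist x y)"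
      using tang[OF x y] M by (intro mult_left_mono) (auto simp: C_def)
    finally show "dist (u x *\<^sub>R \<psi> ?x) (u y *\<^sub>R \<psi> ?y) \<le> (L * B + C * (M * (K / c + 1))) * dist x y"
      by (simp add: dist_norm algebra_simps)
  qed (use L B M K c in \<open>simp add: C_def\<close>)
  then show "\<exists>L. L-lipschitz_on (cball 0 R) (\<lambda>x. u x *\<^sub>R \<psi> (x /\<^sub>R p x))" by blast
qed

section \<open>Linear maps and almost everywhere differentiable maps of bounded distortion\<close>

text \<open>The scale \<open>s\<close> is existentially quantified, so that the notion ignores conformal factors and constants
multiply under composition.\<close>

definition distortion_le :: "real \<Rightarrow> real^'n^'n \<Rightarrow> bool" where
  "distortion_le L A \<longleftrightarrow> det A > 0 \<and>
     (\<exists>s>0. \<forall>v. s * norm v \<le> norm (A *v v) \<and> norm (A *v v) \<le> L * s * norm v)"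

text \<open>The segment from the identity to \<open>A\<close> consists of invertible matrices, so the determinant cannot
change sign along it.\<close>

lemma det_pos_if_no_nonpos_eigenvalue:
  fixes A :: "real^'n^'n"
  assumes "\<And>v \<mu>. A *v v = \<mu> *\<^sub>R v \<Longrightarrow> \<mu> \<le> 0 \<Longrightarrow> v = 0"
  shows "det A > 0"
proof -
  define B where "B t = (1 - t) *\<^sub>R mat 1 + t *\<^sub>R A" for t :: real
  have Bv: "B t *v v = (1 - t) *\<^sub>R v + t *\<^sub>R (A *v v)" for t v
    by (simp add: B_def matrix_vector_mult_add_rdistrib scaleR_matrix_vector_assoc[symmetric])
  have nz: "det (B t) \<noteq> 0" if t: "t \<in> {0..1}" for t
  proof
    assume "det (B t) = 0"
    then have "\<not> invertible (B t)" by (simp add: invertible_det_nz)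
    then obtain v where v: "v \<noteq> 0" "B t *v v = 0"
      unfolding invertible_left_inverse matrix_left_invertible_ker by blast
    have "t \<noteq> 0" using v by (auto simp: Bv)
    then have "A *v v = - ((1 - t) / t) *\<^sub>R v"
    proof -
      have "t *\<^sub>R (A *v v) = - (1 - t) *\<^sub>R v"
        using v(2) by (simp add: Bv add_eq_0_iff algebra_simps)
      then have "(1 / t * t) *\<^sub>R (A *v v) = (1 / t * - (1 - t)) *\<^sub>R v"
        by (metis scaleR_scaleR)
      moreover have "1 / t * t = 1" "1 / t * - (1 - t) = - ((1 - t) / t)"
        using \<open>t \<noteq> 0\<close> by (simp_all add: field_simps)
      ultimately show ?thesis by simp
    qed
    moreover have "- ((1 - t) / t) \<le> 0" using t \<open>t \<noteq> 0\<close> by (simp add: field_simps)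
    ultimately have "v = 0" by (rule assms)
    with v show False by simp
  qed
  have cont: "continuous_on {0..1} (\<lambda>t. det (B t))"
    unfolding det_def B_def by (auto intro!: continuous_intros)
  have "connected ((\<lambda>t. det (B t)) ` {0..1})"
    by (intro connected_continuous_image cont) auto
  moreover have "det (B 0) \<in> (\<lambda>t. det (B t)) ` {0..1}" "det (B 1) \<in> (\<lambda>t. det (B t)) ` {0..1}"
    by auto
  ultimately have "{det (B 1)..det (B 0)} \<subseteq> (\<lambda>t. det (B t)) ` {0..1}"
    by (intro connected_contains_Icc)
  moreover have "det (B 0) = 1" "B 1 = A" by (simp_all add: B_def)
  ultimately show ?thesis using nz by (metis (no_types, lifting) atLeastAtMost_iff image_iff not_le
      order_less_imp_le subsetD zero_le_one)
qed

lemma distortion_leI: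
  fixes A :: "real^'n^'n"
  assumes "s > 0" "\<And>v. norm (A *v v) \<le> M * s * norm v" "\<And>v. s * norm v \<le> M * norm (A *v v)" "M > 0"
    and "det A > 0"
  shows "distortion_le (M * M) A"
  unfolding distortion_le_def
proof (intro conjI exI[of _ "s / M"] allI)
  fix v
  show "s / M * norm v \<le> norm (A *v v)" using assms(3)[of v] assms(4) by (simp add: field_simps)
  show "norm (A *v v) \<le> M * M * (s / M) * norm v" using assms(2)[of v] assms(4) by simp
qed (use assms in auto)

lemma distortion_le_mult:
  assumes A: "distortion_le L A" and B: "distortion_le M B" and L: "L \<ge> 0"
  shows "distortion_le (L * M) (A ** B)"
proof -
  obtain s where s: "s > 0" "\<And>v. s * norm v \<le> norm (A *v v)" "\<And>v. norm (A *v v) \<le> L * s * norm v"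
    using A unfolding distortion_le_def by blast
  obtain t where t: "t > 0" "\<And>v. t * norm v \<le> norm (B *v v)" "\<And>v. norm (B *v v) \<le> M * t * norm v"
    using B unfolding distortion_le_def by blast
  have "det (A ** B) > 0" using A B by (simp add: det_mul distortion_le_def)
  moreover have "(s * t) * norm v \<le> norm ((A ** B) *v v)" for v
  proof -
    have "s * (t * norm v) \<le> s * norm (B *v v)" using t(2) s(1) by simp
    also have "\<dots> \<le> norm (A *v (B *v v))" by (rule s(2))
    finally show ?thesis by (simp add: matrix_vector_mul_assoc)
  qed
  moreover have "norm ((A ** B) *v v) \<le> (L * M) * (s * t) * norm v" for v
  proof -
    have "norm (A *v (B *v v)) \<le> L * s * norm (B *v v)" by (rule s(3))
    also have "\<dots> \<le> L * s * (M * t * norm v)" using t(3) s(1) L by (intro mult_left_mono) auto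
    finally show ?thesis by (simp add: matrix_vector_mul_assoc mult_ac)
  qed
  moreover have "s * t > 0" using s t by simp
  ultimately show ?thesis unfolding distortion_le_def by blast
qed

lemma distortion_le_mono: "distortion_le L A \<Longrightarrow> L \<le> M \<Longrightarrow> distortion_le M A"
  unfolding distortion_le_def by (meson less_imp_le mult_right_mono norm_ge_zero order_trans)

lemma distortion_le_scaleR:
  assumes "c > 0" shows "distortion_le 1 (c *\<^sub>R mat 1 :: real^'n^'n)"
proof -
  have "det (c *\<^sub>R mat 1 :: real^'n^'n) > 0"
    using assms by (intro det_pos_if_no_nonpos_eigenvalue)
      (simp add: scaleR_matrix_vector_assoc[symmetric])
  then show ?thesis using assms unfolding distortion_le_def
    by (intro conjI exI[of _ c]) (simp_all add: scaleR_matrix_vector_assoc[symmetric])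
qed

definition diag_mat :: "('n \<Rightarrow> real) \<Rightarrow> real^'n^'n" where
  "diag_mat a = (\<chi> i j. if i = j then a i else 0)"

lemma diag_mat_mult: "diag_mat a *v x = (\<chi> i. a i * x $ i)"
  by (simp add: diag_mat_def matrix_vector_mult_def vec_eq_iff if_distrib[of "\<lambda>t. t * _"] cong: if_cong)

lemma norm_diag_mat_sign:
  assumes "\<And>i. \<bar>a i\<bar> = 1" shows "norm (diag_mat a *v x) = norm x"
proof -
  have "(a i * x $ i)\<^sup>2 = (x $ i)\<^sup>2" for i
    using assms[of i] by (metis mult_1 power2_abs power_mult_distrib power_one)
  then show ?thesis by (simp add: diag_mat_mult norm_vec_def L2_set_def)
qed

text \<open>The entries of all powers of \<open>C\<close> are bounded by one, hence so are, up to the number of permutations, the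
powers of the determinant.\<close>

lemma abs_det_le_1_if_contraction:
  fixes C :: "real^'n^'n"
  assumes C: "\<And>v. norm (C *v v) \<le> norm v"
  shows "\<bar>det C\<bar> \<le> 1"
proof (rule ccontr)
  assume "\<not> \<bar>det C\<bar> \<le> 1"
  define P where "P k = (((**) C) ^^ k) (mat 1)" for k
  have nP: "norm (P k *v v) \<le> norm v" for k v
  proof (induction k)
    case (Suc k)
    have "P (Suc k) *v v = C *v (P k *v v)" by (simp add: P_def matrix_vector_mul_assoc)
    then show ?case using C[of "P k *v v"] Suc by simp
  qed (simp add: P_def)
  have dP: "det (P k) = det C ^ k" for k
    by (induction k) (simp_all add: P_def det_mul)
  have entry: "\<bar>P k $ i $ j\<bar> \<le> 1" for k i j
  proof -
    have "\<bar>P k $ i $ j\<bar> = \<bar>(P k *v axis j 1) $ i\<bar>"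
      by (simp add: matrix_vector_mult_basis column_def)
    also have "\<dots> \<le> norm (P k *v axis j 1)" by (rule component_le_norm_cart)
    also have "\<dots> \<le> 1" using nP[of k "axis j 1"] by (simp add: norm_axis_1)
    finally show ?thesis .
  qed
  let ?perms = "{p. p permutes (UNIV :: 'n set)}"
  have bound: "\<bar>det (P k)\<bar> \<le> real (card ?perms)" for k
  proof -
    have "\<bar>det (P k)\<bar> \<le> (\<Sum>p\<in>?perms. \<bar>of_int (sign p) * (\<Prod>i\<in>UNIV. P k $ i $ p i)\<bar>)"
      unfolding det_def by (rule sum_abs)
    also have "\<dots> \<le> (\<Sum>p\<in>?perms. 1)"
    proof (rule sum_mono)
      fix p
      have "\<bar>\<Prod>i\<in>UNIV. P k $ i $ p i\<bar> \<le> 1"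
        unfolding abs_prod by (rule prod_le_1) (simp add: entry)
      then show "\<bar>of_int (sign p) * (\<Prod>i\<in>UNIV. P k $ i $ p i)\<bar> \<le> 1"
        by (simp add: sign_def abs_mult)
    qed
    finally show ?thesis by simp
  qed
  obtain k where "real (card ?perms) < \<bar>det C\<bar> ^ k"
    using real_arch_pow[of "\<bar>det C\<bar>"] \<open>\<not> \<bar>det C\<bar> \<le> 1\<close> by auto
  with bound[of k] show False by (simp add: dP power_abs)
qed

text \<open>Applied to the rescaled inverse, the bound for contractions becomes a lower bound.\<close>

lemma det_ge_if_expanding:
  fixes A :: "real^'n^'n"
  assumes s: "s > 0" "\<And>v. s * norm v \<le> norm (A *v v)" and d: "det A > 0"
  shows "s ^ CARD('n) \<le> det A"
proof -
  have "invertible A" using d by (simp add: invertible_det_nz)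
  then obtain B where B: "A ** B = mat 1" unfolding invertible_def by blast
  let ?C = "diag_mat (\<lambda>_. s) ** B"
  have Cv: "?C *v v = s *\<^sub>R (B *v v)" for v
    by (simp add: matrix_vector_mul_assoc[symmetric] diag_mat_mult vec_eq_iff)
  have "norm (?C *v v) \<le> norm v" for v
    using s(2)[of "B *v v"] s(1) by (simp add: Cv matrix_vector_mul_assoc B)
  then have "\<bar>det ?C\<bar> \<le> 1" by (rule abs_det_le_1_if_contraction)
  moreover have "det ?C = s ^ CARD('n) * det B"
    by (simp add: det_mul) (simp add: diag_mat_def det_diagonal)
  moreover have AB: "det A * det B = 1" using B by (metis det_I det_mul)
  moreover have "det B > 0" using AB d by (metis zero_less_mult_pos zero_less_one)
  ultimately have "s ^ CARD('n) * det B \<le> det A * det B" using s(1) by simp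
  then show ?thesis using \<open>det B > 0\<close> by simp
qed

text \<open>The inequality in the definition of quasiregularity.\<close>

lemma onorm_power_le_det:
  fixes A :: "real^'n^'n"
  assumes A: "distortion_le L A" and L: "L \<ge> 0"
  shows "onorm (\<lambda>v. A *v v) ^ CARD('n) \<le> L ^ CARD('n) * det A"
proof -
  obtain s where s: "s > 0" "\<And>v. s * norm v \<le> norm (A *v v)" "\<And>v. norm (A *v v) \<le> L * s * norm v"
    using A unfolding distortion_le_def by blast
  have d: "det A > 0" using A by (simp add: distortion_le_def)
  have "onorm (\<lambda>v. A *v v) \<le> L * s"
    using s L by (intro onorm_bound) auto
  then have "onorm (\<lambda>v. A *v v) ^ CARD('n) \<le> (L * s) ^ CARD('n)"
    by (rule power_mono) (rule onorm_pos_le, rule matrix_vector_mul_bounded_linear)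
  also have "\<dots> \<le> L ^ CARD('n) * det A"
    using det_ge_if_expanding[OF s(1,2) d] L by (simp add: power_mult_distrib mult_left_mono)
  finally show ?thesis .
qed

text \<open>Near a point with injective derivative the map expands distances to that point by a definite
factor on a definite scale. Sorting the points by factor and scale gives
countably many sets on which \<open>f\<close> has locally a Lipschitz inverse, and Lipschitz maps preserve null sets.\<close>

lemma negligible_preimage:
  fixes f :: "'a::euclidean_space \<Rightarrow> 'a"
  assumes N: "negligible N"
    and f: "\<And>x. x \<in> U \<Longrightarrow> \<exists>f' s. (f has_derivative f') (at x) \<and> s > 0 \<and> (\<forall>v. s * norm v \<le> norm (f' v))"
  shows "negligible {x \<in> U. f x \<in> N}"
proof -
  define S where "S k = {x \<in> U. f x \<in> N \<and> (\<forall>y. dist y x < 1 / real (Suc k) \<longrightarrow>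
      dist y x \<le> real (Suc k) * dist (f y) (f x))}" for k :: nat
  have cover: "{x \<in> U. f x \<in> N} \<subseteq> (\<Union>k. S k)"
  proof
    fix x assume x: "x \<in> {x \<in> U. f x \<in> N}"
    then obtain f' s where D: "(f has_derivative f') (at x)" "s > 0" "\<And>v. s * norm v \<le> norm (f' v)"
      using f by blast
    obtain d where d: "d > 0" "\<And>y. norm (y - x) < d \<Longrightarrow>
        norm (f y - f x - f' (y - x)) \<le> s / 2 * norm (y - x)"
      using D(1,2) unfolding has_derivative_at_alt by (meson half_gt_zero)
    obtain k :: nat where k: "max (1 / d) (2 / s) < real k" using reals_Archimedean2 by blast
    have "x \<in> S k"
      unfolding S_def
    proof (intro CollectI conjI allI impI)
      fix y assume y: "dist y x < 1 / real (Suc k)"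
      have "1 / real (Suc k) < d" using k d(1) by (auto simp: field_simps)
      then have "norm (f y - f x - f' (y - x)) \<le> s / 2 * norm (y - x)"
        using y by (intro d(2)) (auto simp: dist_norm)
      moreover have "s * norm (y - x) \<le> norm (f' (y - x))" by (rule D(3))
      ultimately have "s / 2 * norm (y - x) \<le> norm (f y - f x)"
        using norm_triangle_ineq2[of "f' (y - x)" "f y - f x"] by (simp add: norm_minus_commute)
      then have "dist y x \<le> (2 / s) * dist (f y) (f x)"
        using D(2) by (simp add: dist_norm field_simps)
      also have "\<dots> \<le> real (Suc k) * dist (f y) (f x)" using k by (intro mult_right_mono) auto
      finally show "dist y x \<le> real (Suc k) * dist (f y) (f x)" .
    qed (use x in auto)
    then show "x \<in> (\<Union>k. S k)" by blast
  qed
  have "negligible (S k)" for k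
    unfolding locally_negligible_alt[of "S k"]
  proof (intro ballI)
    fix x assume "x \<in> S k"
    define V where "V = S k \<inter> ball x (1 / (2 * real (Suc k)))"
    have exp: "dist y z \<le> real (Suc k) * dist (f y) (f z)" if "y \<in> V" "z \<in> V" for y z
    proof -
      have "dist x y < 1 / (2 * real (Suc k))" "dist x z < 1 / (2 * real (Suc k))"
        using that by (auto simp: V_def)
      then have "dist y z < 1 / (2 * real (Suc k)) + 1 / (2 * real (Suc k))"
        using dist_triangle2[of y z x] by (simp add: dist_commute)
      then have "dist y z < 1 / real (Suc k)" by (simp add: field_simps)
      then show ?thesis using that(2) by (auto simp: V_def S_def)
    qed
    have inj: "inj_on f V"
      by (rule inj_onI) (metis dist_eq_0_iff exp mult_zero_right order_antisym zero_le_dist)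
    have "V = inv_into V f ` (f ` V)" using inj by (simp add: image_inv_into_cancel)
    moreover have "negligible (inv_into V f ` (f ` V))"
    proof (rule negligible_locally_Lipschitz_image)
      show "negligible (f ` V)"
        by (rule negligible_subset[OF N]) (auto simp: V_def S_def)
      fix y assume "y \<in> f ` V"
      then have "norm (inv_into V f z - inv_into V f y) \<le> real (Suc k) * norm (z - y)" if "z \<in> f ` V" for z
        using that exp[of "inv_into V f z" "inv_into V f y"] inj
        by (auto simp: dist_norm)
      then show "\<exists>T B. open T \<and> y \<in> T \<and>
          (\<forall>z\<in>f ` V \<inter> T. norm (inv_into V f z - inv_into V f y) \<le> B * norm (z - y))"
        by (intro exI[of _ UNIV] exI[of _ "real (Suc k)"]) auto
    qed simp
    ultimately have "negligible V" by simp
    moreover have "x \<in> V" using \<open>x \<in> S k\<close> by (simp add: V_def)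
    moreover have "openin (top_of_set (S k)) V" unfolding V_def by (simp add: openin_open_Int)
    ultimately show "\<exists>V. openin (top_of_set (S k)) V \<and> x \<in> V \<and> negligible V" by blast
  qed
  then have "negligible (\<Union>k. S k)" by (intro negligible_countable_Union) auto
  then show ?thesis using cover negligible_subset by blast
qed

definition differentiable_with_distortion :: "real \<Rightarrow> (real^'n \<Rightarrow> real^'n) \<Rightarrow> real^'n \<Rightarrow> bool" where
  "differentiable_with_distortion L f x \<longleftrightarrow>
     (\<exists>A. (f has_derivative (\<lambda>v. A *v v)) (at x) \<and> distortion_le L A)"

definition ae_distortion :: "real \<Rightarrow> (real^'n \<Rightarrow> real^'n) \<Rightarrow> (real^'n) set \<Rightarrow> bool" where
  "ae_distortion L f U \<longleftrightarrow> negligible {x \<in> U. \<not> differentiable_with_distortion L f x}"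

lemma differentiable_with_distortion_mono:
  "differentiable_with_distortion L f x \<Longrightarrow> L \<le> M \<Longrightarrow> differentiable_with_distortion M f x"
  unfolding differentiable_with_distortion_def using distortion_le_mono by blast

lemma ae_distortionI:
  assumes "negligible N" "\<And>x. x \<in> U \<Longrightarrow> x \<notin> N \<Longrightarrow> differentiable_with_distortion L f x"
  shows "ae_distortion L f U"
  unfolding ae_distortion_def by (rule negligible_subset[OF assms(1)]) (use assms(2) in blast)

lemma ae_distortion_mono:
  assumes "ae_distortion L f U" "V \<subseteq> U" "L \<le> M"
  shows "ae_distortion M f V"
  using assms(1) unfolding ae_distortion_def
  by (rule negligible_subset) (use assms differentiable_with_distortion_mono in blast)

lemma differentiable_with_distortion_cong:
  assumes "differentiable_with_distortion L f x" "open U" "x \<in> U" "\<And>y. y \<in> U \<Longrightarrow> g y = f y"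
  shows "differentiable_with_distortion L g x"
proof -
  obtain A where A: "(f has_derivative (\<lambda>v. A *v v)) (at x)" "distortion_le L A"
    using assms(1) unfolding differentiable_with_distortion_def by blast
  have "(g has_derivative (\<lambda>v. A *v v)) (at x)"
    by (rule has_derivative_transform_within_open[OF A(1) assms(2,3)]) (simp add: assms(4))
  then show ?thesis using A(2) unfolding differentiable_with_distortion_def by blast
qed

text \<open>The points where the outer map misbehaves form a null set, and so does their preimage.\<close>

lemma ae_distortion_compose:
  assumes g: "ae_distortion L g V" and f: "ae_distortion M f U" and sub: "f ` U \<subseteq> V" and L: "L \<ge> 0"
  shows "ae_distortion (L * M) (\<lambda>x. g (f x)) U"
proof (rule ae_distortionI)
  let ?Nf = "{x \<in> U. \<not> differentiable_with_distortion M f x}"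
  let ?Ng = "{x \<in> V. \<not> differentiable_with_distortion L g x}"
  let ?G = "{x \<in> U. differentiable_with_distortion M f x}"
  have "negligible {x \<in> ?G. f x \<in> ?Ng}"
  proof (rule negligible_preimage)
    show "negligible ?Ng" using g unfolding ae_distortion_def .
    fix x assume "x \<in> ?G"
    then show "\<exists>f' s. (f has_derivative f') (at x) \<and> s > 0 \<and> (\<forall>v. s * norm v \<le> norm (f' v))"
      unfolding differentiable_with_distortion_def distortion_le_def by blast
  qed
  then show "negligible (?Nf \<union> {x \<in> ?G. f x \<in> ?Ng})"
    using f unfolding ae_distortion_def by simp
  fix x assume x: "x \<in> U" "x \<notin> ?Nf \<union> {x \<in> ?G. f x \<in> ?Ng}"
  then have "differentiable_with_distortion M f x" "differentiable_with_distortion L g (f x)"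
    using sub by auto
  then obtain A B where "(f has_derivative (\<lambda>v. A *v v)) (at x)" "distortion_le M A"
      "(g has_derivative (\<lambda>v. B *v v)) (at (f x))" "distortion_le L B"
    unfolding differentiable_with_distortion_def by blast
  moreover from this have "((\<lambda>x. g (f x)) has_derivative (\<lambda>v. (B ** A) *v v)) (at x)"
    using has_derivative_compose[of f "\<lambda>v. A *v v" x UNIV g "\<lambda>v. B *v v"]
    by (simp add: matrix_vector_mul_assoc)
  ultimately show "differentiable_with_distortion (L * M) (\<lambda>x. g (f x)) x"
    unfolding differentiable_with_distortion_def using distortion_le_mult L by blast
qed

lemma ae_distortion_scaleR:
  assumes "c > 0" shows "ae_distortion 1 (\<lambda>x. c *\<^sub>R x) U"
proof (rule ae_distortionI[of "{}"])
  fix x :: "real^'n"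
  have "((\<lambda>x. c *\<^sub>R x) has_derivative (\<lambda>v. (c *\<^sub>R mat 1 :: real^'n^'n) *v v)) (at x)"
    by (auto intro!: derivative_eq_intros simp: scaleR_matrix_vector_assoc[symmetric])
  then show "differentiable_with_distortion 1 (\<lambda>x. c *\<^sub>R x) x"
    unfolding differentiable_with_distortion_def using distortion_le_scaleR[OF assms] by blast
qed simp

text \<open>Pre- and postcomposition with reflections: \<open>\<tau>\<close> is locally a composition of reflections and translations,
its determinant is the product of the signs \<open>b\<close>, and the signs \<open>a\<close> on the image side cancel that
product. Thus the folded map preserves orientation although the folding does not.\<close>

lemma ae_distortion_reflect:
  fixes a b :: "real^'n \<Rightarrow> 'n \<Rightarrow> real"
  assumes f: "ae_distortion L f U"
    and ab: "\<And>x i. x \<in> V \<Longrightarrow> \<bar>a x i\<bar> = 1" "\<And>x i. x \<in> V \<Longrightarrow> \<bar>b x i\<bar> = 1"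
      "\<And>x. x \<in> V \<Longrightarrow> (\<Prod>i\<in>UNIV. a x i) * (\<Prod>i\<in>UNIV. b x i) = 1"
    and \<tau>: "\<And>x. x \<in> V \<Longrightarrow> (\<tau> has_derivative (\<lambda>v. diag_mat (b x) *v v)) (at x)" "\<And>x. x \<in> V \<Longrightarrow> \<tau> x \<in> U"
    and F: "\<And>x. x \<in> V \<Longrightarrow> \<exists>W. open W \<and> x \<in> W \<and> (\<forall>y\<in>W. F y = diag_mat (a x) *v f (\<tau> y))"
  shows "ae_distortion L F V"
proof (rule ae_distortionI)
  let ?N = "{x \<in> U. \<not> differentiable_with_distortion L f x}"
  show "negligible {x \<in> V. \<tau> x \<in> ?N}"
  proof (rule negligible_preimage)
    show "negligible ?N" using f unfolding ae_distortion_def .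
    fix x assume x: "x \<in> V"
    have "norm (diag_mat (b x) *v v) = norm v" for v
      by (rule norm_diag_mat_sign) (rule ab(2)[OF x])
    then show "\<exists>f' s. (\<tau> has_derivative f') (at x) \<and> s > 0 \<and> (\<forall>v. s * norm v \<le> norm (f' v))"
      using x by (intro exI[of _ "\<lambda>v. diag_mat (b x) *v v"] exI[of _ 1]) (auto intro: \<tau>(1))
  qed
  fix x assume x: "x \<in> V" "x \<notin> {x \<in> V. \<tau> x \<in> ?N}"
  then have "differentiable_with_distortion L f (\<tau> x)" using \<tau>(2) by blast
  then obtain A where A: "(f has_derivative (\<lambda>v. A *v v)) (at (\<tau> x))" "distortion_le L A"
    unfolding differentiable_with_distortion_def by blast
  let ?B = "diag_mat (a x) ** (A ** diag_mat (b x))"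
  have "((\<lambda>y. f (\<tau> y)) has_derivative (\<lambda>v. A *v (diag_mat (b x) *v v))) (at x)"
    using has_derivative_compose[OF \<tau>(1)[OF x(1)] A(1)] .
  then have "((\<lambda>y. diag_mat (a x) *v f (\<tau> y)) has_derivative
      (\<lambda>v. diag_mat (a x) *v (A *v (diag_mat (b x) *v v)))) (at x)"
    by (rule bounded_linear.has_derivative[OF matrix_vector_mul_bounded_linear])
  then have D: "((\<lambda>y. diag_mat (a x) *v f (\<tau> y)) has_derivative (\<lambda>v. ?B *v v)) (at x)"
    by (simp add: matrix_vector_mul_assoc matrix_mul_assoc)
  obtain W where W: "open W" "x \<in> W" "\<And>y. y \<in> W \<Longrightarrow> F y = diag_mat (a x) *v f (\<tau> y)"
    using F[OF x(1)] by blast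
  have DF: "(F has_derivative (\<lambda>v. ?B *v v)) (at x)"
    by (rule has_derivative_transform_within_open[OF D W(1,2)]) (simp add: W(3))
  obtain s where s: "s > 0" "\<And>v. s * norm v \<le> norm (A *v v)" "\<And>v. norm (A *v v) \<le> L * s * norm v"
    using A(2) unfolding distortion_le_def by blast
  have na: "norm (diag_mat (a x) *v v) = norm v" for v
    by (rule norm_diag_mat_sign) (rule ab(1)[OF x(1)])
  have nb: "norm (diag_mat (b x) *v v) = norm v" for v
    by (rule norm_diag_mat_sign) (rule ab(2)[OF x(1)])
  have nB: "norm (?B *v v) = norm (A *v (diag_mat (b x) *v v))" for v
    by (simp add: matrix_vector_mul_assoc[symmetric] na)
  have "det (diag_mat (a x)) * det (diag_mat (b x)) = 1"
    using ab(3)[OF x(1)] by (simp add: diag_mat_def det_diagonal)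
  then have "det ?B = det A" by (simp add: det_mul algebra_simps)
  moreover have "s * norm v \<le> norm (?B *v v)" "norm (?B *v v) \<le> L * s * norm v" for v
    using s(2)[of "diag_mat (b x) *v v"] s(3)[of "diag_mat (b x) *v v"] by (simp_all add: nB nb)
  ultimately have "distortion_le L ?B"
    using A(2) s(1) unfolding distortion_le_def by auto
  then show "differentiable_with_distortion L F x"
    unfolding differentiable_with_distortion_def using DF by blast
qed

section \<open>Locally Lipschitz maps in Sobolev spaces\<close>

definition diff_quotient :: "(real^'n \<Rightarrow> real) \<Rightarrow> 'n \<Rightarrow> nat \<Rightarrow> real^'n \<Rightarrow> real" where
  "diff_quotient F j k x = real (Suc k) * (F (x + (1 / real (Suc k)) *\<^sub>R axis j 1) - F x)"

lemma diff_quotient_tendsto: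
  assumes "(F has_derivative F') (at x)"
  shows "(\<lambda>k. diff_quotient F j k x) \<longlonglongrightarrow> F' (axis j 1)"
proof -
  have lin: "linear F'" using assms has_derivative_linear by blast
  let ?h = "\<lambda>k::nat. (1 / real (Suc k)) *\<^sub>R axis j (1::real)"
  have h0: "?h \<longlonglongrightarrow> 0"
    using tendsto_scaleR[OF LIMSEQ_Suc[OF lim_1_over_n] tendsto_const[of "axis j (1::real)"]]
    by simp
  have nh: "norm (?h k) = 1 / real (Suc k)" for k by (simp add: norm_axis_1)
  have F'h: "F' (?h k) = (1 / real (Suc k)) * F' (axis j 1)" for k
    using linear_scale[OF lin, of "1 / real (Suc k)" "axis j 1"] by simp
  have "(\<lambda>h. norm (F (x + h) - F x - F' h) / norm h) \<midarrow>0\<rightarrow> 0"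
    using assms by (simp add: has_derivative_at)
  then have "(\<lambda>k. norm (F (x + ?h k) - F x - F' (?h k)) / norm (?h k)) \<longlonglongrightarrow> 0"
    by (rule filterlim_compose) (use h0 in \<open>auto simp: filterlim_at axis_eq_0_iff\<close>)
  moreover have "norm (F (x + ?h k) - F x - F' (?h k)) / norm (?h k)
      = \<bar>diff_quotient F j k x - F' (axis j 1)\<bar>" for k
  proof -
    have "diff_quotient F j k x - F' (axis j 1) = real (Suc k) * (F (x + ?h k) - F x - F' (?h k))"
      unfolding F'h diff_quotient_def by (simp add: field_simps)
    then show ?thesis unfolding nh by (simp add: abs_mult)
  qed
  ultimately show ?thesis by (simp add: tendsto_rabs_zero_iff LIM_zero_iff)
qed

lemma diff_quotient_bound:
  assumes "L-lipschitz_on (cball 0 (R + 1)) F" "norm x \<le> R"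
  shows "\<bar>diff_quotient F j k x\<bar> \<le> L"
proof -
  let ?h = "(1 / real (Suc k)) *\<^sub>R axis j (1::real)"
  have nh: "norm ?h = 1 / real (Suc k)" by (simp add: norm_axis_1)
  have "norm (x + ?h) \<le> R + 1"
  proof -
    have "1 / real (Suc k) \<le> 1" by simp
    then show ?thesis using norm_triangle_ineq[of x ?h] assms(2) nh by linarith
  qed
  then have "dist (F (x + ?h)) (F x) \<le> L * dist (x + ?h) x"
    using assms(2) by (intro lipschitz_onD[OF assms(1)]) auto
  then have "\<bar>F (x + ?h) - F x\<bar> \<le> L * (1 / real (Suc k))"
    by (simp add: dist_norm norm_axis_1)
  then show ?thesis
    by (simp add: diff_quotient_def abs_mult pos_le_divide_eq mult.commute del: of_nat_Suc)
qed

lemma diff_quotient_measurable: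
  assumes "continuous_on UNIV F"
  shows "diff_quotient F j k \<in> borel_measurable borel"
proof -
  have "continuous_on UNIV (diff_quotient F j k)"
    unfolding diff_quotient_def
    by (intro continuous_intros continuous_on_compose2[OF assms]) auto
  then show ?thesis by (rule borel_measurable_continuous_onI)
qed

lemma integral_lebesgue_translate:
  fixes F :: "'a::euclidean_space \<Rightarrow> real"
  assumes F: "F \<in> borel_measurable borel"
  shows "integral\<^sup>L lebesgue (\<lambda>x. F (x + a)) = integral\<^sup>L lebesgue F"
proof -
  have "integral\<^sup>L lebesgue (\<lambda>x. F (x + a)) = integral\<^sup>L lborel (\<lambda>x. F (a + x))"
    using F by (subst integral_completion) (auto simp: add.commute)
  also have "\<dots> = integral\<^sup>L (distr lborel borel ((+) a)) F"
    using F by (subst integral_distr) auto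
  also have "\<dots> = integral\<^sup>L lebesgue F"
    using F by (simp add: lborel_distr_plus integral_completion)
  finally show ?thesis .
qed

lemma integrable_lebesgue_if_bounded_support:
  fixes F :: "'a::euclidean_space \<Rightarrow> real"
  assumes "F \<in> borel_measurable lebesgue" "AE x in lebesgue. \<bar>F x\<bar> \<le> B" "\<And>x. R < norm x \<Longrightarrow> F x = 0"
  shows "integrable lebesgue F"
proof -
  have "integrable lebesgue (\<lambda>x. indicator (cball 0 R) x *\<^sub>R F x)"
    by (rule integrableI_bounded_set_indicator[where B = B])
       (use assms in \<open>auto simp: emeasure_bounded_finite[unfolded infinity_ennreal_def]\<close>)
  moreover have "(\<lambda>x. indicator (cball 0 R) x *\<^sub>R F x) = F"
    using assms(3) by (fastforce simp: indicator_def)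
  ultimately show ?thesis by simp
qed

text \<open>The integrals of the difference quotients vanish by translation invariance, and the Lipschitz bound
dominates them. So differentiability almost everywhere suffices for the derivative to integrate to zero, which
is the integration by parts formula once \<open>F\<close> is a product with a test function.\<close>

lemma integral_derivative_eq_0:
  fixes F g :: "real^'n \<Rightarrow> real"
  assumes F: "locally_lipschitz F" and supp: "\<And>x. R < norm x \<Longrightarrow> F x = 0"
    and g: "g \<in> borel_measurable lebesgue"
    and lim: "AE x in lebesgue. (\<lambda>k. diff_quotient F j k x) \<longlonglongrightarrow> g x"
  shows "integral\<^sup>L lebesgue g = 0"
proof -
  obtain L where L: "L-lipschitz_on (cball 0 ((R + 1) + 1)) F" "L > 0"
    using F by (rule locally_lipschitzE)
  have cont: "continuous_on UNIV F" by (rule locally_lipschitz_continuous_on[OF F])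
  have Fb: "F \<in> borel_measurable borel" by (rule borel_measurable_continuous_onI[OF cont])
  obtain B where B: "\<And>x. norm x \<le> R \<Longrightarrow> norm (F x) \<le> B"
    using F by (rule locally_lipschitz_bounded) blast
  have Fi: "integrable lebesgue F"
  proof (rule integrable_lebesgue_if_bounded_support[where R = R])
    have "\<bar>F x\<bar> \<le> max B 0" for x using B[of x] supp[of x] by (cases "norm x \<le> R") auto
    then show "AE x in lebesgue. \<bar>F x\<bar> \<le> max B 0" by simp
  qed (use Fb supp in \<open>auto intro: borel_measurable_if_lebesgue_on measurable_completion\<close>)
  have q0: "integral\<^sup>L lebesgue (diff_quotient F j k) = 0" for k
  proof -
    let ?a = "(1 / real (Suc k)) *\<^sub>R axis j (1::real)"
    have Fa: "integrable lebesgue (\<lambda>x. F (x + ?a))"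
    proof (rule integrable_lebesgue_if_bounded_support[where R = "R + norm ?a"])
      show "F (x + ?a) = 0" if "R + norm ?a < norm x" for x
        using that norm_triangle_sub[of x "x + ?a"] by (intro supp) (simp add: norm_minus_commute)
      have "\<bar>F x\<bar> \<le> max B 0" for x using B[of x] supp[of x] by (cases "norm x \<le> R") auto
      then show "AE x in lebesgue. \<bar>F (x + ?a)\<bar> \<le> max B 0" by simp
      have "(\<lambda>x. F (x + ?a)) \<in> borel_measurable borel" using Fb by measurable
      then show "(\<lambda>x. F (x + ?a)) \<in> borel_measurable lebesgue" by (simp add: measurable_completion)
    qed
    show ?thesis
      unfolding diff_quotient_def using Fi Fa integral_lebesgue_translate[OF Fb, of ?a] by simp
  qed
  have "(\<lambda>k. integral\<^sup>L lebesgue (diff_quotient F j k)) \<longlonglongrightarrow> integral\<^sup>L lebesgue g"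
  proof (rule integral_dominated_convergence[where w = "\<lambda>x. L * indicator (cball 0 (R + 1)) x"])
    have "integrable lebesgue (\<lambda>x. indicator (cball 0 (R + 1)) x *\<^sub>R L)"
      by (rule integrableI_bounded_set_indicator[where B = L])
         (use L in \<open>auto simp: emeasure_bounded_finite[unfolded infinity_ennreal_def]\<close>)
    then show "integrable lebesgue (\<lambda>x::real^'n. L * indicator (cball 0 (R + 1)) x)"
      by (simp add: mult.commute)
    show "diff_quotient F j k \<in> borel_measurable lebesgue" for k
      using diff_quotient_measurable[OF cont] by (simp add: measurable_completion)
    have "norm (diff_quotient F j k x) \<le> L * indicator (cball 0 (R + 1)) x" for k x
    proof (cases "norm x \<le> R + 1")
      case True
      then show ?thesis using diff_quotient_bound[OF L(1) True] by simp
    next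
      case False
      let ?a = "(1 / real (Suc k)) *\<^sub>R axis j (1::real)"
      have "norm ?a \<le> 1" by (simp add: norm_axis_1)
      then have "norm (x + ?a) > R"
        using False norm_triangle_ineq4[of "x + ?a" ?a] unfolding add_diff_cancel by linarith
      then show ?thesis using False by (simp add: diff_quotient_def supp)
    qed
    then show "AE x in lebesgue. norm (diff_quotient F j k x) \<le> L * indicator (cball 0 (R + 1)) x" for k
      by simp
  qed (use g lim in auto)
  then show ?thesis by (simp add: q0 LIMSEQ_const_iff)
qed

lemma test_function_imp:
  fixes \<phi> :: "real^'n \<Rightarrow> real"
  assumes "test_function \<phi>"
  obtains R where "locally_lipschitz \<phi>" "\<And>x. (\<phi> has_derivative frechet_derivative \<phi> (at x)) (at x)"
    "\<And>j. continuous_on UNIV (\<lambda>x. frechet_derivative \<phi> (at x) (axis j 1))"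
    "\<And>x. R < norm x \<Longrightarrow> \<phi> x = 0"
    "\<And>x j. R < norm x \<Longrightarrow> frechet_derivative \<phi> (at x) (axis j 1) = 0"
proof -
  let ?d = "\<lambda>j x. frechet_derivative \<phi> (at x) (axis j 1)"
  have "Ck_function (Suc 0) \<phi>" using assms unfolding test_function_def by blast
  then have df: "\<phi> differentiable_on UNIV" and c: "\<And>j. continuous_on UNIV (?d j)" by auto
  have D: "(\<phi> has_derivative frechet_derivative \<phi> (at x)) (at x)" for x
    using df by (simp add: differentiable_on_def frechet_derivative_works[symmetric])
  obtain R where R: "{x. \<phi> x \<noteq> 0} \<subseteq> cball 0 R"
    using assms unfolding test_function_def
    by (meson bounded_subset_ballD ball_subset_cball order_trans closure_subset compact_imp_bounded order_trans)
  then have z: "\<phi> x = 0" if "R < norm x" for x using that by force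
  have "?d j x = 0" if "R < norm x" for x j
  proof -
    have x: "x \<in> - cball 0 R" using that by simp
    have "(\<phi> has_derivative (\<lambda>_. 0)) (at x)"
      by (rule has_derivative_transform_within_open[OF has_derivative_const _ x])
         (auto simp: z open_Compl)
    then show ?thesis using has_derivative_unique[OF D] by (metis)
  qed
  moreover have "locally_lipschitz \<phi>"
    unfolding locally_lipschitz_def
  proof
    fix r
    have "\<exists>B. \<forall>x\<in>cball 0 r. \<bar>?d j x\<bar> \<le> B" for j
    proof -
      have "bounded (?d j ` cball 0 r)"
        by (intro compact_imp_bounded compact_continuous_image continuous_on_subset[OF c]) auto
      then show ?thesis unfolding bounded_iff by auto
    qed
    then obtain B where B: "\<And>j x. x \<in> cball 0 r \<Longrightarrow> \<bar>?d j x\<bar> \<le> B j" by metis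
    have "(\<Sum>j\<in>UNIV. \<bar>B j\<bar>)-lipschitz_on (cball 0 r) \<phi>"
    proof (rule bounded_derivative_imp_lipschitz)
      fix x :: "real^'n" assume x: "x \<in> cball 0 r"
      show "(\<phi> has_derivative frechet_derivative \<phi> (at x)) (at x within cball 0 r)"
        by (rule has_derivative_at_withinI[OF D])
      show "onorm (frechet_derivative \<phi> (at x)) \<le> (\<Sum>j\<in>UNIV. \<bar>B j\<bar>)"
      proof (rule onorm_bound)
        fix v :: "real^'n"
        have lin: "linear (frechet_derivative \<phi> (at x))" using D has_derivative_linear by blast
        have "(\<Sum>j\<in>UNIV. (v $ j) *\<^sub>R axis j 1) = v"
          by (simp add: vec_eq_iff axis_def if_distrib cong: if_cong)
        then have "frechet_derivative \<phi> (at x) v = (\<Sum>j\<in>UNIV. v $ j * ?d j x)"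
          using linear_sum[OF lin, of "\<lambda>j. (v $ j) *\<^sub>R axis j 1" UNIV]
          by (simp add: linear_scale[OF lin])
        also have "norm \<dots> \<le> (\<Sum>j\<in>UNIV. norm v * \<bar>B j\<bar>)"
        proof (rule sum_norm_le)
          fix j
          have "\<bar>v $ j\<bar> * \<bar>?d j x\<bar> \<le> norm v * \<bar>B j\<bar>"
            using component_le_norm_cart[of v j] B[OF x, of j] by (intro mult_mono) auto
          then show "norm (v $ j * ?d j x) \<le> norm v * \<bar>B j\<bar>" by (simp add: abs_mult)
        qed
        finally show "norm (frechet_derivative \<phi> (at x) v) \<le> (\<Sum>j\<in>UNIV. \<bar>B j\<bar>) * norm v"
          by (simp add: sum_distrib_left[symmetric] mult.commute)
      qed (simp add: sum_nonneg)
    qed (auto simp: sum_nonneg)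
    then show "\<exists>L. L-lipschitz_on (cball 0 r) \<phi>" by blast
  qed
  ultimately show thesis using that[OF _ D c z] by blast
qed

lemma Lp_loc_if_locally_bounded:
  fixes g :: "real^'n \<Rightarrow> 'b::euclidean_space"
  assumes m: "g \<in> borel_measurable lebesgue"
    and b: "\<And>R. \<exists>B. AE x in lebesgue. norm x \<le> R \<longrightarrow> norm (g x) \<le> B"
  shows "Lp_loc p g"
  unfolding Lp_loc_def
proof (intro conjI allI impI m)
  fix C :: "(real^'n) set" assume C: "compact C"
  then obtain R where R: "C \<subseteq> cball 0 R" by (meson bounded_subset_ballD ball_subset_cball order_trans compact_imp_bounded)
  obtain B where B: "AE x in lebesgue. norm x \<le> R \<longrightarrow> norm (g x) \<le> B" using b by blast
  show "set_integrable lebesgue C (\<lambda>x. norm (g x) ^ p)"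
    unfolding set_integrable_def
  proof (rule integrableI_bounded_set_indicator[where B = "B ^ p"])
    show "C \<in> sets lebesgue" using C by (simp add: borel_compact)
    show "(\<lambda>x. norm (g x) ^ p) \<in> borel_measurable lebesgue" using m by measurable
    show "emeasure lebesgue C < \<infinity>"
      using C emeasure_bounded_finite[OF compact_imp_bounded[OF C]] by (simp add: borel_compact)
    show "AE x in lebesgue. x \<in> C \<longrightarrow> norm (norm (g x) ^ p) \<le> B ^ p"
      using B R by (auto elim!: eventually_mono intro!: power_mono)
  qed
qed

text \<open>The entries of \<open>D\<close> are defined as limits of difference quotients at every point, which makes measurability
immediate; almost everywhere they are the entries of the derivative.\<close>

theorem quasiregular_if_ae_distortion:
  fixes f :: "real^'n \<Rightarrow> real^'n"
  assumes f: "locally_lipschitz f" and ae: "ae_distortion L f UNIV" and L: "L \<ge> 1"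
  shows "quasiregular f"
proof -
  define q where "q i j k = diff_quotient (\<lambda>x. f x $ i) j k" for i j k
  define D :: "real^'n \<Rightarrow> real^'n^'n" where "D x = (\<chi> i j. lim (\<lambda>k. q i j k x))" for x
  have fi: "locally_lipschitz (\<lambda>x. f x $ i)" for i by (rule locally_lipschitz_nth[OF f])
  have cont: "continuous_on UNIV f" by (rule locally_lipschitz_continuous_on[OF f])
  have conti: "continuous_on UNIV (\<lambda>x. f x $ i)" for i
    by (rule locally_lipschitz_continuous_on[OF fi])
  have D_eq: "D x = A" "(\<lambda>k. q i j k x) \<longlonglongrightarrow> A $ i $ j"
    if "(f has_derivative (\<lambda>v. A *v v)) (at x)" for x A i j
  proof -
    have lim: "(\<lambda>k. q i j k x) \<longlonglongrightarrow> A $ i $ j" for i j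
    proof -
      have "((\<lambda>x. f x $ i) has_derivative (\<lambda>v. (A *v v) $ i)) (at x)"
        using that by (rule bounded_linear.has_derivative[OF bounded_linear_vec_nth])
      from diff_quotient_tendsto[OF this, of j] show ?thesis
        by (simp add: q_def matrix_vector_mult_basis column_def)
    qed
    then show "D x = A" "(\<lambda>k. q i j k x) \<longlonglongrightarrow> A $ i $ j"
      by (simp_all add: D_def vec_eq_iff limI)
  qed
  have good: "AE x in lebesgue. \<exists>A. (f has_derivative (\<lambda>v. A *v v)) (at x) \<and> distortion_le L A"
  proof -
    have "{x. \<not> differentiable_with_distortion L f x} \<in> null_sets lebesgue"
      using ae by (simp add: ae_distortion_def negligible_iff_null_sets)
    then have "AE x in lebesgue. x \<notin> {x. \<not> differentiable_with_distortion L f x}"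
      by (rule AE_not_in)
    then show ?thesis by (simp add: differentiable_with_distortion_def)
  qed
  have Dij_meas: "(\<lambda>x. D x $ i $ j) \<in> borel_measurable borel" for i j
    unfolding D_def q_def using diff_quotient_measurable[OF conti] by simp
  have D_meas: "D \<in> borel_measurable lebesgue"
  proof -
    have "D \<in> borel_measurable borel"
      unfolding borel_measurable_euclidean_space[of D]
    proof
      fix b :: "real^'n^'n" assume "b \<in> Basis"
      then obtain i j where b: "b = axis i (axis j 1)" by (auto simp: Basis_vec_def)
      show "(\<lambda>x. D x \<bullet> b) \<in> borel_measurable borel"
        using Dij_meas by (simp add: b inner_axis)
    qed
    then show ?thesis by (simp add: measurable_completion)
  qed
  have D_bd: "\<exists>B. AE x in lebesgue. norm x \<le> R \<longrightarrow> norm (D x) \<le> B" for R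
  proof -
    obtain M where M: "M-lipschitz_on (cball 0 (R + 1)) f" "M > 0" using f by (rule locally_lipschitzE)
    have Mi: "M-lipschitz_on (cball 0 (R + 1)) (\<lambda>x. f x $ i)" for i
    proof (rule lipschitz_onI)
      fix x y :: "real^'n" assume xy: "x \<in> cball 0 (R + 1)" "y \<in> cball 0 (R + 1)"
      show "dist (f x $ i) (f y $ i) \<le> M * dist x y"
        using dist_vec_nth_le[of "f x" i "f y"] lipschitz_onD[OF M(1) xy] by linarith
    qed (use M in simp)
    have "norm (D x) \<le> (\<Sum>i\<in>(UNIV::'n set). \<Sum>j\<in>(UNIV::'n set). M)"
      if nx: "norm x \<le> R" and ex: "\<exists>A. (f has_derivative (\<lambda>v. A *v v)) (at x) \<and> distortion_le L A" for x
    proof -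
      obtain A where A: "(f has_derivative (\<lambda>v. A *v v)) (at x)" using ex by blast
      have "\<bar>D x $ i $ j\<bar> \<le> M" for i j
      proof (rule LIMSEQ_le_const2)
        show "(\<lambda>k. \<bar>q i j k x\<bar>) \<longlonglongrightarrow> \<bar>D x $ i $ j\<bar>"
          using D_eq[OF A] by (intro tendsto_rabs) simp
        show "\<exists>N. \<forall>n\<ge>N. \<bar>q i j n x\<bar> \<le> M"
          unfolding q_def using diff_quotient_bound[OF Mi nx] by blast
      qed
      then have "(\<Sum>j\<in>UNIV. \<bar>D x $ i $ j\<bar>) \<le> (\<Sum>j\<in>(UNIV::'n set). M)" for i
        by (intro sum_mono)
      then have "norm (D x $ i) \<le> (\<Sum>j\<in>(UNIV::'n set). M)" for i
        using norm_le_l1_cart[of "D x $ i"] by (meson order_trans)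
      then have "(\<Sum>i\<in>UNIV. norm (D x $ i)) \<le> (\<Sum>i\<in>(UNIV::'n set). \<Sum>j\<in>(UNIV::'n set). M)"
        by (intro sum_mono)
      moreover have "norm (D x) \<le> (\<Sum>i\<in>UNIV. norm (D x $ i))"
        unfolding norm_vec_def[of "D x"] by (rule L2_set_le_sum) simp
      ultimately show ?thesis by linarith
    qed
    then show ?thesis using good by (intro exI) (auto elim!: eventually_mono)
  qed
  have f_bd: "\<exists>B. AE x in lebesgue. norm x \<le> R \<longrightarrow> norm (f x) \<le> B" for R
    by (rule locally_lipschitz_bounded[OF f, of R]) blast
  have f_meas: "f \<in> borel_measurable lebesgue"
    using borel_measurable_continuous_onI[OF cont] by (simp add: measurable_completion)
  have "integral\<^sup>L lebesgue (\<lambda>x. f x $ i * frechet_derivative \<phi> (at x) (axis j 1))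
      = - integral\<^sup>L lebesgue (\<lambda>x. D x $ i $ j * \<phi> x)" if \<phi>: "test_function \<phi>" for \<phi> i j
  proof -
    obtain R where R: "locally_lipschitz \<phi>" "\<And>x. (\<phi> has_derivative frechet_derivative \<phi> (at x)) (at x)"
      "\<And>j. continuous_on UNIV (\<lambda>x. frechet_derivative \<phi> (at x) (axis j 1))"
      "\<And>x. R < norm x \<Longrightarrow> \<phi> x = 0"
      "\<And>x j. R < norm x \<Longrightarrow> frechet_derivative \<phi> (at x) (axis j 1) = 0"
      using \<phi> by (rule test_function_imp) blast
    let ?d = "\<lambda>x. frechet_derivative \<phi> (at x) (axis j 1)"
    have phi_c: "continuous_on UNIV \<phi>" by (rule locally_lipschitz_continuous_on[OF R(1)])
    have phi_m: "\<phi> \<in> borel_measurable lebesgue"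
      using borel_measurable_continuous_onI[OF phi_c] by (simp add: measurable_completion)
    have fd_c: "continuous_on UNIV (\<lambda>x. f x $ i * ?d x)" by (intro continuous_on_mult conti R(3))
    have fd_m: "(\<lambda>x. f x $ i * ?d x) \<in> borel_measurable lebesgue"
      using borel_measurable_continuous_onI[OF fd_c] by (simp add: measurable_completion)
    have Dphi_m: "(\<lambda>x. D x $ i $ j * \<phi> x) \<in> borel_measurable lebesgue"
      using Dij_meas phi_m by (intro borel_measurable_times) (auto simp: measurable_completion)
    have i1: "integrable lebesgue (\<lambda>x. f x $ i * ?d x)"
    proof -
      have "bounded ((\<lambda>x. f x $ i * ?d x) ` cball 0 R)"
        by (intro compact_imp_bounded compact_continuous_image continuous_on_subset[OF fd_c]) auto
      then obtain B where "\<forall>x\<in>cball 0 R. \<bar>f x $ i * ?d x\<bar> \<le> B"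
        unfolding bounded_iff by auto
      then have B: "\<And>x. norm x \<le> R \<Longrightarrow> \<bar>f x $ i * ?d x\<bar> \<le> B" by simp
      have "\<bar>f x $ i * ?d x\<bar> \<le> max B 0" for x
        using B[of x] R(5)[of x] by (cases "norm x \<le> R") auto
      then show ?thesis
        by (intro integrable_lebesgue_if_bounded_support[where R = R and B = "max B 0"] fd_m)
           (auto simp: R(5))
    qed
    have i2: "integrable lebesgue (\<lambda>x. D x $ i $ j * \<phi> x)"
    proof -
      obtain B where B: "AE x in lebesgue. norm x \<le> R \<longrightarrow> norm (D x) \<le> B" using D_bd by blast
      obtain C where C: "\<And>x. norm x \<le> R \<Longrightarrow> norm (\<phi> x) \<le> C"
        using R(1) by (rule locally_lipschitz_bounded) blast
      have "\<bar>D x $ i $ j * \<phi> x\<bar> \<le> \<bar>B\<bar> * \<bar>C\<bar>" if "norm x \<le> R \<longrightarrow> norm (D x) \<le> B" for x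
      proof (cases "norm x \<le> R")
        case True
        have "\<bar>D x $ i $ j\<bar> \<le> norm (D x)"
          using component_le_norm_cart[of "D x $ i" j] Finite_Cartesian_Product.norm_nth_le[of "D x" i] by linarith
        then show ?thesis using C[OF True] that True unfolding abs_mult
          by (intro mult_mono) auto
      next
        case False
        then show ?thesis by (simp add: R(4))
      qed
      then show ?thesis
        by (intro integrable_lebesgue_if_bounded_support[where R = R and B = "\<bar>B\<bar> * \<bar>C\<bar>"] Dphi_m)
           (use B in \<open>auto simp: R(4) elim!: eventually_mono\<close>)
    qed
    have "integral\<^sup>L lebesgue (\<lambda>x. f x $ i * ?d x + D x $ i $ j * \<phi> x) = 0"
    proof (rule integral_derivative_eq_0)
      show "locally_lipschitz (\<lambda>x. f x $ i * \<phi> x)" by (rule locally_lipschitz_mult[OF fi R(1)])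
      show "R < norm x \<Longrightarrow> f x $ i * \<phi> x = 0" for x by (simp add: R(4))
      show "(\<lambda>x. f x $ i * ?d x + D x $ i $ j * \<phi> x) \<in> borel_measurable lebesgue"
        using fd_m Dphi_m by (rule borel_measurable_add)
      have "(\<lambda>k. diff_quotient (\<lambda>x. f x $ i * \<phi> x) j k x) \<longlonglongrightarrow> f x $ i * ?d x + D x $ i $ j * \<phi> x"
        if "(f has_derivative (\<lambda>v. A *v v)) (at x)" for x A
      proof -
        have "((\<lambda>x. f x $ i) has_derivative (\<lambda>v. (A *v v) $ i)) (at x)"
          using that by (rule bounded_linear.has_derivative[OF bounded_linear_vec_nth])
        from has_derivative_mult[OF this R(2)[of x]]
        have "((\<lambda>x. f x $ i * \<phi> x) has_derivative
            (\<lambda>v. f x $ i * frechet_derivative \<phi> (at x) v + (A *v v) $ i * \<phi> x)) (at x)" .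
        from diff_quotient_tendsto[OF this, of j] show ?thesis
          using D_eq(1)[OF that] by (simp add: matrix_vector_mult_basis column_def)
      qed
      then show "AE x in lebesgue. (\<lambda>k. diff_quotient (\<lambda>x. f x $ i * \<phi> x) j k x)
          \<longlonglongrightarrow> f x $ i * ?d x + D x $ i $ j * \<phi> x"
        using good by (auto elim!: eventually_mono)
    qed
    then show ?thesis using i1 i2 by simp
  qed
  then have "W1p_loc p f D" for p
    unfolding W1p_loc_def weak_derivative_def
    using Lp_loc_if_locally_bounded[OF f_meas f_bd] Lp_loc_if_locally_bounded[OF D_meas D_bd] by blast
  moreover have "AE x in lebesgue. onorm (\<lambda>v. D x *v v) ^ CARD('n) \<le> L ^ CARD('n) * det (D x)"
    using good
  proof (rule eventually_mono)
    fix x assume "\<exists>A. (f has_derivative (\<lambda>v. A *v v)) (at x) \<and> distortion_le L A"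
    then obtain A where A: "(f has_derivative (\<lambda>v. A *v v)) (at x)" "distortion_le L A" by blast
    show "onorm (\<lambda>v. D x *v v) ^ CARD('n) \<le> L ^ CARD('n) * det (D x)"
      using onorm_power_le_det[OF A(2)] L by (simp add: D_eq(1)[OF A(1)])
  qed
  moreover have "1 \<le> L ^ CARD('n)" using L by simp
  ultimately show ?thesis unfolding quasiregular_def using cont by blast
qed

section \<open>A norm adapted to cubes, and maps with a planar profile\<close>

text \<open>One coordinate, whichever it is, is singled out as the height; the remaining ones are called horizontal.\<close>

definition vert :: "'n::finite" where "vert = undefined"

definition with_height :: "real^'n \<Rightarrow> real \<Rightarrow> real^'n" where
  "with_height x s = (\<chi> i. if i = vert then s else x $ i)"

text \<open>The sup norm of the horizontal coordinates.\<close>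

definition hnorm :: "real^'n \<Rightarrow> real" where
  "hnorm x = infnorm (with_height x 0)"

text \<open>The norm whose unit ball is the double cone (pyramid) over the horizontal cube.\<close>

definition cnorm :: "real^'n \<Rightarrow> real" where
  "cnorm x = hnorm x + \<bar>x $ vert\<bar>"

lemma with_height_nth: "with_height x s $ i = (if i = vert then s else x $ i)"
  by (simp add: with_height_def)

lemma with_height_simps [simp]:
  "with_height x s $ vert = s" "with_height (with_height x t) s = with_height x s"
  "i \<noteq> vert \<Longrightarrow> with_height x s $ i = x $ i" "with_height x (x $ vert) = x"
  by (auto simp: with_height_nth vec_eq_iff)

lemma hnorm_with_height [simp]: "hnorm (with_height x s) = hnorm x"
  by (simp add: hnorm_def)

lemma hnorm_ge_0 [simp]: "0 \<le> hnorm x" by (simp add: hnorm_def infnorm_pos_le)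

lemma component_le_hnorm: "i \<noteq> vert \<Longrightarrow> \<bar>x $ i\<bar> \<le> hnorm x"
  using component_le_infnorm_cart[of "with_height x 0" i] by (simp add: hnorm_def)

lemma infnorm_le_cart: "(\<And>i. \<bar>(x::real^'n) $ i\<bar> \<le> b) \<Longrightarrow> infnorm x \<le> b"
  unfolding infnorm_cart by (rule cSup_least) auto

lemma hnorm_le: "0 \<le> b \<Longrightarrow> (\<And>i. i \<noteq> vert \<Longrightarrow> \<bar>x $ i\<bar> \<le> b) \<Longrightarrow> hnorm x \<le> b"
  unfolding hnorm_def by (rule infnorm_le_cart) (auto simp: with_height_nth)

lemma hnorm_cong: "(\<And>i. i \<noteq> vert \<Longrightarrow> \<bar>x $ i\<bar> = \<bar>y $ i\<bar>) \<Longrightarrow> hnorm x = hnorm y"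
  by (intro order_antisym hnorm_le) (auto simp: component_le_hnorm, metis component_le_hnorm)

lemma hnorm_scaleR [simp]: "hnorm (c *\<^sub>R x) = \<bar>c\<bar> * hnorm x"
proof -
  have "with_height (c *\<^sub>R x) 0 = c *\<^sub>R with_height x 0" by (auto simp: vec_eq_iff with_height_nth)
  then show ?thesis by (simp add: hnorm_def infnorm_mul)
qed

lemma hnorm_0 [simp]: "hnorm 0 = 0"
  using hnorm_scaleR[of 0 0] by simp

lemma hnorm_diff_le: "\<bar>hnorm x - hnorm y\<bar> \<le> norm (x - y)"
proof -
  have eq: "with_height x 0 - with_height y 0 = with_height (x - y) 0"
    by (auto simp: vec_eq_iff with_height_nth)
  have "\<bar>hnorm x - hnorm y\<bar> \<le> infnorm (with_height (x - y) 0)"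
    unfolding hnorm_def eq[symmetric] by (rule absdiff_infnorm)
  also have "\<dots> \<le> norm (x - y)"
  proof (rule infnorm_le_cart)
    show "\<bar>with_height (x - y) 0 $ i\<bar> \<le> norm (x - y)" for i
      using component_le_norm_cart[of "x - y" i] by (simp add: with_height_nth)
  qed
  finally show ?thesis .
qed

lemma locally_lipschitz_hnorm: "locally_lipschitz hnorm"
  by (rule locally_lipschitz_global[of 1], rule lipschitz_onI) (auto simp: dist_norm hnorm_diff_le)

lemma locally_lipschitz_cnorm: "locally_lipschitz cnorm"
  unfolding cnorm_def
  by (intro locally_lipschitz_add locally_lipschitz_hnorm locally_lipschitz_abs
      locally_lipschitz_bounded_linear bounded_linear_vec_nth)

lemma continuous_on_hnorm [continuous_intros]:
  "continuous_on S f \<Longrightarrow> continuous_on S (\<lambda>x. hnorm (f x))"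
  by (rule continuous_on_compose2[OF locally_lipschitz_continuous_on[OF locally_lipschitz_hnorm]]) auto

lemma continuous_on_cnorm [continuous_intros]:
  "continuous_on S f \<Longrightarrow> continuous_on S (\<lambda>x. cnorm (f x))"
  by (rule continuous_on_compose2[OF locally_lipschitz_continuous_on[OF locally_lipschitz_cnorm]]) auto

lemma cnorm_ge_0 [simp]: "0 \<le> cnorm x" by (simp add: cnorm_def)

lemma cnorm_scaleR [simp]: "cnorm (c *\<^sub>R x) = \<bar>c\<bar> * cnorm x"
  by (simp add: cnorm_def abs_mult distrib_left)

lemma norm_le_cnorm: "norm (x::real^'n) \<le> real CARD('n) * cnorm x"
proof -
  have "norm x \<le> (\<Sum>i\<in>UNIV. \<bar>x $ i\<bar>)" by (rule norm_le_l1_cart)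
  also have "\<dots> \<le> (\<Sum>i\<in>(UNIV::'n set). cnorm x)"
  proof (rule sum_mono)
    show "\<bar>x $ i\<bar> \<le> cnorm x" for i
      using component_le_hnorm[of i x] by (cases "i = vert") (auto simp: cnorm_def)
  qed
  finally show ?thesis by simp
qed

lemma cnorm_le_norm: "cnorm x \<le> 2 * norm x"
  using hnorm_diff_le[of x 0] component_le_norm_cart[of x vert]
  by (simp add: cnorm_def)

lemma cnorm_eq_0 [simp]: "cnorm x = 0 \<longleftrightarrow> x = 0"
proof
  assume "cnorm x = 0"
  then show "x = 0" using norm_le_cnorm[of x] by simp
qed (simp add: cnorm_def)

lemma cnorm_pos: "x \<noteq> 0 \<Longrightarrow> 0 < cnorm x"
  using cnorm_ge_0[of x] cnorm_eq_0[of x] by linarith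

lemma locally_lipschitz_with_height:
  assumes "locally_lipschitz f" "locally_lipschitz g"
  shows "locally_lipschitz (\<lambda>x. with_height (f x) (g x))"
proof (rule locally_lipschitz_vec)
  show "locally_lipschitz (\<lambda>x. with_height (f x) (g x) $ i)" for i
    using assms locally_lipschitz_nth[OF assms(1), of i] by (cases "i = vert") simp_all
qed

text \<open>The open set where a single coordinate realises \<open>hnorm\<close>, which is therefore differentiable there.\<close>

definition dominant :: "real^'n \<Rightarrow> 'n \<Rightarrow> bool" where
  "dominant x j \<longleftrightarrow> j \<noteq> vert \<and> x $ j \<noteq> 0 \<and> (\<forall>i. i \<noteq> vert \<longrightarrow> i \<noteq> j \<longrightarrow> \<bar>x $ i\<bar> < \<bar>x $ j\<bar>)"

lemma hnorm_dominant: "dominant x j \<Longrightarrow> hnorm x = \<bar>x $ j\<bar>"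
  unfolding dominant_def
  by (intro order_antisym hnorm_le component_le_hnorm) (auto simp: less_imp_le)

lemma open_dominant: "open {x. dominant x j}"
proof (cases "j = vert")
  case False
  then have eq: "{x. dominant x j} = {x. x $ j \<noteq> 0} \<inter> (\<Inter>i\<in>{i. i \<noteq> vert \<and> i \<noteq> j}. {x. \<bar>x $ i\<bar> < \<bar>x $ j\<bar>})"
    unfolding dominant_def by auto
  show ?thesis unfolding eq
    by (intro open_Int open_INT ballI open_Collect_neq open_Collect_less continuous_intros) auto
qed (simp add: dominant_def)

lemma hnorm_has_derivative:
  assumes "dominant x j"
  shows "(hnorm has_derivative (\<lambda>v. sgn (x $ j) * v $ j)) (at x)"
proof (rule has_derivative_transform_within_open)
  let ?S = "{y. dominant y j} \<inter> {y. 0 < sgn (x $ j) * y $ j}"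
  show "((\<lambda>y. sgn (x $ j) * y $ j) has_derivative (\<lambda>v. sgn (x $ j) * v $ j)) (at x)"
    by (intro bounded_linear_imp_has_derivative bounded_linear_mult_right[THEN bounded_linear_compose]
        bounded_linear_vec_nth)
  show "open ?S"
    by (intro open_Int open_dominant open_Collect_less continuous_intros)
  show "x \<in> ?S" using assms by (auto simp: dominant_def sgn_if)
  show "sgn (x $ j) * y $ j = hnorm y" if "y \<in> ?S" for y
    using that hnorm_dominant[of y j] by (auto simp: sgn_if split: if_splits)
qed

lemma negligible_not_dominant:
  assumes "CARD('n) \<ge> 2"
  shows "negligible {x::real^'n. \<nexists>j. dominant x j}"
proof -
  define H where "H a b c = {x::real^'n. (a *\<^sub>R axis (fst b) 1 + c *\<^sub>R axis (snd b) 1) \<bullet> x = 0}" for a b c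
  let ?P = "{p::'n \<times> 'n. fst p \<noteq> snd p}"
  have negH: "negligible (H a p c)" if "fst p \<noteq> snd p" "a \<noteq> 0" for a p c
  proof -
    have "(a *\<^sub>R axis (fst p) 1 + c *\<^sub>R axis (snd p) (1::real)) $ fst p = a"
      using that by (simp add: axis_def)
    then have "a *\<^sub>R axis (fst p) 1 + c *\<^sub>R axis (snd p) (1::real) \<noteq> 0"
      using that by (metis zero_index)
    then show ?thesis unfolding H_def by (intro negligible_hyperplane) simp
  qed
  have "negligible (\<Union>p\<in>?P. H 1 p 0 \<union> H 1 p 1 \<union> H 1 p (-1))"
    by (intro negligible_Union) (auto intro!: negH)
  moreover have "{x::real^'n. \<nexists>j. dominant x j} \<subseteq> (\<Union>p\<in>?P. H 1 p 0 \<union> H 1 p 1 \<union> H 1 p (-1))"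
  proof
    fix x :: "real^'n" assume x: "x \<in> {x. \<nexists>j. dominant x j}"
    have "\<exists>k. k \<noteq> (vert::'n)"
    proof (rule ccontr)
      assume "\<nexists>k. k \<noteq> (vert::'n)"
      then have "(UNIV::'n set) = {vert}" by auto
      then show False using assms by (metis card_1_singleton_iff One_nat_def Suc_1 not_less_eq_eq order_refl)
    qed
    then obtain k where k: "k \<noteq> (vert::'n)" by blast
    let ?I = "{i. i \<noteq> (vert::'n)}"
    have "Max ((\<lambda>i. \<bar>x $ i\<bar>) ` ?I) \<in> (\<lambda>i. \<bar>x $ i\<bar>) ` ?I" using k by (intro Max_in) auto
    then obtain j where "j \<in> ?I" "Max ((\<lambda>i. \<bar>x $ i\<bar>) ` ?I) = \<bar>x $ j\<bar>" by blast
    then have j: "j \<noteq> vert" "\<And>i. i \<noteq> vert \<Longrightarrow> \<bar>x $ i\<bar> \<le> \<bar>x $ j\<bar>"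
      using Max_ge[of "(\<lambda>i. \<bar>x $ i\<bar>) ` ?I"] by auto
    have ip: "(a *\<^sub>R axis i 1 + c *\<^sub>R axis l 1) \<bullet> x = a * x $ i + c * x $ l" for a c i l
      by (simp add: inner_add_left inner_axis')
    have "\<not> dominant x j" using x by blast
    then consider "x $ j = 0" | i where "i \<noteq> vert" "i \<noteq> j" "\<bar>x $ i\<bar> = \<bar>x $ j\<bar>"
      using j unfolding dominant_def by (metis not_less order_antisym)
    then show "x \<in> (\<Union>p\<in>?P. H 1 p 0 \<union> H 1 p 1 \<union> H 1 p (-1))"
    proof cases
      case 1
      then have "x \<in> H 1 (j, vert) 0" unfolding H_def by (simp add: inner_axis')
      then show ?thesis using j(1) by (intro UN_I[of "(j, vert)"]) auto
    next
      case (2 i)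
      then have "x $ i = x $ j \<or> x $ i = - x $ j" by (auto simp: abs_if split: if_splits)
      then have "x \<in> H 1 (i, j) 1 \<union> H 1 (i, j) (-1)" unfolding H_def by (auto simp: inner_add_left inner_diff_left inner_axis')
      then show ?thesis using 2 by (intro UN_I[of "(i, j)"]) auto
    qed
  qed
  ultimately show ?thesis using negligible_subset by blast
qed

text \<open>The planar map \<open>(r, z) \<mapsto> (k r z * r, g r z)\<close> determines the derivative: it acts on the dominant
coordinate and the height by the Jacobian matrix of this planar map, and multiplies the other
coordinates, modulo those two, by \<open>k r z\<close>. Cramer's rule bounds the inverse. If the Jacobian
is positive and the trace is nonnegative, then the planar matrix has no eigenvalue in \<open>(-\<infinity>, 0]\<close>, which
gives the sign of the determinant. The scale \<open>s\<close> makes the bound independent of conformal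
factors.\<close>

lemma profile_distortion:
  fixes x :: "real^'n" and k g :: "real \<Rightarrow> real \<Rightarrow> real"
  defines "r \<equiv> hnorm x" and "z \<equiv> x $ vert"
  assumes dom: "dominant x j"
    and k: "((\<lambda>p. k (fst p) (snd p)) has_derivative (\<lambda>p. kr * fst p + kz * snd p)) (at (r, z))"
    and g: "((\<lambda>p. g (fst p) (snd p)) has_derivative (\<lambda>p. gr * fst p + gz * snd p)) (at (r, z))"
    and s: "s > 0" and M: "M \<ge> 1"
    and k0: "s \<le> M * k r z" "k r z \<le> M * s"
    and b: "\<bar>r * kr\<bar> \<le> M * s" "\<bar>r * kz\<bar> \<le> M * s" "\<bar>gr\<bar> \<le> M * s" "\<bar>gz\<bar> \<le> M * s"
    and J: "s\<^sup>2 \<le> M * ((k r z + r * kr) * gz - r * kz * gr)"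
    and tr: "0 \<le> k r z + r * kr + gz"
  shows "differentiable_with_distortion ((7 * real CARD('n) * M ^ 4) * (7 * real CARD('n) * M ^ 4))
     (\<lambda>x. with_height (k (hnorm x) (x $ vert) *\<^sub>R x) (g (hnorm x) (x $ vert))) x"
proof -
  let ?n = "real CARD('n)"
  define \<sigma> where "\<sigma> = sgn (x $ j)"
  have j: "j \<noteq> vert" "x $ j \<noteq> 0" using dom by (auto simp: dominant_def)
  have sig: "\<bar>\<sigma>\<bar> = 1" "\<sigma> * \<sigma> = 1" "\<sigma> * x $ j = r"
    using j by (auto simp: \<sigma>_def r_def hnorm_dominant[OF dom] sgn_if)
  define A' where "A' v = with_height (k r z *\<^sub>R v + (kr * (\<sigma> * v $ j) + kz * v $ vert) *\<^sub>R x)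
      (gr * (\<sigma> * v $ j) + gz * v $ vert)" for v
  have pair: "((\<lambda>x. (hnorm x, x $ vert)) has_derivative (\<lambda>v. (\<sigma> * v $ j, v $ vert))) (at x)"
    unfolding \<sigma>_def
    by (intro has_derivative_Pair hnorm_has_derivative[OF dom]
        bounded_linear_imp_has_derivative bounded_linear_vec_nth)
  have Dk: "((\<lambda>x. k (hnorm x) (x $ vert)) has_derivative (\<lambda>v. kr * (\<sigma> * v $ j) + kz * v $ vert)) (at x)"
    using has_derivative_compose[OF pair k[unfolded r_def z_def]] by simp
  have Dg: "((\<lambda>x. g (hnorm x) (x $ vert)) has_derivative (\<lambda>v. gr * (\<sigma> * v $ j) + gz * v $ vert)) (at x)"
    using has_derivative_compose[OF pair g[unfolded r_def z_def]] by simp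
  let ?F = "\<lambda>x. with_height (k (hnorm x) (x $ vert) *\<^sub>R x) (g (hnorm x) (x $ vert))"
  have D: "(?F has_derivative A') (at x)"
  proof (subst has_derivative_componentwise_within, intro ballI)
    fix b :: "real^'n" assume "b \<in> Basis"
    then obtain i where b: "b = axis i 1" by (auto simp: Basis_vec_def)
    have "((\<lambda>x. k (hnorm x) (x $ vert) *\<^sub>R x) has_derivative
       (\<lambda>v. k r z *\<^sub>R v + (kr * (\<sigma> * v $ j) + kz * v $ vert) *\<^sub>R x)) (at x)"
      using has_derivative_scaleR[OF Dk has_derivative_ident] by (simp add: r_def z_def)
    then have "((\<lambda>x. (k (hnorm x) (x $ vert) *\<^sub>R x) $ i) has_derivative
       (\<lambda>v. (k r z *\<^sub>R v + (kr * (\<sigma> * v $ j) + kz * v $ vert) *\<^sub>R x) $ i)) (at x)"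
      by (rule bounded_linear.has_derivative[OF bounded_linear_vec_nth])
    then show "((\<lambda>x. ?F x \<bullet> b) has_derivative (\<lambda>v. A' v \<bullet> b)) (at x)"
      using Dg by (cases "i = vert") (auto simp: b inner_axis A'_def with_height_nth)
  qed
  define A where "A = matrix A'"
  have Av: "A *v v = A' v" for v
    unfolding A_def using has_derivative_linear[OF D] by (simp add: matrix_works)
  define Rr where "Rr = k r z + r * kr"
  define Rz where "Rz = r * kz"
  define Jac where "Jac = Rr * gz - Rz * gr"
  have kpos: "k r z > 0" using s M k0(1) by (metis less_le_trans zero_less_mult_pos2 zero_less_one
    mult.commute zero_less_mult_pos)
  have Jpos: "Jac > 0"
  proof -
    have "0 < M * Jac" using J s by (simp add: Jac_def Rr_def Rz_def) (smt (verit) zero_less_power)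
    then show ?thesis using M by (simp add: zero_less_mult_iff)
  qed
  have row_j: "\<sigma> * A' v $ j = Rr * (\<sigma> * v $ j) + Rz * v $ vert" for v
  proof -
    have "\<sigma> * A' v $ j = k r z * (\<sigma> * v $ j) + (kr * (\<sigma> * v $ j) + kz * v $ vert) * (\<sigma> * x $ j)"
      using j by (simp add: A'_def algebra_simps)
    then show ?thesis unfolding sig(3) by (simp add: Rr_def Rz_def algebra_simps)
  qed
  have row_v: "A' v $ vert = gr * (\<sigma> * v $ j) + gz * v $ vert" for v by (simp add: A'_def)
  have xi: "\<bar>x $ i\<bar> \<le> r" if "i \<noteq> vert" for i using component_le_hnorm[OF that] by (simp add: r_def)
  have r0: "r \<ge> 0" by (simp add: r_def)
  have Rb: "\<bar>Rr\<bar> \<le> 2 * M * s" "\<bar>Rz\<bar> \<le> M * s"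
    using b k0(2) kpos by (auto simp: Rr_def Rz_def)
  have sv: "\<bar>\<sigma> * v $ i\<bar> = \<bar>v $ i\<bar>" for v :: "real^'n" and i using sig by (simp add: abs_mult)
  have mixed: "\<bar>(kr * a + kz * c) * x $ i\<bar> \<le> M * s * (\<bar>a\<bar> + \<bar>c\<bar>)" if "i \<noteq> vert" for a c i
  proof -
    have "\<bar>(kr * a + kz * c) * x $ i\<bar> \<le> (\<bar>kr\<bar> * \<bar>a\<bar> + \<bar>kz\<bar> * \<bar>c\<bar>) * r"
      unfolding abs_mult using xi[OF that] r0 abs_triangle_ineq[of "kr * a" "kz * c"]
      by (intro mult_mono) (auto simp: abs_mult)
    also have "\<dots> = \<bar>r * kr\<bar> * \<bar>a\<bar> + \<bar>r * kz\<bar> * \<bar>c\<bar>" using r0 by (simp add: abs_mult algebra_simps)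
    also have "\<dots> \<le> M * s * \<bar>a\<bar> + M * s * \<bar>c\<bar>"
      using b by (intro add_mono mult_right_mono) auto
    finally show ?thesis by (simp add: algebra_simps)
  qed
  have M4: "M \<le> M ^ 4" "M ^ 3 \<le> M ^ 4" using M by (auto intro: self_le_power power_increasing)
  have "distortion_le ((7 * ?n * M ^ 4) * (7 * ?n * M ^ 4)) A"
  proof (rule distortion_leI[where s = s])
    show "7 * ?n * M ^ 4 > 0" using M by simp
    show "norm (A *v v) \<le> 7 * ?n * M ^ 4 * s * norm v" for v
    proof -
      have c: "\<bar>v $ i\<bar> \<le> norm v" for i by (rule component_le_norm_cart)
      have "\<bar>A' v $ i\<bar> \<le> 3 * (M * s) * norm v" for i
      proof (cases "i = vert")
        case True
        have "\<bar>gr * (\<sigma> * v $ j) + gz * v $ vert\<bar> \<le> \<bar>gr\<bar> * \<bar>\<sigma> * v $ j\<bar> + \<bar>gz\<bar> * \<bar>v $ vert\<bar>"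
          using abs_triangle_ineq[of "gr * (\<sigma> * v $ j)" "gz * v $ vert"] by (simp add: abs_mult)
        also have "\<dots> \<le> (M * s) * norm v + (M * s) * norm v"
          unfolding sv using b c s M by (intro add_mono mult_mono) auto
        finally show ?thesis using True s M by (simp add: A'_def algebra_simps)
      next
        case False
        have "\<bar>A' v $ i\<bar> \<le> \<bar>k r z * v $ i\<bar> + \<bar>(kr * (\<sigma> * v $ j) + kz * v $ vert) * x $ i\<bar>"
          using False by (simp add: A'_def)
        also have "\<dots> \<le> (M * s) * norm v + M * s * (\<bar>\<sigma> * v $ j\<bar> + \<bar>v $ vert\<bar>)"
        proof (rule add_mono[OF _ mixed[OF False]])
          show "\<bar>k r z * v $ i\<bar> \<le> M * s * norm v"
            unfolding abs_mult using k0(2) kpos c s M by (intro mult_mono) auto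
        qed
        also have "\<dots> \<le> (M * s) * norm v + M * s * (norm v + norm v)"
          unfolding sv using c s M by (intro add_left_mono mult_left_mono add_mono) auto
        finally show ?thesis by (simp add: algebra_simps)
      qed
      then have "(\<Sum>i\<in>UNIV. \<bar>A' v $ i\<bar>) \<le> (\<Sum>i\<in>(UNIV::'n set). 3 * (M * s) * norm v)"
        by (rule sum_mono)
      then have "norm (A' v) \<le> ?n * (3 * (M * s) * norm v)"
        using norm_le_l1_cart[of "A' v"] by simp
      also have "\<dots> \<le> ?n * (7 * (M ^ 4 * s) * norm v)"
        using M4(1) s M by (intro mult_left_mono mult_right_mono) (auto intro!: mult_mono)
      finally show ?thesis by (simp add: Av algebra_simps)
    qed
    show "s * norm v \<le> 7 * ?n * M ^ 4 * norm (A *v v)" for v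
    proof -
      define w where "w = A' v"
      have c: "\<bar>w $ i\<bar> \<le> norm w" for i by (rule component_le_norm_cart)
      define a where "a = \<sigma> * v $ j"
      define e where "e = v $ vert"
      have eq1: "\<sigma> * w $ j = Rr * a + Rz * e" and eq2: "w $ vert = gr * a + gz * e"
        using row_j[of v] row_v[of v] by (simp_all add: w_def a_def e_def)
      have Ja: "Jac * a = gz * (\<sigma> * w $ j) - Rz * w $ vert" and Je: "Jac * e = Rr * w $ vert - gr * (\<sigma> * w $ j)"
        unfolding eq1 eq2 Jac_def by (simp_all add: algebra_simps)
      have sJ: "s\<^sup>2 \<le> M * Jac" using J by (simp add: Jac_def Rr_def Rz_def)
      \<comment> \<open>Cramer's rule expresses \<open>Jac * a\<close> and \<open>Jac * e\<close> by the entries of \<open>w\<close>; this divides by \<open>Jac\<close>\<close>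
      have solve: "s * \<bar>t\<bar> \<le> 3 * M ^ 2 * norm w" if "\<bar>Jac * t\<bar> \<le> 3 * (M * s) * norm w" for t
      proof -
        have "s\<^sup>2 * \<bar>t\<bar> \<le> M * Jac * \<bar>t\<bar>" using sJ by (rule mult_right_mono) simp
        also have "\<dots> = M * \<bar>Jac * t\<bar>" using Jpos by (simp add: abs_mult)
        also have "\<dots> \<le> M * (3 * (M * s) * norm w)" using that M by (intro mult_left_mono) auto
        finally have "s * (s * \<bar>t\<bar>) \<le> s * (3 * M ^ 2 * norm w)"
          by (simp add: power2_eq_square algebra_simps)
        then show ?thesis using s by simp
      qed
      have a: "s * \<bar>a\<bar> \<le> 3 * M ^ 2 * norm w"
      proof (rule solve)
        have "\<bar>Jac * a\<bar> \<le> \<bar>gz\<bar> * \<bar>\<sigma> * w $ j\<bar> + \<bar>Rz\<bar> * \<bar>w $ vert\<bar>"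
          unfolding Ja using abs_triangle_ineq4[of "gz * (\<sigma> * w $ j)" "Rz * w $ vert"] by (simp add: abs_mult)
        also have "\<dots> \<le> (M * s) * norm w + (M * s) * norm w"
          unfolding sv using b Rb c s M by (intro add_mono mult_mono) auto
        also have "\<dots> \<le> 3 * (M * s) * norm w" using M s by simp
        finally show "\<bar>Jac * a\<bar> \<le> 3 * (M * s) * norm w" .
      qed
      have e: "s * \<bar>e\<bar> \<le> 3 * M ^ 2 * norm w"
      proof (rule solve)
        have "\<bar>Jac * e\<bar> \<le> \<bar>Rr\<bar> * \<bar>w $ vert\<bar> + \<bar>gr\<bar> * \<bar>\<sigma> * w $ j\<bar>"
          unfolding Je using abs_triangle_ineq4[of "Rr * w $ vert" "gr * (\<sigma> * w $ j)"] by (simp add: abs_mult)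
        also have "\<dots> \<le> (2 * M * s) * norm w + (M * s) * norm w"
          unfolding sv using b Rb c s M by (intro add_mono mult_mono) auto
        finally show "\<bar>Jac * e\<bar> \<le> 3 * (M * s) * norm w" by (simp add: algebra_simps)
      qed
      have "s * \<bar>v $ i\<bar> \<le> 7 * M ^ 4 * norm w" for i
      proof (cases "i = vert")
        case True
        have "3 * M ^ 2 \<le> 7 * M ^ 4"
          using M power_increasing[of 2 4 M] by (intro mult_mono) auto
        then have "3 * M ^ 2 * norm w \<le> 7 * M ^ 4 * norm w" by (rule mult_right_mono) simp
        then show ?thesis using e True by (simp add: e_def)
      next
        case False
        have "k r z * v $ i = w $ i - (kr * a + kz * e) * x $ i"
          using False by (simp add: w_def A'_def a_def e_def)
        then have "k r z * \<bar>v $ i\<bar> \<le> \<bar>w $ i\<bar> + \<bar>(kr * a + kz * e) * x $ i\<bar>"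
          using kpos by (metis abs_mult abs_of_pos abs_triangle_ineq4)
        also have "\<dots> \<le> norm w + M * s * (\<bar>a\<bar> + \<bar>e\<bar>)" by (intro add_mono c mixed[OF False])
        also have "M * s * (\<bar>a\<bar> + \<bar>e\<bar>) = M * (s * \<bar>a\<bar> + s * \<bar>e\<bar>)" by (simp add: algebra_simps)
        also have "norm w + \<dots> \<le> norm w + M * (3 * M ^ 2 * norm w + 3 * M ^ 2 * norm w)"
          using a e M by (intro add_left_mono mult_left_mono add_mono) auto
        also have "\<dots> = (1 + 6 * M ^ 3) * norm w" by (simp add: power2_eq_square power3_eq_cube algebra_simps)
        finally have kv: "k r z * \<bar>v $ i\<bar> \<le> (1 + 6 * M ^ 3) * norm w" .
        have "s * \<bar>v $ i\<bar> \<le> M * k r z * \<bar>v $ i\<bar>" using k0(1) by (rule mult_right_mono) simp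
        also have "\<dots> \<le> M * ((1 + 6 * M ^ 3) * norm w)" using kv M by simp
        also have "\<dots> = (M + 6 * M ^ 4) * norm w" by (simp add: algebra_simps power4_eq_xxxx power3_eq_cube)
        also have "\<dots> \<le> 7 * M ^ 4 * norm w" using M4(1) by (intro mult_right_mono) auto
        finally show ?thesis .
      qed
      then have "(\<Sum>i\<in>UNIV. s * \<bar>v $ i\<bar>) \<le> (\<Sum>i\<in>(UNIV::'n set). 7 * M ^ 4 * norm w)" by (rule sum_mono)
      then have "s * (\<Sum>i\<in>UNIV. \<bar>v $ i\<bar>) \<le> ?n * (7 * M ^ 4 * norm w)" by (simp add: sum_distrib_left)
      moreover have "s * norm v \<le> s * (\<Sum>i\<in>UNIV. \<bar>v $ i\<bar>)" using s norm_le_l1_cart[of v] by simp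
      ultimately show ?thesis by (simp add: Av w_def algebra_simps)
    qed
    show "det A > 0"
    proof (rule det_pos_if_no_nonpos_eigenvalue)
      fix v \<mu> assume ev: "A *v v = \<mu> *\<^sub>R v" and mu: "\<mu> \<le> (0::real)"
      have A'v: "A' v = \<mu> *\<^sub>R v" using ev by (simp add: Av)
      define a where "a = \<sigma> * v $ j"
      define e where "e = v $ vert"
      have eq1: "(Rr - \<mu>) * a + Rz * e = 0" and eq2: "gr * a + (gz - \<mu>) * e = 0"
        using row_j[of v] row_v[of v] unfolding A'v by (simp_all add: a_def e_def algebra_simps)
      have "(Rr - \<mu>) * (gz - \<mu>) - Rz * gr = Jac - \<mu> * (Rr + gz) + \<mu>\<^sup>2"
        by (simp add: Jac_def power2_eq_square algebra_simps)
      also have "\<dots> > 0"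
      proof -
        have "\<mu> * (Rr + gz) \<le> 0" using mu tr by (simp add: mult_nonpos_nonneg Rr_def)
        then show ?thesis using Jpos zero_le_power2[of \<mu>] by linarith
      qed
      finally have dpos: "(Rr - \<mu>) * (gz - \<mu>) - Rz * gr > 0" .
      have "((Rr - \<mu>) * (gz - \<mu>) - Rz * gr) * a = (gz - \<mu>) * ((Rr - \<mu>) * a + Rz * e) - Rz * (gr * a + (gz - \<mu>) * e)"
        by (simp add: algebra_simps)
      then have a0: "a = 0" using dpos by (simp add: eq1 eq2)
      have "((Rr - \<mu>) * (gz - \<mu>) - Rz * gr) * e = (Rr - \<mu>) * (gr * a + (gz - \<mu>) * e) - gr * ((Rr - \<mu>) * a + Rz * e)"
        by (simp add: algebra_simps)
      then have e0: "e = 0" using dpos by (simp add: eq1 eq2)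
      have "v $ i = 0" for i
      proof (cases "i = vert")
        case False
        have "A' v $ i = k r z * v $ i" using a0 e0 False by (simp add: A'_def a_def e_def)
        then have "(k r z - \<mu>) * v $ i = 0" unfolding A'v by (auto simp: algebra_simps)
        then show ?thesis using kpos mu by auto
      qed (use e0 in \<open>simp add: e_def\<close>)
      then show "v = 0" by (simp add: vec_eq_iff)
    qed
  qed (rule s)
  then show ?thesis unfolding differentiable_with_distortion_def using D Av by (metis (no_types, lifting) ext)
qed

text \<open>The derivative is a multiple of the identity plus a matrix of rank one whose image is the radial
direction, so only the stretching along the ray, \<open>\<kappa> x + \<kappa>' x\<close>, has to be controlled.\<close>

lemma radial_distortion:
  fixes x :: "real^'n" and \<kappa> :: "real^'n \<Rightarrow> real"
  assumes D: "(\<kappa> has_derivative \<kappa>') (at x)" and pos: "\<kappa> x > 0" and M: "M \<ge> 1"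
    and b: "\<And>v. norm x * \<bar>\<kappa>' v\<bar> \<le> M * \<kappa> x * norm v" and rad: "\<kappa> x \<le> M * (\<kappa> x + \<kappa>' x)"
  shows "differentiable_with_distortion ((1 + M\<^sup>2) * (1 + M\<^sup>2)) (\<lambda>x. \<kappa> x *\<^sub>R x) x"
proof -
  define A' where "A' v = \<kappa> x *\<^sub>R v + \<kappa>' v *\<^sub>R x" for v
  have DA: "((\<lambda>x. \<kappa> x *\<^sub>R x) has_derivative A') (at x)"
    unfolding A'_def using has_derivative_scaleR[OF D has_derivative_ident] by simp
  define A where "A = matrix A'"
  have Av: "A *v v = A' v" for v
    unfolding A_def using has_derivative_linear[OF DA] by (simp add: matrix_works)
  have lin: "linear \<kappa>'" using D has_derivative_linear by blast
  have kA: "\<kappa>' (A' v) = (\<kappa> x + \<kappa>' x) * \<kappa>' v" for v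
    by (simp add: A'_def linear_add[OF lin] linear_scale[OF lin] algebra_simps)
  have rpos: "\<kappa> x + \<kappa>' x > 0" using rad pos M
    by (smt (verit) mult_nonneg_nonpos)
  have "distortion_le ((1 + M\<^sup>2) * (1 + M\<^sup>2)) A"
  proof (rule distortion_leI[where s = "\<kappa> x"])
    show "norm (A *v v) \<le> (1 + M\<^sup>2) * \<kappa> x * norm v" for v
    proof -
      have "norm (A' v) \<le> \<kappa> x * norm v + norm x * \<bar>\<kappa>' v\<bar>"
        using norm_triangle_ineq[of "\<kappa> x *\<^sub>R v" "\<kappa>' v *\<^sub>R x"] pos by (simp add: A'_def mult.commute)
      also have "\<dots> \<le> \<kappa> x * norm v + M * \<kappa> x * norm v" using b[of v] by simp
      also have "\<dots> \<le> \<kappa> x * norm v + M\<^sup>2 * \<kappa> x * norm v"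
        using M pos self_le_power[of M 2] by (intro add_left_mono mult_right_mono) auto
      finally show ?thesis by (simp add: Av algebra_simps)
    qed
    show "\<kappa> x * norm v \<le> (1 + M\<^sup>2) * norm (A *v v)" for v
    proof -
      let ?w = "A' v"
      have "\<kappa> x * (norm x * \<bar>\<kappa>' v\<bar>) \<le> M * (\<kappa> x + \<kappa>' x) * (norm x * \<bar>\<kappa>' v\<bar>)"
        using rad by (rule mult_right_mono) simp
      also have "\<dots> = M * (norm x * \<bar>\<kappa>' ?w\<bar>)" using rpos by (simp add: kA abs_mult)
      also have "\<dots> \<le> M * (M * \<kappa> x * norm ?w)" using b[of ?w] M by (intro mult_left_mono) auto
      finally have "\<kappa> x * (norm x * \<bar>\<kappa>' v\<bar>) \<le> \<kappa> x * (M\<^sup>2 * norm ?w)"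
        by (simp add: power2_eq_square algebra_simps)
      then have t: "norm x * \<bar>\<kappa>' v\<bar> \<le> M\<^sup>2 * norm ?w" using pos by simp
      have "\<kappa> x *\<^sub>R v = ?w - \<kappa>' v *\<^sub>R x" by (simp add: A'_def)
      then have "\<kappa> x * norm v \<le> norm ?w + norm (\<kappa>' v *\<^sub>R x)"
        using pos by (metis abs_of_pos norm_scaleR norm_triangle_ineq4)
      then show ?thesis using t by (simp add: Av algebra_simps)
    qed
    show "det A > 0"
    proof (rule det_pos_if_no_nonpos_eigenvalue)
      fix v \<mu> assume ev: "A *v v = \<mu> *\<^sub>R v" and mu: "\<mu> \<le> (0::real)"
      have "\<kappa>' (A' v) = \<mu> * \<kappa>' v" using ev by (simp add: Av linear_scale[OF lin])
      then have "(\<kappa> x + \<kappa>' x - \<mu>) * \<kappa>' v = 0" by (simp add: kA algebra_simps)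
      then have k0: "\<kappa>' v = 0" using rpos mu by auto
      have "(\<kappa> x - \<mu>) *\<^sub>R v = 0" using ev k0 by (simp add: Av A'_def algebra_simps)
      then show "v = 0" using pos mu by auto
    qed
    show "1 + M\<^sup>2 > 0" using zero_le_power2[of M] by linarith
  qed (rule pos)
  then show ?thesis unfolding differentiable_with_distortion_def using DA Av by (metis (no_types, lifting) ext)
qed

text \<open>The interfaces between the pieces of the maps below lie in such sets, or in finite unions of them.\<close>

lemma negligible_hnorm_level:
  assumes "CARD('n) \<ge> 2"
  shows "negligible {x::real^'n. a * x $ vert + hnorm x = c}"
proof -
  define H where "H j s = {x::real^'n. (a *\<^sub>R axis vert 1 + s *\<^sub>R axis j 1) \<bullet> x = c}" for j s
  have negH: "negligible (H j s)" if "j \<noteq> vert" "s \<noteq> 0" for j s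
  proof -
    have "(a *\<^sub>R axis vert 1 + s *\<^sub>R axis j (1::real)) $ j = s" using that by (simp add: axis_def)
    then have "a *\<^sub>R axis vert 1 + s *\<^sub>R axis j (1::real) \<noteq> 0" using that by (metis zero_index)
    then show ?thesis unfolding H_def by (intro negligible_hyperplane) simp
  qed
  have "negligible ({x::real^'n. \<nexists>j. dominant x j} \<union> (\<Union>j\<in>{j. j \<noteq> vert}. H j 1 \<union> H j (-1)))"
    by (intro negligible_Un negligible_not_dominant assms negligible_Union) (auto intro!: negH)
  moreover have "{x::real^'n. a * x $ vert + hnorm x = c}
      \<subseteq> {x. \<nexists>j. dominant x j} \<union> (\<Union>j\<in>{j. j \<noteq> vert}. H j 1 \<union> H j (-1))"
  proof
    fix x :: "real^'n" assume x: "x \<in> {x. a * x $ vert + hnorm x = c}"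
    show "x \<in> {x. \<nexists>j. dominant x j} \<union> (\<Union>j\<in>{j. j \<noteq> vert}. H j 1 \<union> H j (-1))"
    proof (cases "\<exists>j. dominant x j")
      case True
      then obtain j where j: "dominant x j" by blast
      then have "j \<noteq> vert" "a * x $ vert + \<bar>x $ j\<bar> = c"
        using x hnorm_dominant[OF j] by (auto simp: dominant_def)
      moreover from this have "x \<in> H j 1 \<union> H j (-1)"
        by (auto simp: H_def inner_add_left inner_diff_left inner_axis' abs_if split: if_splits)
      ultimately show ?thesis by blast
    qed simp
  qed
  ultimately show ?thesis using negligible_subset by blast
qed

lemma negligible_cnorm_level:
  assumes "CARD('n) \<ge> 2"
  shows "negligible {x::real^'n. cnorm x = c}"
proof (rule negligible_subset)
  show "negligible ({x::real^'n. 1 * x $ vert + hnorm x = c} \<union> {x. (-1) * x $ vert + hnorm x = c})"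
    by (intro negligible_Un negligible_hnorm_level assms)
qed (auto simp: cnorm_def abs_if)

lemma negligible_component_level: "negligible {x::real^'n. x $ i = c}"
proof -
  have "negligible {x::real^'n. axis i 1 \<bullet> x = c}"
    by (rule negligible_hyperplane) (simp add: axis_eq_0_iff)
  then show ?thesis by (simp add: inner_axis')
qed

section \<open>Folding a beam\<close>

definition parity_sign :: "int \<Rightarrow> real" where
  "parity_sign n = (if even n then 1 else -1)"

text \<open>The line is divided into the cells \<open>[2 * n - 1, 2 * n + 1)\<close>; the triangle wave identifies them all with
\<open>[-1, 1]\<close> and reverses the direction in those with odd \<open>n\<close>. The assignment of the end points to cells
makes the signs jump at the walls, where the factors that are multiplied by signs vanish.\<close>

definition cell_sign :: "real \<Rightarrow> real" where
  "cell_sign y = parity_sign (round (y / 2))"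

definition triangle_wave :: "real \<Rightarrow> real" where
  "triangle_wave y = cell_sign y * (y - 2 * of_int (round (y / 2)))"

lemma parity_sign_simps [simp]:
  "parity_sign (m + n) = parity_sign m * parity_sign n" "parity_sign n * parity_sign n = 1"
  "\<bar>parity_sign n\<bar> = 1" "parity_sign 0 = 1" "parity_sign (- n) = parity_sign n"
  "parity_sign n \<noteq> 0"
  by (auto simp: parity_sign_def)

lemma parity_sign_odd_mult: "odd a \<Longrightarrow> parity_sign (a * n) = parity_sign n"
  by (simp add: parity_sign_def)

lemma cell_sign_abs [simp]: "\<bar>cell_sign y\<bar> = 1" "cell_sign y * cell_sign y = 1" "cell_sign y \<noteq> 0"
  by (simp_all add: cell_sign_def)

lemma triangle_wave_repr:
  obtains n :: int where "y = 2 * of_int n + parity_sign n * triangle_wave y"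
    "n = round (y / 2)" "cell_sign y = parity_sign n"
proof -
  have "parity_sign n * (parity_sign n * t) = t" for n t
    by (simp add: mult.assoc[symmetric])
  then have "y = 2 * of_int (round (y / 2)) + parity_sign (round (y / 2)) * triangle_wave y"
    by (simp only: triangle_wave_def cell_sign_def)
  then show thesis by (rule that) (simp_all add: cell_sign_def)
qed

lemma triangle_wave_abs_le: "\<bar>triangle_wave y\<bar> \<le> 1"
proof -
  have "\<bar>y - 2 * of_int (round (y / 2))\<bar> \<le> 1"
    using of_int_round_abs_le[of "y / 2"] by linarith
  then show ?thesis unfolding triangle_wave_def abs_mult cell_sign_def by simp
qed

lemma triangle_wave_unique:
  assumes y: "y = 2 * of_int n + parity_sign n * v" and v: "\<bar>v\<bar> \<le> 1"
  shows "triangle_wave y = v" "\<bar>v\<bar> < 1 \<Longrightarrow> cell_sign y = parity_sign n" "\<bar>v\<bar> < 1 \<Longrightarrow> round (y / 2) = n"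
proof -
  have r: "round (y / 2) = n" if "\<bar>v\<bar> < 1"
  proof (rule round_unique')
    show "\<bar>y / 2 - of_int n\<bar> < 1 / 2" using that by (simp add: y parity_sign_def add_divide_distrib diff_divide_distrib)
  qed
  then show "\<bar>v\<bar> < 1 \<Longrightarrow> cell_sign y = parity_sign n" "\<bar>v\<bar> < 1 \<Longrightarrow> round (y / 2) = n"
    by (simp_all add: cell_sign_def)
  show "triangle_wave y = v"
  proof (cases "\<bar>v\<bar> < 1")
    case True
    then show ?thesis using r by (simp add: triangle_wave_def cell_sign_def y parity_sign_def)
  next
    case False
    then have "v = 1 \<or> v = -1" using v by linarith
    then have "parity_sign n * v = of_int 1 \<or> parity_sign n * v = of_int (-1)"
      by (auto simp: parity_sign_def)
    then obtain s :: int where s: "s = 1 \<or> s = -1" "parity_sign n * v = of_int s" by blast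
    have "y / 2 = of_int n + of_int s / 2" using y s(2) by simp
    then have "round (y / 2) = \<lfloor>real_of_int n + of_int s / 2 + 1 / 2\<rfloor>" by (simp only: round_def)
    also have "\<dots> = n + (if s = 1 then 1 else 0)"
      using s(1) by (auto simp: floor_eq_iff)
    finally have "round (y / 2) = n + (if s = 1 then 1 else 0)" .
    then show ?thesis
      using s by (auto simp: triangle_wave_def cell_sign_def y parity_sign_def)
  qed
qed

lemma triangle_wave_id: "\<bar>y\<bar> \<le> 1 \<Longrightarrow> triangle_wave y = y"
  using triangle_wave_unique(1)[of y 0 y] by simp

lemma cell_sign_1: "\<bar>y\<bar> < 1 \<Longrightarrow> cell_sign y = 1"
  using triangle_wave_unique(2)[of y 0 y] by simp

text \<open>Multiplication by an odd number maps the centres \<open>2 * n\<close> of the cells to centres of cells with the same parity,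
hence it commutes with the group generated by the reflections in the walls and is well defined on
the folded line. This makes the power maps compose.\<close>

lemma triangle_wave_mult_odd:
  assumes "odd a"
  shows "triangle_wave (of_int a * triangle_wave y) = triangle_wave (of_int a * y)"
    and "\<bar>triangle_wave (of_int a * y)\<bar> < 1 \<Longrightarrow>
      cell_sign (of_int a * y) = cell_sign y * cell_sign (of_int a * triangle_wave y)"
proof -
  obtain n where n: "y = 2 * of_int n + parity_sign n * triangle_wave y" "cell_sign y = parity_sign n"
    using triangle_wave_repr[of y] by metis
  let ?u = "of_int a * triangle_wave y"
  obtain m where m: "?u = 2 * of_int m + parity_sign m * triangle_wave ?u" "cell_sign ?u = parity_sign m"
    using triangle_wave_repr[of ?u] by metis
  define s :: int where "s = (if even n then 1 else -1)"
  have s: "parity_sign n = of_int s" by (simp add: s_def parity_sign_def)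
  have par: "parity_sign (a * n + s * m) = parity_sign n * parity_sign m"
    using assms by (simp add: parity_sign_odd_mult) (simp add: s_def)
  have "of_int a * y = 2 * (of_int a * of_int n) + parity_sign n * ?u"
    by (subst n(1)) (simp add: algebra_simps)
  also have "\<dots> = 2 * of_int (a * n + s * m) + parity_sign n * parity_sign m * triangle_wave ?u"
    by (subst m(1)) (simp add: s algebra_simps)
  finally have y: "of_int a * y = 2 * of_int (a * n + s * m) + parity_sign (a * n + s * m) * triangle_wave ?u"
    by (simp only: par)
  from triangle_wave_unique(1)[OF y triangle_wave_abs_le]
  show eq: "triangle_wave ?u = triangle_wave (of_int a * y)" by simp
  show "cell_sign (of_int a * y) = cell_sign y * cell_sign ?u" if "\<bar>triangle_wave (of_int a * y)\<bar> < 1"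
    using triangle_wave_unique(2)[OF y triangle_wave_abs_le] that par n(2) m(2) by (simp add: eq)
qed

text \<open>For odd factors the walls of the original cell lie among the walls of the subdivided ones.\<close>

lemma triangle_wave_odd_integer:
  assumes "odd a" "\<bar>y\<bar> = 1" shows "\<bar>triangle_wave (of_int a * y)\<bar> = 1"
proof -
  obtain m where m: "of_int a * y = 2 * of_int m + parity_sign m * triangle_wave (of_int a * y)"
    using triangle_wave_repr by metis
  obtain s :: int where s: "y = of_int s" "s = 1 \<or> s = -1"
    using assms(2) by (metis abs_eq_iff abs_1 of_int_1 of_int_minus)
  have t: "triangle_wave (of_int a * y) = parity_sign m * (of_int a * y - 2 * of_int m)"
    by (subst m) (simp add: mult.assoc[symmetric])
  then have "\<bar>triangle_wave (of_int a * y)\<bar> = of_int \<bar>a * s - 2 * m\<bar>"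
    by (simp add: abs_mult s(1))
  moreover have "a * s - 2 * m \<noteq> 0" using assms(1) s(2) by presburger
  ultimately show ?thesis using triangle_wave_abs_le[of "of_int a * y"] by linarith
qed

lemma triangle_wave_lipschitz: "1-lipschitz_on UNIV triangle_wave"
proof (rule lipschitz_onI)
  have main: "\<bar>triangle_wave x - triangle_wave y\<bar> \<le> \<bar>x - y\<bar>" if xy: "x \<le> y" for x y
  proof -
    obtain n where n: "x = 2 * of_int n + parity_sign n * triangle_wave x" "n = round (x / 2)"
      using triangle_wave_repr[of x] by metis
    obtain m where m: "y = 2 * of_int m + parity_sign m * triangle_wave y" "m = round (y / 2)"
      using triangle_wave_repr[of y] by metis
    have "n \<le> m" unfolding n(2) m(2) using xy by (intro round_mono) simp
    then consider "m = n" | "m = n + 1" | "n + 2 \<le> m" by linarith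
    then show ?thesis
    proof cases
      case 1
      then have "x - y = parity_sign n * (triangle_wave x - triangle_wave y)"
        using n(1) m(1) by (simp add: algebra_simps)
      then show ?thesis by (simp add: abs_mult)
    next
      case 2
      then have "y = 2 * of_int n + 2 - parity_sign n * triangle_wave y"
        using m(1) by (simp add: parity_sign_def algebra_simps split: if_splits)
      then show ?thesis
        using n(1) triangle_wave_abs_le[of x] triangle_wave_abs_le[of y]
        by (auto simp: parity_sign_def abs_le_iff abs_if split: if_splits)
    next
      case 3
      then have "real_of_int n + 2 \<le> real_of_int m" by linarith
      moreover have "\<bar>x - 2 * of_int n\<bar> \<le> 1" "\<bar>y - 2 * of_int m\<bar> \<le> 1"
        using n(1) m(1) triangle_wave_abs_le[of x] triangle_wave_abs_le[of y]
        by (auto simp: parity_sign_def split: if_splits)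
      ultimately have "\<bar>x - y\<bar> \<ge> 2" by linarith
      then show ?thesis using triangle_wave_abs_le[of x] triangle_wave_abs_le[of y] by linarith
    qed
  qed
  show "dist (triangle_wave x) (triangle_wave y) \<le> 1 * dist x y" for x y
    using main[of x y] main[of y x] by (cases "x \<le> y") (auto simp: dist_real_def abs_minus_commute)
qed simp

lemma round_locally_constant:
  assumes "\<bar>triangle_wave y\<bar> < 1"
  shows "\<exists>e>0. \<forall>x. \<bar>x - y\<bar> < e \<longrightarrow> round (x / 2) = round (y / 2)"
proof -
  obtain n where n: "y = 2 * of_int n + parity_sign n * triangle_wave y" "n = round (y / 2)"
    using triangle_wave_repr[of y] by metis
  have d: "\<bar>y - 2 * of_int n\<bar> < 1" using n(1) assms by (auto simp: parity_sign_def split: if_splits)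
  have c: "round (x / 2) = round (y / 2)" if "\<bar>x - y\<bar> < 1 - \<bar>y - 2 * of_int n\<bar>" for x
  proof -
    have "\<bar>x / 2 - of_int n\<bar> < 1 / 2" using that by linarith
    then have "round (x / 2) = n" by (rule round_unique')
    then show ?thesis using n(2) by simp
  qed
  have "1 - \<bar>y - 2 * of_int n\<bar> > 0" using d by simp
  then show ?thesis using c by blast
qed

lemma round_eq_if_no_wall:
  assumes "\<And>z. z \<in> closed_segment x y \<Longrightarrow> \<bar>triangle_wave z\<bar> < 1"
  shows "round (x / 2) = round (y / 2)"
proof -
  have "(\<lambda>z. round (z / 2)) constant_on closed_segment x y"
  proof (rule locally_constant_imp_constant)
    fix z assume "z \<in> closed_segment x y"
    then obtain e where e: "e > 0" "\<And>w. \<bar>w - z\<bar> < e \<Longrightarrow> round (w / 2) = round (z / 2)"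
      using round_locally_constant[OF assms] by blast
    show "\<exists>T. openin (top_of_set (closed_segment x y)) T \<and> z \<in> T \<and> (\<forall>w\<in>T. round (w / 2) = round (z / 2))"
    proof (intro exI[of _ "closed_segment x y \<inter> ball z e"] conjI ballI)
      show "openin (top_of_set (closed_segment x y)) (closed_segment x y \<inter> ball z e)"
        by (rule openin_open_Int) simp
      show "z \<in> closed_segment x y \<inter> ball z e" using e(1) \<open>z \<in> closed_segment x y\<close> by simp
      fix w assume "w \<in> closed_segment x y \<inter> ball z e"
      then have "\<bar>w - z\<bar> < e" by (simp add: dist_real_def abs_minus_commute)
      then show "round (w / 2) = round (z / 2)" by (rule e(2))
    qed
  qed auto
  then show ?thesis unfolding constant_on_def by (metis ends_in_segment)
qed

definition beam_fold :: "real^'n \<Rightarrow> real^'n" where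
  "beam_fold x = (\<chi> i. if i = vert then x $ vert else triangle_wave (x $ i))"

definition sheet_sign :: "real^'n \<Rightarrow> real" where
  "sheet_sign x = (\<Prod>i\<in>-{vert}. cell_sign (x $ i))"

lemma beam_fold_nth [simp]:
  "beam_fold x $ vert = x $ vert" "i \<noteq> vert \<Longrightarrow> beam_fold x $ i = triangle_wave (x $ i)"
  by (simp_all add: beam_fold_def)

lemma sheet_sign_abs [simp]: "\<bar>sheet_sign x\<bar> = 1" "sheet_sign x * sheet_sign x = 1"
  by (simp_all add: sheet_sign_def abs_prod prod.distrib[symmetric])

lemma hnorm_beam_fold_le_1 [simp]: "hnorm (beam_fold x) \<le> 1"
  by (rule hnorm_le) (auto simp: triangle_wave_abs_le)

lemma hnorm_less_1_iff:
  fixes x :: "real^'n"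
  shows "hnorm x < 1 \<longleftrightarrow> (\<forall>i. i \<noteq> vert \<longrightarrow> \<bar>x $ i\<bar> < 1)"
proof (intro iffI allI impI)
  fix i :: 'n assume "hnorm x < 1" "i \<noteq> vert"
  then show "\<bar>x $ i\<bar> < 1" using component_le_hnorm[of i x] by simp
next
  assume a: "\<forall>i. i \<noteq> vert \<longrightarrow> \<bar>x $ i\<bar> < 1"
  let ?S = "insert 0 ((\<lambda>i. \<bar>x $ i\<bar>) ` (-{vert}))"
  have "Max ?S < 1" using a by (subst Max_less_iff) auto
  moreover have "hnorm x \<le> Max ?S" by (rule hnorm_le) (auto intro!: Max_ge)
  ultimately show "hnorm x < 1" by (rule le_less_trans[rotated])
qed

lemma hnorm_eq_1_component:
  assumes "hnorm x = 1" shows "\<exists>i. i \<noteq> vert \<and> \<bar>x $ i\<bar> = 1"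
  using hnorm_less_1_iff[of x] component_le_hnorm[of _ x] assms by (metis less_eq_real_def less_irrefl)

lemma locally_lipschitz_beam_fold: "locally_lipschitz beam_fold"
proof (rule locally_lipschitz_vec)
  fix i
  have "locally_lipschitz (\<lambda>x. x $ i)"
    by (intro locally_lipschitz_bounded_linear bounded_linear_vec_nth)
  then show "locally_lipschitz (\<lambda>x. beam_fold x $ i)"
    using locally_lipschitz_compose_global[OF triangle_wave_lipschitz] by (cases "i = vert") simp_all
qed

text \<open>The sheet of a point can only change across a wall, by the intermediate value theorem.\<close>

lemma sheet_sign_cong_no_wall:
  fixes f :: "'a::euclidean_space \<Rightarrow> real^'n"
  assumes c: "continuous_on (closed_segment x y) f"
    and nw: "\<And>z. z \<in> closed_segment x y \<Longrightarrow> hnorm (beam_fold (f z)) < 1"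
  shows "sheet_sign (f x) = sheet_sign (f y)"
proof -
  have "round (f x $ i / 2) = round (f y $ i / 2)" if "i \<noteq> vert" for i
  proof (rule round_eq_if_no_wall)
    fix t assume t: "t \<in> closed_segment (f x $ i) (f y $ i)"
    have "connected ((\<lambda>z. f z $ i) ` closed_segment x y)"
      by (intro connected_continuous_image continuous_intros c convex_connected convex_closed_segment)
    then have "convex ((\<lambda>z. f z $ i) ` closed_segment x y)"
      using connected_convex_1_gen[of "(\<lambda>z. f z $ i) ` closed_segment x y"] by simp
    then have "closed_segment (f x $ i) (f y $ i) \<subseteq> (\<lambda>z. f z $ i) ` closed_segment x y"
      by (intro closed_segment_subset) auto
    then obtain z where "z \<in> closed_segment x y" "t = f z $ i" using t by blast
    then show "\<bar>triangle_wave t\<bar> < 1" using nw[of z] that by (auto simp: hnorm_less_1_iff)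
  qed
  then show ?thesis by (simp add: sheet_sign_def cell_sign_def)
qed

lemma beam_fold_locally_affine:
  fixes x :: "real^'n"
  assumes x: "hnorm (beam_fold x) < 1"
  obtains W where "open W" "x \<in> W"
    "\<And>y i. y \<in> W \<Longrightarrow> i \<noteq> vert \<Longrightarrow> round (y $ i / 2) = round (x $ i / 2)"
proof -
  define P where "P i e \<longleftrightarrow> 0 < e \<and> (i \<noteq> vert \<longrightarrow> (\<forall>t. \<bar>t - x $ i\<bar> < e \<longrightarrow> round (t / 2) = round (x $ i / 2)))" for i and e :: real
  have "\<exists>e. P i e" for i
  proof (cases "i = vert")
    case True
    then show ?thesis unfolding P_def by (intro exI[of _ 1]) simp
  next
    case False
    then have "\<bar>triangle_wave (x $ i)\<bar> < 1" using x by (auto simp: hnorm_less_1_iff)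
    from round_locally_constant[OF this] show ?thesis unfolding P_def by blast
  qed
  then obtain e where "\<And>i. P i (e i)" by metis
  then have e: "\<And>i. e i > 0"
    "\<And>i t. i \<noteq> vert \<Longrightarrow> \<bar>t - x $ i\<bar> < e i \<Longrightarrow> round (t / 2) = round (x $ i / 2)"
    unfolding P_def by blast+
  let ?W = "\<Inter>i. {y. \<bar>y $ i - x $ i\<bar> < e i}"
  have "open ?W" by (intro open_INT ballI open_Collect_less continuous_intros) auto
  then show thesis
  proof (rule that)
    show "x \<in> ?W" using e(1) by simp
    show "round (y $ i / 2) = round (x $ i / 2)" if "y \<in> ?W" "i \<noteq> vert" for y i
      using e(2)[OF that(2)] that(1) by blast
  qed
qed

text \<open>The extension, by reflection, of a map \<open>\<beta>\<close> of the beam \<open>hnorm x \<le> 1\<close> to the whole space: a reflection in a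
wall of the beam is answered by the reflection in the hyperplane of height zero. It is continuous when \<open>\<beta>\<close>
maps the walls into that hyperplane.\<close>

definition beam_extension :: "(real^'n \<Rightarrow> real^'n) \<Rightarrow> real^'n \<Rightarrow> real^'n" where
  "beam_extension \<beta> x = with_height (\<beta> (beam_fold x)) (sheet_sign x * \<beta> (beam_fold x) $ vert)"

lemma with_height_eq_diag_mat:
  "with_height y (s * y $ vert) = diag_mat (\<lambda>i. if i = vert then s else 1) *v y"
  by (simp add: diag_mat_mult vec_eq_iff with_height_nth)

lemma ae_distortion_beam_extension:
  fixes \<beta> :: "real^'n \<Rightarrow> real^'n"
  assumes \<beta>: "ae_distortion L \<beta> {x. hnorm x < 1 \<and> x $ vert \<in> I}"
  shows "ae_distortion L (beam_extension \<beta>) {x. x $ vert \<in> I}"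
proof -
  let ?V = "{x. hnorm (beam_fold x) < 1 \<and> x $ vert \<in> I}"
  have V: "ae_distortion L (beam_extension \<beta>) ?V"
  proof (rule ae_distortion_reflect[OF \<beta>,
      where \<tau> = beam_fold and a = "\<lambda>x i. if i = vert then sheet_sign x else 1"
        and b = "\<lambda>x i. if i = vert then 1 else cell_sign (x $ i)"])
    fix x :: "real^'n" assume x: "x \<in> ?V"
    show "\<bar>if i = vert then sheet_sign x else 1\<bar> = 1" "\<bar>if i = vert then 1 else cell_sign (x $ i)\<bar> = 1" for i
      by auto
    have "(\<Prod>i\<in>UNIV. if i = vert then sheet_sign x else 1) = sheet_sign x" by simp
    moreover have "(\<Prod>i\<in>UNIV. if i = vert then 1 else cell_sign (x $ i)) = sheet_sign x"
      unfolding sheet_sign_def by (rule prod.mono_neutral_cong_right) auto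
    ultimately show "(\<Prod>i\<in>UNIV. if i = vert then sheet_sign x else 1) *
        (\<Prod>i\<in>UNIV. if i = vert then 1 else cell_sign (x $ i)) = 1" by simp
    obtain W where W: "open W" "x \<in> W"
      "\<And>y i. y \<in> W \<Longrightarrow> i \<noteq> vert \<Longrightarrow> round (y $ i / 2) = round (x $ i / 2)"
      using x beam_fold_locally_affine[of x] by blast
    let ?b = "\<lambda>i. if i = vert then 1 else cell_sign (x $ i)"
    let ?c = "\<chi> i. if i = vert then 0 else cell_sign (x $ i) * (2 * of_int (round (x $ i / 2)))"
    show "(beam_fold has_derivative (*v) (diag_mat ?b)) (at x)"
    proof (rule has_derivative_transform_within_open[OF _ W(1,2)])
      show "((\<lambda>y. diag_mat ?b *v y - ?c) has_derivative (*v) (diag_mat ?b)) (at x)"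
        by (auto intro!: derivative_eq_intros bounded_linear.has_derivative[OF matrix_vector_mul_bounded_linear])
      fix y assume "y \<in> W"
      then show "diag_mat ?b *v y - ?c = beam_fold y"
        using W(3)[of y] by (auto simp: vec_eq_iff diag_mat_mult beam_fold_def triangle_wave_def
            cell_sign_def algebra_simps)
    qed
    show "beam_fold x \<in> {x. hnorm x < 1 \<and> x $ vert \<in> I}" using x by simp
    have "beam_extension \<beta> y = diag_mat (\<lambda>i. if i = vert then sheet_sign x else 1) *v \<beta> (beam_fold y)"
      if "y \<in> W" for y
    proof -
      have "sheet_sign y = sheet_sign x"
        unfolding sheet_sign_def cell_sign_def using W(3)[OF that] by (intro prod.cong) auto
      then show ?thesis by (simp add: beam_extension_def with_height_eq_diag_mat)
    qed
    then show "\<exists>W. open W \<and> x \<in> W \<and> (\<forall>y\<in>W. beam_extension \<beta> y =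
        diag_mat (\<lambda>i. if i = vert then sheet_sign x else 1) *v \<beta> (beam_fold y))"
      using W(1,2) by blast
  qed
  have "negligible {x::real^'n. hnorm (beam_fold x) = 1}"
  proof (rule negligible_subset)
    have "countable (\<Union>i\<in>UNIV. range (\<lambda>n::int. {x::real^'n. x $ i = of_int n}))" by auto
    then show "negligible (\<Union>(\<Union>i\<in>UNIV. range (\<lambda>n::int. {x::real^'n. x $ i = of_int n})))"
      by (rule negligible_countable_Union) (auto simp: negligible_component_level)
    show "{x::real^'n. hnorm (beam_fold x) = 1} \<subseteq> \<Union>(\<Union>i\<in>UNIV. range (\<lambda>n::int. {x. x $ i = of_int n}))"
    proof
      fix x :: "real^'n" assume "x \<in> {x. hnorm (beam_fold x) = 1}"
      then obtain i where i: "i \<noteq> vert" "\<bar>triangle_wave (x $ i)\<bar> = 1"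
        using hnorm_eq_1_component[of "beam_fold x"] by auto
      obtain n where n: "x $ i = 2 * of_int n + parity_sign n * triangle_wave (x $ i)"
        using triangle_wave_repr by metis
      have "x $ i = of_int (2 * n + 1) \<or> x $ i = of_int (2 * n - 1)"
        using n i(2) by (auto simp: parity_sign_def abs_if split: if_splits)
      then have "\<exists>m. x $ i = of_int m" by blast
      then show "x \<in> \<Union>(\<Union>i\<in>UNIV. range (\<lambda>n::int. {x. x $ i = of_int n}))" by blast
    qed
  qed
  then have "negligible ({x::real^'n. hnorm (beam_fold x) = 1} \<union> {x \<in> ?V. \<not> differentiable_with_distortion L (beam_extension \<beta>) x})"
    using V unfolding ae_distortion_def by simp
  then show ?thesis
  proof (rule ae_distortionI)
    fix x assume x: "x \<in> {x. x $ vert \<in> I}" "x \<notin> {x::real^'n. hnorm (beam_fold x) = 1} \<union>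
        {x \<in> ?V. \<not> differentiable_with_distortion L (beam_extension \<beta>) x}"
    then have "hnorm (beam_fold x) < 1" using hnorm_beam_fold_le_1[of x] by (simp add: order_less_le)
    then show "differentiable_with_distortion L (beam_extension \<beta>) x" using x by auto
  qed
qed

text \<open>The extension of a map of the upper half space that commutes with the reflection in height zero.\<close>

definition half_space_extension :: "(real^'n \<Rightarrow> real^'n) \<Rightarrow> real^'n \<Rightarrow> real^'n" where
  "half_space_extension f x =
     (let w = f (with_height x \<bar>x $ vert\<bar>) in with_height w (sgn (x $ vert) * w $ vert))"

lemma ae_distortion_half_space_extension:
  fixes f :: "real^'n \<Rightarrow> real^'n"
  assumes f: "ae_distortion L f {x. 0 < x $ vert \<and> cnorm x \<in> I}"
  shows "ae_distortion L (half_space_extension f) {x. cnorm x \<in> I}"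
proof -
  let ?V = "{x. x $ vert \<noteq> 0 \<and> cnorm x \<in> I}"
  let ?s = "\<lambda>x i. if i = vert then sgn (x $ vert) else (1::real)"
  let ?\<tau> = "\<lambda>x::real^'n. with_height x \<bar>x $ vert\<bar>"
  have V: "ae_distortion L (half_space_extension f) ?V"
  proof (rule ae_distortion_reflect[OF f, where \<tau> = ?\<tau> and a = ?s and b = ?s])
    fix x :: "real^'n" assume x: "x \<in> ?V"
    show "\<bar>?s x i\<bar> = 1" for i using x by (auto simp: sgn_if)
    show "\<bar>?s x i\<bar> = 1" for i using x by (auto simp: sgn_if)
    have "(\<Prod>i\<in>UNIV. ?s x i) = sgn (x $ vert)" by simp
    then show "(\<Prod>i\<in>UNIV. ?s x i) * (\<Prod>i\<in>UNIV. ?s x i) = 1" using x by (auto simp: sgn_if)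
    let ?W = "{y::real^'n. 0 < sgn (x $ vert) * y $ vert}"
    have W: "open ?W" "x \<in> ?W"
      using x by (auto intro!: open_Collect_less continuous_intros simp: sgn_if)
    have sW: "sgn (y $ vert) = sgn (x $ vert)" if "y \<in> ?W" for y
      using that by (auto simp: sgn_if split: if_splits)
    show "(?\<tau> has_derivative (*v) (diag_mat (?s x))) (at x)"
    proof (rule has_derivative_transform_within_open[OF _ W])
      show "((\<lambda>y. diag_mat (?s x) *v y) has_derivative (*v) (diag_mat (?s x))) (at x)"
        by (rule bounded_linear_imp_has_derivative[OF matrix_vector_mul_bounded_linear])
      show "diag_mat (?s x) *v y = ?\<tau> y" if "y \<in> ?W" for y
        using sW[OF that] by (auto simp: vec_eq_iff diag_mat_mult with_height_nth abs_sgn mult.commute)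
    qed
    show "?\<tau> x \<in> {x. 0 < x $ vert \<and> cnorm x \<in> I}" using x by (simp add: cnorm_def)
    show "\<exists>W. open W \<and> x \<in> W \<and> (\<forall>y\<in>W. half_space_extension f y = diag_mat (?s x) *v f (?\<tau> y))"
    proof (intro exI[of _ ?W] conjI ballI W)
      fix y assume "y \<in> ?W"
      from sW[OF this] show "half_space_extension f y = diag_mat (?s x) *v f (?\<tau> y)"
        by (simp add: half_space_extension_def Let_def with_height_eq_diag_mat)
    qed
  qed
  have "negligible ({x::real^'n. x $ vert = 0} \<union>
      {x \<in> ?V. \<not> differentiable_with_distortion L (half_space_extension f) x})"
    using V unfolding ae_distortion_def by (simp add: negligible_component_level)
  then show ?thesis by (rule ae_distortionI) auto
qed

section \<open>Tools for piecewise defined maps\<close>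

text \<open>The distortion bound of \<open>profile_distortion\<close> for the parameter \<open>M\<close>.\<close>

definition profile_bound :: "'n::finite itself \<Rightarrow> real \<Rightarrow> real" where
  "profile_bound _ M = (7 * real CARD('n) * M ^ 4) * (7 * real CARD('n) * M ^ 4)"

lemma profile_bound_ge_1: "M \<ge> 1 \<Longrightarrow> profile_bound TYPE('n::finite) M \<ge> 1"
proof -
  assume "M \<ge> 1"
  then have M4: "1 \<le> M ^ 4" by simp
  have n: "1 \<le> 7 * real CARD('n)" using zero_less_card_finite[where 'a='n] by linarith
  have "1 * 1 \<le> (7 * real CARD('n)) * M ^ 4" using M4 n by (intro mult_mono) auto
  then show ?thesis unfolding profile_bound_def
    using mult_mono[of 1 "7 * real CARD('n) * M ^ 4" 1 "7 * real CARD('n) * M ^ 4"] by simp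
qed

lemma profile_ae_distortion:
  fixes F :: "real^'n \<Rightarrow> real^'n" and k g kr kz gr gz s :: "real \<Rightarrow> real \<Rightarrow> real"
  assumes n: "CARD('n) \<ge> 2" and M: "M \<ge> 1"
    and U: "open U"
    and F: "\<And>x. x \<in> U \<Longrightarrow> F x = with_height (k (hnorm x) (x $ vert) *\<^sub>R x) (g (hnorm x) (x $ vert))"
    and D: "\<And>r z. (r, z) \<in> R \<Longrightarrow>
      ((\<lambda>p. k (fst p) (snd p)) has_derivative (\<lambda>p. kr r z * fst p + kz r z * snd p)) (at (r, z))"
      "\<And>r z. (r, z) \<in> R \<Longrightarrow>
      ((\<lambda>p. g (fst p) (snd p)) has_derivative (\<lambda>p. gr r z * fst p + gz r z * snd p)) (at (r, z))"
    and R: "\<And>x. x \<in> U \<Longrightarrow> (hnorm x, x $ vert) \<in> R"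
    and s: "\<And>r z. (r, z) \<in> R \<Longrightarrow> s r z > 0"
    and k0: "\<And>r z. (r, z) \<in> R \<Longrightarrow> s r z \<le> M * k r z" "\<And>r z. (r, z) \<in> R \<Longrightarrow> k r z \<le> M * s r z"
    and b: "\<And>r z. (r, z) \<in> R \<Longrightarrow> \<bar>r * kr r z\<bar> \<le> M * s r z" "\<And>r z. (r, z) \<in> R \<Longrightarrow> \<bar>r * kz r z\<bar> \<le> M * s r z"
      "\<And>r z. (r, z) \<in> R \<Longrightarrow> \<bar>gr r z\<bar> \<le> M * s r z" "\<And>r z. (r, z) \<in> R \<Longrightarrow> \<bar>gz r z\<bar> \<le> M * s r z"
    and J: "\<And>r z. (r, z) \<in> R \<Longrightarrow>
       (s r z)\<^sup>2 \<le> M * ((k r z + r * kr r z) * gz r z - r * kz r z * gr r z)"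
    and tr: "\<And>r z. (r, z) \<in> R \<Longrightarrow> 0 \<le> k r z + r * kr r z + gz r z"
  shows "ae_distortion (profile_bound TYPE('n) M) F U"
proof (rule ae_distortionI[OF negligible_not_dominant[OF n]])
  fix x assume x: "x \<in> U" "x \<notin> {x. \<nexists>j. dominant x j}"
  then obtain j where j: "dominant x j" by blast
  have "differentiable_with_distortion (profile_bound TYPE('n) M)
      (\<lambda>x. with_height (k (hnorm x) (x $ vert) *\<^sub>R x) (g (hnorm x) (x $ vert))) x"
    unfolding profile_bound_def
    by (rule profile_distortion[OF j D(1)[OF R[OF x(1)]] D(2)[OF R[OF x(1)]] s[OF R[OF x(1)]] M
        k0(1)[OF R[OF x(1)]] k0(2)[OF R[OF x(1)]] b(1)[OF R[OF x(1)]] b(2)[OF R[OF x(1)]]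
        b(3)[OF R[OF x(1)]] b(4)[OF R[OF x(1)]] J[OF R[OF x(1)]] tr[OF R[OF x(1)]]])
  then show "differentiable_with_distortion (profile_bound TYPE('n) M) F x"
    by (rule differentiable_with_distortion_cong[OF _ U x(1)]) (rule F)
qed

lemma ae_distortion_Un:
  assumes "ae_distortion L f U" "ae_distortion L f V" "negligible N" "W \<subseteq> U \<union> V \<union> N"
  shows "ae_distortion L f W"
proof (rule ae_distortionI)
  show "negligible ({x \<in> U. \<not> differentiable_with_distortion L f x}
      \<union> {x \<in> V. \<not> differentiable_with_distortion L f x} \<union> N)"
    using assms unfolding ae_distortion_def by simp
qed (use assms(4) in auto)

lemma ae_distortion_cong_open:
  assumes "ae_distortion L f U" "open U" "\<And>x. x \<in> U \<Longrightarrow> g x = f x"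
  shows "ae_distortion L g U"
  by (rule ae_distortionI[OF assms(1)[unfolded ae_distortion_def]])
     (use assms in \<open>auto intro: differentiable_with_distortion_cong\<close>)

lemma locally_lipschitz_beam_sign:
  fixes u :: "real^'n \<Rightarrow> real^'n" and w :: "real^'n \<Rightarrow> real"
  assumes w: "locally_lipschitz w"
    and nz: "\<And>x. w x \<noteq> 0 \<Longrightarrow> x $ vert \<noteq> 0" "\<And>x. w x \<noteq> 0 \<Longrightarrow> hnorm (beam_fold (u x)) < 1"
    and u: "continuous_on {x. w x \<noteq> 0} u"
  shows "locally_lipschitz (\<lambda>x. (sgn (x $ vert) * sheet_sign (u x)) * w x)"
proof (rule locally_lipschitz_sign_switch[OF w])
  show "\<bar>sgn (x $ vert) * sheet_sign (u x)\<bar> \<le> 1" for x by (simp add: abs_mult sgn_if)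
  fix x y assume seg: "\<forall>z\<in>closed_segment x y. w z \<noteq> 0"
  then have sub: "closed_segment x y \<subseteq> {x. w x \<noteq> 0}" by blast
  have "sheet_sign (u x) = sheet_sign (u y)"
    by (rule sheet_sign_cong_no_wall[OF continuous_on_subset[OF u sub]]) (use seg nz in blast)
  moreover have "sgn (x $ vert) = sgn (y $ vert)"
  proof (rule ccontr)
    assume ne: "sgn (x $ vert) \<noteq> sgn (y $ vert)"
    have "connected ((\<lambda>z. z $ vert) ` closed_segment x y)"
      by (intro connected_continuous_image continuous_intros convex_connected convex_closed_segment)
    moreover have "x $ vert \<in> (\<lambda>z. z $ vert) ` closed_segment x y"
      "y $ vert \<in> (\<lambda>z. z $ vert) ` closed_segment x y" by auto
    moreover have "x $ vert \<noteq> 0" "y $ vert \<noteq> 0" using seg nz(1) by auto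
    then have "x $ vert \<le> 0 \<and> 0 \<le> y $ vert \<or> y $ vert \<le> 0 \<and> 0 \<le> x $ vert"
      using ne by (auto simp: sgn_if split: if_splits)
    ultimately have "0 \<in> (\<lambda>z. z $ vert) ` closed_segment x y"
      by (elim disjE conjE) (rule connectedD_interval; assumption)+
    then show False using seg nz(1) by force
  qed
  ultimately show "sgn (x $ vert) * sheet_sign (u x) = sgn (y $ vert) * sheet_sign (u y)" by simp
qed

lemma cnorm_0 [simp]: "cnorm 0 = 0" by (simp only: cnorm_eq_0)

section \<open>Power maps\<close>

text \<open>In the upper half space this is the beam map \<open>y \<mapsto> real d *\<^sub>R y\<close> in the logarithmic coordinates
\<open>log_chart\<close>, folded and mapped back by \<open>exp_chart\<close> (\<open>power_map_eq_extension\<close>). The explicit form extends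
continuously to the origin and shows homogeneity.\<close>

definition power_map :: "nat \<Rightarrow> real^'n \<Rightarrow> real^'n" where
  "power_map d x = (let u = real d *\<^sub>R (x /\<^sub>R cnorm x) in
     with_height (cnorm x ^ d *\<^sub>R beam_fold u)
       ((sgn (x $ vert) * sheet_sign u) * (cnorm x ^ d * (1 - hnorm (beam_fold u)))))"

text \<open>Points of height zero lie on the walls of the beam, and an odd factor keeps them on walls. So the
height of the image vanishes, and the two half spaces fit together.\<close>

lemma hnorm_beam_fold_equator:
  assumes "odd d" "x \<noteq> 0" "x $ vert = 0"
  shows "hnorm (beam_fold (real d *\<^sub>R (x /\<^sub>R cnorm x))) = 1"
proof -
  have c: "cnorm x > 0" using cnorm_pos assms by blast
  have "hnorm (x /\<^sub>R cnorm x) = 1" using c assms(3) by (simp add: cnorm_def)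
  then obtain i where i: "i \<noteq> vert" "\<bar>(x /\<^sub>R cnorm x) $ i\<bar> = 1" using hnorm_eq_1_component by blast
  have "\<bar>triangle_wave (of_int (int d) * (x /\<^sub>R cnorm x) $ i)\<bar> = 1"
    by (rule triangle_wave_odd_integer[OF _ i(2)]) (use assms(1) in simp)
  then have "1 \<le> hnorm (beam_fold (real d *\<^sub>R (x /\<^sub>R cnorm x)))"
    using component_le_hnorm[OF i(1), of "beam_fold (real d *\<^sub>R (x /\<^sub>R cnorm x))"] i(1) by (simp add: mult.assoc)
  then show ?thesis using hnorm_beam_fold_le_1 by (intro order_antisym)
qed

lemma power_map_0 [simp]: "d > 0 \<Longrightarrow> power_map d 0 = 0"
  by (simp add: power_map_def Let_def vec_eq_iff with_height_nth)

lemma hnorm_power_map: "hnorm (power_map d x) = cnorm x ^ d * hnorm (beam_fold (real d *\<^sub>R (x /\<^sub>R cnorm x)))"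
  by (simp add: power_map_def Let_def)

lemma cnorm_power_map:
  assumes "odd d" shows "cnorm (power_map d x) = cnorm x ^ d"
proof (cases "x = 0")
  case True
  then show ?thesis using assms by (simp add: odd_pos)
next
  case False
  let ?u = "real d *\<^sub>R (x /\<^sub>R cnorm x)"
  have "\<bar>power_map d x $ vert\<bar> = cnorm x ^ d * (1 - hnorm (beam_fold ?u))"
  proof (cases "x $ vert = 0")
    case True
    then show ?thesis using hnorm_beam_fold_equator[OF assms False True]
      by (simp add: power_map_def Let_def)
  next
    case nz: False
    have "\<bar>sgn (x $ vert)\<bar> = 1" using nz by (simp add: sgn_if)
    then show ?thesis using hnorm_beam_fold_le_1[of ?u]
      by (simp add: power_map_def Let_def abs_mult)
  qed
  then show ?thesis by (simp add: cnorm_def[of "power_map d x"] hnorm_power_map algebra_simps)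
qed

lemma power_map_scaleR:
  assumes "c > 0" shows "power_map d (c *\<^sub>R x) = c ^ d *\<^sub>R power_map d x"
proof -
  have "c *\<^sub>R x /\<^sub>R cnorm (c *\<^sub>R x) = x /\<^sub>R cnorm x" using assms by simp
  moreover have "sgn ((c *\<^sub>R x) $ vert) = sgn (x $ vert)" using assms by (simp add: sgn_mult)
  moreover have "cnorm (c *\<^sub>R x) = c * cnorm x" using assms by simp
  ultimately show ?thesis
    by (simp only: power_map_def Let_def power_mult_distrib) (simp add: vec_eq_iff with_height_nth)
qed

lemma power_map_compose:
  fixes x :: "real^'n"
  assumes a: "odd a" and d: "odd d"
  shows "power_map a (power_map d x) = power_map (a * d) x"
proof (cases "x = 0")
  case True
  then show ?thesis using assms by (simp add: odd_pos)
next
  case False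
  define w where "w = power_map d x"
  define u where "u = real d *\<^sub>R (x /\<^sub>R cnorm x)"
  have c: "cnorm x > 0" using False by (rule cnorm_pos)
  have cw: "cnorm w = cnorm x ^ d" unfolding w_def by (rule cnorm_power_map[OF d])
  have wi: "(real a *\<^sub>R (w /\<^sub>R cnorm w)) $ i = of_int (int a) * triangle_wave (u $ i)" if "i \<noteq> vert" for i
  proof -
    have "w $ i = cnorm x ^ d * triangle_wave (u $ i)"
      by (simp only: w_def power_map_def Let_def u_def[symmetric] with_height_simps(3)[OF that]
          vector_scaleR_component beam_fold_nth(2)[OF that] real_scaleR_def)
    then show ?thesis using c False by (simp add: cw field_simps)
  qed
  let ?v = "real a *\<^sub>R (w /\<^sub>R cnorm w)"
  let ?y = "real (a * d) *\<^sub>R (x /\<^sub>R cnorm x)"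
  have yi: "?y $ i = of_int (int a) * u $ i" for i by (simp add: u_def)
  have tri: "beam_fold ?v $ i = beam_fold ?y $ i" if "i \<noteq> vert" for i
    using a triangle_wave_mult_odd(1)[of "int a" "u $ i"]
    unfolding beam_fold_nth(2)[OF that] wi[OF that] yi by simp
  have h: "hnorm (beam_fold ?v) = hnorm (beam_fold ?y)" by (intro hnorm_cong arg_cong[of _ _ abs] tri)
  have sign: "sgn (w $ vert) * sheet_sign ?v = sgn (x $ vert) * sheet_sign ?y"
    if lt: "hnorm (beam_fold ?y) < 1"
  proof -
    have small: "\<bar>triangle_wave (of_int (int a) * u $ i)\<bar> < 1" if "i \<noteq> vert" for i
      using lt that yi[of i] unfolding hnorm_less_1_iff by (metis beam_fold_nth(2))
    have cs: "cell_sign (?y $ i) = cell_sign (u $ i) * cell_sign (?v $ i)" if "i \<noteq> vert" for i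
      unfolding yi wi[OF that] using a by (intro triangle_wave_mult_odd(2) small that) simp
    have "\<bar>triangle_wave (u $ i)\<bar> < 1" if "i \<noteq> vert" for i
    proof (rule ccontr)
      assume "\<not> \<bar>triangle_wave (u $ i)\<bar> < 1"
      then have "\<bar>triangle_wave (u $ i)\<bar> = 1" using triangle_wave_abs_le[of "u $ i"] by linarith
      then have "\<bar>triangle_wave (of_int (int a) * triangle_wave (u $ i))\<bar> = 1"
        using a by (intro triangle_wave_odd_integer) auto
      then show False using small[OF that] a triangle_wave_mult_odd(1)[of "int a" "u $ i"] by simp
    qed
    then have lt_u: "hnorm (beam_fold u) < 1" by (simp add: hnorm_less_1_iff)
    have "w $ vert = (sgn (x $ vert) * sheet_sign u) * (cnorm x ^ d * (1 - hnorm (beam_fold u)))"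
      by (simp add: w_def power_map_def Let_def u_def)
    moreover have "sgn (cnorm x ^ d * (1 - hnorm (beam_fold u))) = 1" using c lt_u by simp
    moreover have "sgn (sheet_sign u) = sheet_sign u"
      using sheet_sign_abs(1)[of u] by (auto simp: sgn_if abs_if split: if_splits)
    ultimately have "sgn (w $ vert) = sgn (x $ vert) * sheet_sign u" by (simp only: sgn_mult sgn_sgn mult_1_right)
    moreover have "sheet_sign ?y = sheet_sign u * sheet_sign ?v"
      unfolding sheet_sign_def prod.distrib[symmetric] by (intro prod.cong refl cs) simp
    ultimately show ?thesis
      using sheet_sign_abs(2)[of u] by simp
  qed
  show ?thesis
    unfolding w_def[symmetric]
  proof (subst vec_eq_iff, rule allI)
    fix i
    show "power_map a w $ i = power_map (a * d) x $ i"
    proof (cases "i = vert")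
      case False
      then show ?thesis using tri[OF False]
        by (simp add: power_map_def[of a w] power_map_def[of "a * d" x] Let_def cw power_mult mult.commute
            del: beam_fold_nth of_nat_mult vector_scaleR_component) (simp add: power_mult[symmetric] mult.commute)
    next
      case True
      have "power_map a w $ vert = (sgn (w $ vert) * sheet_sign ?v) * (cnorm w ^ a * (1 - hnorm (beam_fold ?y)))"
        by (simp only: power_map_def Let_def with_height_simps h)
      also have "\<dots> = (sgn (x $ vert) * sheet_sign ?y) * (cnorm w ^ a * (1 - hnorm (beam_fold ?y)))"
      proof (cases "hnorm (beam_fold ?y) < 1")
        case True
        then show ?thesis by (simp only: sign)
      next
        case False
        then have "hnorm (beam_fold ?y) = 1" using hnorm_beam_fold_le_1[of ?y] by linarith
        then show ?thesis by (simp only:) simp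
      qed
      also have "\<dots> = power_map (a * d) x $ vert"
        by (simp only: power_map_def Let_def with_height_simps cw power_mult[symmetric] mult.commute[of d a])
      finally show ?thesis using True by simp
    qed
  qed
qed

lemma locally_lipschitz_power_map_parts:
  assumes "d > 0"
  shows "locally_lipschitz (\<lambda>x::real^'n. cnorm x ^ d *\<^sub>R beam_fold (real d *\<^sub>R (x /\<^sub>R cnorm x)))"
    and "locally_lipschitz (\<lambda>x::real^'n. cnorm x ^ d * (1 - hnorm (beam_fold (real d *\<^sub>R (x /\<^sub>R cnorm x)))))"
proof -
  have c: "(1 / real CARD('n)) * norm x \<le> cnorm x" for x :: "real^'n"
    using norm_le_cnorm[of x] by (simp add: field_simps)
  have up: "\<exists>C. \<forall>x::real^'n. norm x \<le> R \<longrightarrow> \<bar>cnorm x ^ d\<bar> \<le> C * cnorm x" for R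
  proof (intro exI[of _ "(2 * R) ^ (d - 1)"] allI impI)
    fix x :: "real^'n" assume "norm x \<le> R"
    then have "cnorm x \<le> 2 * R" using cnorm_le_norm[of x] by linarith
    then have "cnorm x ^ (d - 1) * cnorm x \<le> (2 * R) ^ (d - 1) * cnorm x"
      by (intro mult_right_mono power_mono) auto
    then show "\<bar>cnorm x ^ d\<bar> \<le> (2 * R) ^ (d - 1) * cnorm x"
      using assms by (simp add: power_eq_if[of _ d] mult.commute)
  qed
  have lin: "locally_lipschitz (\<lambda>y::real^'n. real d *\<^sub>R y)"
    by (intro locally_lipschitz_bounded_linear bounded_linear_scaleR_right)
  have \<psi>1: "locally_lipschitz (\<lambda>y::real^'n. beam_fold (real d *\<^sub>R y))"
    by (rule locally_lipschitz_compose[OF locally_lipschitz_beam_fold lin])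
  then have \<psi>2: "locally_lipschitz (\<lambda>y::real^'n. 1 - hnorm (beam_fold (real d *\<^sub>R y)))"
    by (intro locally_lipschitz_diff locally_lipschitz_const
        locally_lipschitz_compose[OF locally_lipschitz_hnorm])
  have pos: "1 / real CARD('n) > 0" by simp
  note polar = locally_lipschitz_polar[OF locally_lipschitz_power[OF locally_lipschitz_cnorm]
      locally_lipschitz_cnorm pos c up]
  show "locally_lipschitz (\<lambda>x::real^'n. cnorm x ^ d *\<^sub>R beam_fold (real d *\<^sub>R (x /\<^sub>R cnorm x)))"
    using polar[OF \<psi>1] .
  show "locally_lipschitz (\<lambda>x::real^'n. cnorm x ^ d * (1 - hnorm (beam_fold (real d *\<^sub>R (x /\<^sub>R cnorm x)))))"
    using polar[OF \<psi>2] by simp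
qed

lemma locally_lipschitz_power_map:
  assumes "odd d" shows "locally_lipschitz (power_map d :: real^'n \<Rightarrow> real^'n)"
proof -
  have d: "d > 0" using assms by (simp add: odd_pos)
  have w: "locally_lipschitz (\<lambda>x::real^'n. (sgn (x $ vert) * sheet_sign (real d *\<^sub>R (x /\<^sub>R cnorm x))) *
      (cnorm x ^ d * (1 - hnorm (beam_fold (real d *\<^sub>R (x /\<^sub>R cnorm x))))))"
  proof (rule locally_lipschitz_beam_sign[OF locally_lipschitz_power_map_parts(2)[OF d]])
    let ?w = "\<lambda>x::real^'n. cnorm x ^ d * (1 - hnorm (beam_fold (real d *\<^sub>R (x /\<^sub>R cnorm x))))"
    fix x :: "real^'n" assume nz: "?w x \<noteq> 0"
    then have "x \<noteq> 0" using d by auto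
    then show "x $ vert \<noteq> 0" using hnorm_beam_fold_equator[OF assms] nz by auto
    show "hnorm (beam_fold (real d *\<^sub>R (x /\<^sub>R cnorm x))) < 1"
      using nz hnorm_beam_fold_le_1[of "real d *\<^sub>R (x /\<^sub>R cnorm x)"] unfolding mult_eq_0_iff by linarith
  next
    show "continuous_on {x::real^'n. cnorm x ^ d * (1 - hnorm (beam_fold (real d *\<^sub>R (x /\<^sub>R cnorm x)))) \<noteq> 0}
        (\<lambda>x. real d *\<^sub>R (x /\<^sub>R cnorm x))"
    proof (intro continuous_on_scaleR continuous_on_const continuous_on_inverse continuous_on_cnorm
        continuous_on_id ballI)
      fix x :: "real^'n"
      assume "x \<in> {x. cnorm x ^ d * (1 - hnorm (beam_fold (real d *\<^sub>R (x /\<^sub>R cnorm x)))) \<noteq> 0}"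
      then have "cnorm x ^ d \<noteq> 0" by (metis (mono_tags) mem_Collect_eq mult_zero_left)
      then show "cnorm x \<noteq> 0" using d by (metis zero_power)
    qed
  qed
  have eq: "power_map d = (\<lambda>x::real^'n. with_height (cnorm x ^ d *\<^sub>R beam_fold (real d *\<^sub>R (x /\<^sub>R cnorm x)))
      ((sgn (x $ vert) * sheet_sign (real d *\<^sub>R (x /\<^sub>R cnorm x))) *
      (cnorm x ^ d * (1 - hnorm (beam_fold (real d *\<^sub>R (x /\<^sub>R cnorm x)))))))"
    by (rule ext) (simp only: power_map_def Let_def)
  show ?thesis unfolding eq
    by (rule locally_lipschitz_with_height[OF locally_lipschitz_power_map_parts(1)[OF d] w])
qed

text \<open>Logarithmic coordinates of the upper half space: \<open>hnorm x + x $ vert\<close> is \<open>cnorm x\<close> there, and the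
horizontal cross section of the image is the unit cube. The map \<open>exp_chart\<close> is the inverse.\<close>

definition log_chart :: "real^'n \<Rightarrow> real^'n" where
  "log_chart x = with_height ((1 / (hnorm x + x $ vert)) *\<^sub>R x) (ln (hnorm x + x $ vert))"

definition exp_chart :: "real^'n \<Rightarrow> real^'n" where
  "exp_chart y = with_height (exp (y $ vert) *\<^sub>R y) (exp (y $ vert) * (1 - hnorm y))"

lemma ae_distortion_log_chart:
  assumes n: "CARD('n) \<ge> 2"
  shows "ae_distortion (profile_bound TYPE('n) 1) log_chart {x::real^'n. 0 < x $ vert}"
proof (rule profile_ae_distortion[OF n, where R = "{(r, z). 0 \<le> r \<and> 0 < z}"
    and k = "\<lambda>r z. 1 / (r + z)" and g = "\<lambda>r z. ln (r + z)"
    and kr = "\<lambda>r z. - 1 / (r + z)\<^sup>2" and kz = "\<lambda>r z. - 1 / (r + z)\<^sup>2"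
    and gr = "\<lambda>r z. 1 / (r + z)" and gz = "\<lambda>r z. 1 / (r + z)" and s = "\<lambda>r z. 1 / (r + z)"])
  show "open {x::real^'n. 0 < x $ vert}" by (intro open_Collect_less continuous_intros)
  fix r z :: real assume rz: "(r, z) \<in> {(r, z). 0 \<le> r \<and> 0 < z}"
  then have N: "r + z > 0" and r: "0 \<le> r" and z: "0 < z" by auto
  show "((\<lambda>p. 1 / (fst p + snd p)) has_derivative (\<lambda>p. - 1 / (r + z)\<^sup>2 * fst p + - 1 / (r + z)\<^sup>2 * snd p)) (at (r, z))"
    using N by (auto intro!: derivative_eq_intros simp: field_simps power2_eq_square)
      (simp add: diff_divide_distrib)
  show "((\<lambda>p. ln (fst p + snd p)) has_derivative (\<lambda>p. 1 / (r + z) * fst p + 1 / (r + z) * snd p)) (at (r, z))"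
    using N by (auto intro!: derivative_eq_intros simp: divide_inverse algebra_simps)
  have q: "r / (r + z)\<^sup>2 \<le> 1 / (r + z)"
  proof -
    have "r / (r + z)\<^sup>2 = (r / (r + z)) * (1 / (r + z))" by (simp add: power2_eq_square)
    also have "\<dots> \<le> 1 * (1 / (r + z))" using N z by (intro mult_right_mono) auto
    finally show ?thesis by simp
  qed
  show "\<bar>r * (- 1 / (r + z)\<^sup>2)\<bar> \<le> 1 * (1 / (r + z))" "\<bar>r * (- 1 / (r + z)\<^sup>2)\<bar> \<le> 1 * (1 / (r + z))"
    using q N r by (simp_all add: abs_mult)
  have "(1 / (r + z) + r * (- 1 / (r + z)\<^sup>2)) * (1 / (r + z)) - r * (- 1 / (r + z)\<^sup>2) * (1 / (r + z)) = (1 / (r + z))\<^sup>2"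
    by (simp add: power2_eq_square algebra_simps)
  then show "(1 / (r + z))\<^sup>2 \<le> 1 * ((1 / (r + z) + r * (- 1 / (r + z)\<^sup>2)) * (1 / (r + z)) - r * (- 1 / (r + z)\<^sup>2) * (1 / (r + z)))"
    by simp
  show "0 \<le> 1 / (r + z) + r * (- 1 / (r + z)\<^sup>2) + 1 / (r + z)"
  proof -
    have "r * (- 1 / (r + z)\<^sup>2) = - (r / (r + z)\<^sup>2)" by simp
    moreover have "1 / (r + z) \<ge> 0" using N by simp
    ultimately show ?thesis using q by linarith
  qed
qed (auto simp: log_chart_def)

lemma ae_distortion_exp_chart:
  assumes n: "CARD('n) \<ge> 2"
  shows "ae_distortion (profile_bound TYPE('n) 1) exp_chart {x::real^'n. hnorm x < 1 \<and> x $ vert \<in> UNIV}"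
proof (rule profile_ae_distortion[OF n, where R = "{(r, z). 0 \<le> r \<and> r < 1}"
    and k = "\<lambda>r z. exp z" and g = "\<lambda>r z. exp z * (1 - r)"
    and kr = "\<lambda>r z. 0" and kz = "\<lambda>r z. exp z"
    and gr = "\<lambda>r z. - exp z" and gz = "\<lambda>r z. exp z * (1 - r)" and s = "\<lambda>r z. exp z"])
  show "open {x::real^'n. hnorm x < 1 \<and> x $ vert \<in> UNIV}" by (auto intro!: open_Collect_less continuous_intros)
  fix r z :: real assume rz: "(r, z) \<in> {(r, z). 0 \<le> r \<and> r < 1}"
  then have r: "0 \<le> r" "r < 1" by auto
  show "((\<lambda>p. exp (snd p)) has_derivative (\<lambda>p. 0 * fst p + exp z * snd p)) (at (r, z))"
    by (auto intro!: derivative_eq_intros)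
  show "((\<lambda>p. exp (snd p) * (1 - fst p)) has_derivative (\<lambda>p. - exp z * fst p + exp z * (1 - r) * snd p)) (at (r, z))"
    by (auto intro!: derivative_eq_intros simp: algebra_simps)
  show "\<bar>r * exp z\<bar> \<le> 1 * exp z" "\<bar>exp z * (1 - r)\<bar> \<le> 1 * exp z"
    using r by (simp_all add: abs_mult)
  have "(exp z + r * 0) * (exp z * (1 - r)) - r * exp z * (- exp z) = (exp z)\<^sup>2"
    by (simp add: power2_eq_square algebra_simps)
  then show "(exp z)\<^sup>2 \<le> 1 * ((exp z + r * 0) * (exp z * (1 - r)) - r * exp z * (- exp z))" by simp
  show "0 \<le> exp z + r * 0 + exp z * (1 - r)" using r by simp
qed (auto simp: exp_chart_def)

lemma power_map_eq_extension:
  fixes x :: "real^'n"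
  assumes x: "x \<noteq> 0"
  shows "power_map d x = half_space_extension (\<lambda>x. beam_extension exp_chart (real d *\<^sub>R log_chart x)) x"
proof -
  let ?a = "with_height x \<bar>x $ vert\<bar>"
  let ?u = "real d *\<^sub>R (x /\<^sub>R cnorm x)"
  let ?v = "real d *\<^sub>R log_chart ?a"
  have c: "cnorm x > 0" using x by (rule cnorm_pos)
  have vi: "?v $ i = ?u $ i" if "i \<noteq> vert" for i
    using that by (simp add: log_chart_def cnorm_def field_simps)
  have vv: "exp (?v $ vert) = cnorm x ^ d"
    using c by (simp add: log_chart_def cnorm_def[symmetric] exp_of_nat_mult)
  have fold: "beam_fold ?v $ i = beam_fold ?u $ i" if "i \<noteq> vert" for i
    by (simp only: beam_fold_nth(2)[OF that] vi[OF that])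
  have h: "hnorm (beam_fold ?v) = hnorm (beam_fold ?u)" by (intro hnorm_cong arg_cong[of _ _ abs] fold)
  have s: "sheet_sign ?v = sheet_sign ?u"
    unfolding sheet_sign_def by (intro prod.cong refl arg_cong[of _ _ cell_sign] vi) simp
  have E: "exp_chart (beam_fold ?v) = with_height (cnorm x ^ d *\<^sub>R beam_fold ?u) (cnorm x ^ d * (1 - hnorm (beam_fold ?u)))"
    unfolding exp_chart_def beam_fold_nth vv h
    by (simp add: vec_eq_iff with_height_nth fold del: beam_fold_nth)
  show ?thesis
    unfolding half_space_extension_def Let_def beam_extension_def E s
    by (simp add: power_map_def Let_def mult.assoc)
qed

text \<open>The bound is that of the two charts; the factor \<open>d\<close> enters through a homothety only.\<close>

lemma ae_distortion_power_map:
  assumes n: "CARD('n) \<ge> 2" and d: "d > 0"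
  shows "ae_distortion (profile_bound TYPE('n) 1 * profile_bound TYPE('n) 1) (power_map d :: real^'n \<Rightarrow> real^'n) UNIV"
proof -
  let ?B = "profile_bound TYPE('n) 1"
  have B: "?B \<ge> 0" using profile_bound_ge_1[of 1, where 'n='n] by simp
  have "ae_distortion ?B (beam_extension exp_chart) {x::real^'n. x $ vert \<in> UNIV}"
    by (rule ae_distortion_beam_extension[OF ae_distortion_exp_chart[OF n]])
  then have 1: "ae_distortion ?B (beam_extension exp_chart) (UNIV :: (real^'n) set)" by simp
  have 2: "ae_distortion (1 * ?B) (\<lambda>x::real^'n. real d *\<^sub>R log_chart x) {x. 0 < x $ vert}"
    using d by (intro ae_distortion_compose[OF ae_distortion_scaleR[of "real d" UNIV] ae_distortion_log_chart[OF n]]) auto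
  have "ae_distortion (?B * (1 * ?B)) (\<lambda>x::real^'n. beam_extension exp_chart (real d *\<^sub>R log_chart x)) {x. 0 < x $ vert}"
    by (rule ae_distortion_compose[OF 1 2]) (use B in auto)
  then have "ae_distortion (?B * ?B) (\<lambda>x::real^'n. beam_extension exp_chart (real d *\<^sub>R log_chart x))
      {x. 0 < x $ vert \<and> cnorm x \<in> {0<..}}"
    by (rule ae_distortion_mono) auto
  then have 3: "ae_distortion (?B * ?B) (half_space_extension (\<lambda>x::real^'n. beam_extension exp_chart (real d *\<^sub>R log_chart x)))
      {x. cnorm x \<in> {0<..}}"
    by (rule ae_distortion_half_space_extension)
  have "ae_distortion (?B * ?B) (power_map d :: real^'n \<Rightarrow> real^'n) {x. cnorm x \<in> {0<..}}"
  proof (rule ae_distortion_cong_open[OF 3])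
    show "open {x::real^'n. cnorm x \<in> {0<..}}" by (auto intro!: open_Collect_less continuous_intros)
  qed (auto intro!: power_map_eq_extension)
  from ae_distortion_Un[OF this this negligible_sing[of "0::real^'n"]] show ?thesis
    using cnorm_pos by (metis (no_types, lifting) UNIV_I UnCI greaterThan_iff mem_Collect_eq singleton_iff subsetI)
qed

section \<open>Tripling the degree\<close>

text \<open>A chart of the part \<open>cnorm x < 2\<close> of the upper half space by a part of the beam of heights between \<open>0\<close>
and \<open>1\<close>. The flat cube \<open>cnorm x \<le> 1\<close> in height zero becomes the bottom of the beam, the rest of height zero
becomes its walls, and the level set \<open>cnorm x = 2\<close> becomes the cross section at height \<open>1\<close>. Inside the
double pyramid \<open>cnorm x \<le> 1\<close> the map is linear; this is what makes the transition map linear near the origin.\<close>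

definition inner_chart :: "real^'n \<Rightarrow> real^'n" where
  "inner_chart x = (let M = max 1 (cnorm x) in
     with_height ((1 / M) *\<^sub>R x) (M - 1 + x $ vert / M - x $ vert / 2))"

text \<open>The factor equals \<open>1\<close> near the bottom centre and \<open>2\<close> at height \<open>3\<close>, and it grows with the height
beyond the surface \<open>2 * y $ vert = 1 - hnorm y\<close>, where the minimum in \<open>slab_chart\<close> changes sides.\<close>

definition slab_factor :: "real^'n \<Rightarrow> real" where
  "slab_factor y = 1 + max 0 (2 * y $ vert + hnorm y - 1) / (5 + hnorm y)"

text \<open>A map of the beam of heights between \<open>0\<close> and \<open>3\<close> to the upper half space. Both the bottom and the walls go to
height zero, and the cross section at height \<open>3\<close> goes to the level set \<open>cnorm x = 2\<close>. Near the
centre of the bottom it inverts the linear part of \<open>inner_chart\<close>.\<close>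

definition slab_chart :: "real^'n \<Rightarrow> real^'n" where
  "slab_chart y = with_height (slab_factor y *\<^sub>R y) (slab_factor y * min (2 * y $ vert) (1 - hnorm y))"

text \<open>The linear part of \<open>inner_chart\<close> halves heights and that of \<open>slab_chart\<close> doubles them, so near the origin
only the factor \<open>3\<close> remains. This factor is odd and maps heights \<open>[0, 1]\<close> to \<open>[0, 3]\<close>.\<close>

definition inner_map :: "real^'n \<Rightarrow> real^'n" where
  "inner_map = half_space_extension (\<lambda>x. beam_extension slab_chart (3 *\<^sub>R inner_chart x))"

text \<open>The argument of the beam extension in \<open>inner_map\<close>, for points of both half spaces.\<close>

definition inner_arg :: "real^'n \<Rightarrow> real^'n" where
  "inner_arg x = 3 *\<^sub>R inner_chart (with_height x \<bar>x $ vert\<bar>)"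

lemma cnorm_with_height_abs [simp]: "cnorm (with_height x \<bar>x $ vert\<bar>) = cnorm x"
  by (simp add: cnorm_def)

lemma inner_arg_nth:
  "inner_arg x $ vert = 3 * (max 1 (cnorm x) - 1 + \<bar>x $ vert\<bar> / max 1 (cnorm x) - \<bar>x $ vert\<bar> / 2)"
  "i \<noteq> vert \<Longrightarrow> inner_arg x $ i = 3 * (x $ i / max 1 (cnorm x))"
  by (simp_all add: inner_arg_def inner_chart_def Let_def)

lemma inner_map_eq:
  "inner_map x = with_height (slab_factor (beam_fold (inner_arg x)) *\<^sub>R beam_fold (inner_arg x))
     ((sgn (x $ vert) * sheet_sign (inner_arg x)) *
       (slab_factor (beam_fold (inner_arg x)) * min (2 * inner_arg x $ vert) (1 - hnorm (beam_fold (inner_arg x)))))"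
  unfolding inner_map_def half_space_extension_def Let_def beam_extension_def slab_chart_def
      inner_arg_def[symmetric] by (simp add: mult.assoc)

lemma inner_arg_height_ge_0: "inner_arg x $ vert \<ge> 0"
proof -
  define M where "M = max 1 (cnorm x)"
  define z where "z = \<bar>x $ vert\<bar>"
  have "z \<le> cnorm x" by (simp add: cnorm_def z_def)
  then have M: "M \<ge> 1" "0 \<le> z" "z \<le> M" by (auto simp: M_def z_def)
  have "0 \<le> M - 1 + z / M - z / 2"
  proof (cases "M \<le> 2")
    case True
    then have "z / 2 \<le> z / M" using M by (intro divide_left_mono) auto
    then show ?thesis using M by linarith
  next
    case False
    moreover have "0 \<le> z / M" using M by simp
    ultimately show ?thesis using M by linarith
  qed
  then show ?thesis by (simp add: inner_arg_nth M_def z_def)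
qed

text \<open>The height of the image vanishes at height zero and on the walls, where the signs in \<open>inner_map\<close> may jump.\<close>

lemma inner_map_height_eq_0:
  fixes x :: "real^'n"
  assumes "x $ vert = 0 \<or> hnorm (beam_fold (inner_arg x)) = 1"
  shows "min (2 * inner_arg x $ vert) (1 - hnorm (beam_fold (inner_arg x))) = 0"
proof -
  have wall: "min (2 * inner_arg x $ vert) (1 - hnorm (beam_fold (inner_arg x))) = 0"
    if "hnorm (beam_fold (inner_arg x)) = 1"
    using that inner_arg_height_ge_0[of x] by (simp add: min_def)
  show ?thesis
  proof (cases "hnorm (beam_fold (inner_arg x)) = 1")
    case False
    then have z: "x $ vert = 0" using assms by simp
    have "cnorm x \<le> 1"
    proof (rule ccontr)
      assume "\<not> cnorm x \<le> 1"
      then have M: "max 1 (cnorm x) = hnorm x" "hnorm x > 0" using z by (auto simp: cnorm_def)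
      then have "hnorm (x /\<^sub>R hnorm x) = 1" by simp
      then obtain i where i: "i \<noteq> vert" "\<bar>(x /\<^sub>R hnorm x) $ i\<bar> = 1" using hnorm_eq_1_component by blast
      have "\<bar>triangle_wave (of_int 3 * (x /\<^sub>R hnorm x) $ i)\<bar> = 1"
        by (rule triangle_wave_odd_integer[OF _ i(2)]) simp
      then have "\<bar>beam_fold (inner_arg x) $ i\<bar> = 1"
        using i(1) M(1) by (simp add: inner_arg_nth field_simps)
      then have "1 \<le> hnorm (beam_fold (inner_arg x))"
        using component_le_hnorm[OF i(1), of "beam_fold (inner_arg x)"] by simp
      then show False using False hnorm_beam_fold_le_1[of "inner_arg x"] by linarith
    qed
    then have "inner_arg x $ vert = 0" using z by (simp add: inner_arg_nth)
    then show ?thesis using hnorm_beam_fold_le_1[of "inner_arg x"] by simp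
  qed (rule wall)
qed

lemma locally_lipschitz_inner_arg: "locally_lipschitz (inner_arg :: real^'n \<Rightarrow> real^'n)"
proof -
  have M: "locally_lipschitz (\<lambda>x::real^'n. max 1 (cnorm x))"
    by (intro locally_lipschitz_max locally_lipschitz_const locally_lipschitz_cnorm)
  have iM: "locally_lipschitz (\<lambda>x::real^'n. inverse (max 1 (cnorm x)))"
    by (rule locally_lipschitz_inverse[OF M zero_less_one max.cobounded1])
  have nth: "locally_lipschitz (\<lambda>x::real^'n. x $ i)" for i
    by (intro locally_lipschitz_bounded_linear bounded_linear_vec_nth)
  show ?thesis
  proof (rule locally_lipschitz_vec)
    fix i
    show "locally_lipschitz (\<lambda>x::real^'n. inner_arg x $ i)"
    proof (cases "i = vert")
      case True
      have "locally_lipschitz (\<lambda>x::real^'n. 3 * (max 1 (cnorm x) - 1 + \<bar>x $ vert\<bar> * inverse (max 1 (cnorm x)) - \<bar>x $ vert\<bar> * (1/2)))"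
        by (rule locally_lipschitz_mult[OF locally_lipschitz_const locally_lipschitz_diff[OF
              locally_lipschitz_add[OF locally_lipschitz_diff[OF M locally_lipschitz_const]
                locally_lipschitz_mult[OF locally_lipschitz_abs[OF nth] iM]]
              locally_lipschitz_mult[OF locally_lipschitz_abs[OF nth] locally_lipschitz_const]]])
      then show ?thesis by (simp only: True inner_arg_nth divide_inverse mult_1_left)
    next
      case False
      have "locally_lipschitz (\<lambda>x::real^'n. 3 * (x $ i * inverse (max 1 (cnorm x))))"
        by (rule locally_lipschitz_mult[OF locally_lipschitz_const locally_lipschitz_mult[OF nth iM]])
      then show ?thesis by (simp only: inner_arg_nth(2)[OF False] divide_inverse)
    qed
  qed
qed

lemma locally_lipschitz_slab_factor: "locally_lipschitz (slab_factor :: real^'n \<Rightarrow> real)"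
proof -
  have i: "locally_lipschitz (\<lambda>y::real^'n. inverse (5 + hnorm y))"
  proof (rule locally_lipschitz_inverse)
    show "locally_lipschitz (\<lambda>y::real^'n. 5 + hnorm y)"
      by (rule locally_lipschitz_add[OF locally_lipschitz_const locally_lipschitz_hnorm])
    show "0 < (5::real)" "5 \<le> 5 + hnorm y" for y :: "real^'n" by auto
  qed
  have "locally_lipschitz (\<lambda>y::real^'n. 1 + max 0 (2 * y $ vert + hnorm y - 1) * inverse (5 + hnorm y))"
    by (intro locally_lipschitz_mult locally_lipschitz_const locally_lipschitz_add locally_lipschitz_max
        locally_lipschitz_diff locally_lipschitz_hnorm i locally_lipschitz_bounded_linear bounded_linear_vec_nth)
  then show ?thesis unfolding slab_factor_def divide_inverse .
qed

lemma locally_lipschitz_inner_map: "locally_lipschitz (inner_map :: real^'n \<Rightarrow> real^'n)"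
proof -
  let ?y = "\<lambda>x::real^'n. beam_fold (inner_arg x)"
  have y: "locally_lipschitz ?y"
    by (rule locally_lipschitz_compose[OF locally_lipschitz_beam_fold locally_lipschitz_inner_arg])
  have f: "locally_lipschitz (\<lambda>x. slab_factor (?y x))"
    by (rule locally_lipschitz_compose[OF locally_lipschitz_slab_factor y])
  have w: "locally_lipschitz (\<lambda>x. slab_factor (?y x) * min (2 * inner_arg x $ vert) (1 - hnorm (?y x)))"
    by (intro locally_lipschitz_mult f locally_lipschitz_min locally_lipschitz_const locally_lipschitz_diff
        locally_lipschitz_nth[OF locally_lipschitz_inner_arg] locally_lipschitz_compose[OF locally_lipschitz_hnorm y])
  have s: "locally_lipschitz (\<lambda>x. (sgn (x $ vert) * sheet_sign (inner_arg x)) *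
      (slab_factor (?y x) * min (2 * inner_arg x $ vert) (1 - hnorm (?y x))))"
  proof (rule locally_lipschitz_beam_sign[OF w])
    fix x assume "slab_factor (?y x) * min (2 * inner_arg x $ vert) (1 - hnorm (?y x)) \<noteq> 0"
    then have "min (2 * inner_arg x $ vert) (1 - hnorm (?y x)) \<noteq> 0" by (metis mult_zero_right)
    then have n: "\<not> (x $ vert = 0 \<or> hnorm (?y x) = 1)" using inner_map_height_eq_0 by blast
    then show "x $ vert \<noteq> 0" by blast
    show "hnorm (?y x) < 1" using n hnorm_beam_fold_le_1[of "inner_arg x"] by linarith
  qed (rule locally_lipschitz_continuous_on[OF locally_lipschitz_inner_arg])
  have eq: "inner_map = (\<lambda>x. with_height (slab_factor (?y x) *\<^sub>R ?y x) ((sgn (x $ vert) * sheet_sign (inner_arg x)) *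
      (slab_factor (?y x) * min (2 * inner_arg x $ vert) (1 - hnorm (?y x)))))"
    by (rule ext) (rule inner_map_eq)
  show ?thesis unfolding eq
    by (intro locally_lipschitz_with_height locally_lipschitz_scaleR f y s)
qed

lemma inner_map_near_0:
  fixes x :: "real^'n"
  assumes x: "cnorm x \<le> 1/4" shows "inner_map x = 3 *\<^sub>R x"
proof -
  have M: "max 1 (cnorm x) = 1" using x by simp
  have comp: "\<bar>3 * x $ i\<bar> < 1" if "i \<noteq> vert" for i
    using component_le_hnorm[OF that, of x] x by (simp add: cnorm_def abs_mult)
  have v: "inner_arg x $ vert = 3 * \<bar>x $ vert\<bar> / 2" using M by (simp add: inner_arg_nth)
  have yi: "beam_fold (inner_arg x) $ i = 3 * x $ i" if "i \<noteq> vert" for i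
    using that M comp[OF that] by (simp add: inner_arg_nth triangle_wave_id)
  have h: "hnorm (beam_fold (inner_arg x)) = 3 * hnorm x"
  proof -
    have "hnorm (beam_fold (inner_arg x)) = hnorm (3 *\<^sub>R x)"
      by (rule hnorm_cong) (simp add: yi del: beam_fold_nth)
    then show ?thesis by simp
  qed
  have s: "sheet_sign (inner_arg x) = 1"
    unfolding sheet_sign_def by (rule prod.neutral) (use M comp in \<open>auto simp: inner_arg_nth cell_sign_1\<close>)
  have f: "slab_factor (beam_fold (inner_arg x)) = 1"
    using x h v by (simp add: slab_factor_def cnorm_def)
  have m: "min (2 * inner_arg x $ vert) (1 - hnorm (beam_fold (inner_arg x))) = 3 * \<bar>x $ vert\<bar>"
    using x unfolding v h by (simp add: cnorm_def min_def)
  have "sgn (x $ vert) * (3 * \<bar>x $ vert\<bar>) = 3 * x $ vert" by (simp add: sgn_if)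
  then show ?thesis
    unfolding inner_map_eq f s m by (simp add: vec_eq_iff with_height_nth yi del: beam_fold_nth)
qed

text \<open>On this level set \<open>inner_arg\<close> has height \<open>3\<close>, where \<open>slab_factor\<close> is \<open>2\<close>, and its horizontal part is that of
\<open>power_map 3\<close>, whose values are larger by \<open>2 ^ 3 / 2 = 4\<close>.\<close>

lemma inner_map_at_2:
  fixes x :: "real^'n"
  assumes x: "cnorm x = 2" shows "inner_map x = (1/4) *\<^sub>R power_map 3 x"
proof -
  let ?u = "real 3 *\<^sub>R (x /\<^sub>R cnorm x)"
  have v: "inner_arg x $ vert = 3" using x by (simp add: inner_arg_nth)
  have ui: "inner_arg x $ i = ?u $ i" if "i \<noteq> vert" for i using that x by (simp add: inner_arg_nth)
  have yi: "beam_fold (inner_arg x) $ i = beam_fold ?u $ i" if "i \<noteq> vert" for i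
    unfolding beam_fold_nth(2)[OF that] ui[OF that] ..
  have h: "hnorm (beam_fold (inner_arg x)) = hnorm (beam_fold ?u)"
    by (intro hnorm_cong arg_cong[of _ _ abs] yi)
  have s: "sheet_sign (inner_arg x) = sheet_sign ?u"
    unfolding sheet_sign_def by (intro prod.cong refl arg_cong[of _ _ cell_sign] ui) simp
  have f: "slab_factor (beam_fold (inner_arg x)) = 2"
  proof -
    have "1 + max 0 (2 * 3 + t - 1) / (5 + t) = 2" if "0 \<le> t" for t :: real
      using that by (simp add: max_def)
    from this[OF hnorm_ge_0] show ?thesis unfolding slab_factor_def beam_fold_nth(1) v h .
  qed
  have m: "min (2 * inner_arg x $ vert) (1 - hnorm (beam_fold (inner_arg x))) = 1 - hnorm (beam_fold ?u)"
    unfolding v h using hnorm_ge_0[of "beam_fold ?u"] by linarith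
  show ?thesis
    unfolding inner_map_eq f s m
    by (simp add: vec_eq_iff with_height_nth power_map_def Let_def x yi[unfolded x] del: beam_fold_nth)
qed

definition transition_map :: "real^'n \<Rightarrow> real^'n" where
  "transition_map x = (if cnorm x \<le> 2 then inner_map x else (1/4) *\<^sub>R power_map 3 x)"

lemma transition_map_near_0: "cnorm x \<le> 1/4 \<Longrightarrow> transition_map x = 3 *\<^sub>R x"
  by (simp add: transition_map_def inner_map_near_0)

lemma transition_map_far: "cnorm x \<ge> 2 \<Longrightarrow> transition_map x = (1/4) *\<^sub>R power_map 3 x"
  by (auto simp: transition_map_def inner_map_at_2)

lemma locally_lipschitz_transition_map: "locally_lipschitz (transition_map :: real^'n \<Rightarrow> real^'n)"
  unfolding transition_map_def
  by (intro locally_lipschitz_If locally_lipschitz_inner_map locally_lipschitz_scaleR locally_lipschitz_const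
      locally_lipschitz_power_map locally_lipschitz_continuous_on[OF locally_lipschitz_cnorm] inner_map_at_2) auto

lemma ae_distortion_slab_chart:
  assumes n: "CARD('n) \<ge> 2"
  shows "ae_distortion (profile_bound TYPE('n) 4) slab_chart {x::real^'n. hnorm x < 1 \<and> x $ vert \<in> {0<..<3}}"
proof -
  let ?U = "{x::real^'n. hnorm x < 1 \<and> x $ vert \<in> {0<..<3}}"
  let ?U1 = "?U \<inter> {x. 2 * x $ vert + hnorm x < 1}"
  let ?U2 = "?U \<inter> {x. 1 < 2 * x $ vert + hnorm x}"
  have cU: "?U = {x. hnorm x < 1} \<inter> {x. 0 < x $ vert} \<inter> {x. x $ vert < 3}" by auto
  have open1: "open ?U1" and open2: "open ?U2"
    unfolding cU by (intro open_Int open_Collect_less continuous_intros)+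
  have "ae_distortion (profile_bound TYPE('n) 4) slab_chart ?U1"
  proof (rule profile_ae_distortion[OF n _ open1, where R = UNIV
    and k = "\<lambda>r z. 1" and g = "\<lambda>r z. 2 * z"
    and kr = "\<lambda>r z. 0" and kz = "\<lambda>r z. 0" and gr = "\<lambda>r z. 0" and gz = "\<lambda>r z. 2" and s = "\<lambda>r z. 1"])
    show "slab_chart x = with_height (1 *\<^sub>R x) (2 * x $ vert)" if "x \<in> ?U1" for x
      using that by (simp add: slab_chart_def slab_factor_def)
    show "((\<lambda>p. 2 * snd p) has_derivative (\<lambda>p. 0 * fst p + 2 * snd p)) (at (r, z))" for r z :: real
      by (auto intro!: derivative_eq_intros)
  qed auto
  moreover have "ae_distortion (profile_bound TYPE('n) 4) slab_chart ?U2"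
  proof (rule profile_ae_distortion[OF n _ open2, where R = "{(r, z). 0 \<le> r \<and> r < 1 \<and> 0 < z \<and> z < 3 \<and> 1 < 2 * z + r}"
    and k = "\<lambda>r z. 1 + (2 * z + r - 1) / (5 + r)" and g = "\<lambda>r z. (1 + (2 * z + r - 1) / (5 + r)) * (1 - r)"
    and kr = "\<lambda>r z. (6 - 2 * z) / (5 + r)\<^sup>2" and kz = "\<lambda>r z. 2 / (5 + r)"
    and gr = "\<lambda>r z. (6 - 2 * z) / (5 + r)\<^sup>2 * (1 - r) - (1 + (2 * z + r - 1) / (5 + r))"
    and gz = "\<lambda>r z. 2 / (5 + r) * (1 - r)" and s = "\<lambda>r z. 1"])
    show "slab_chart x = with_height ((1 + (2 * x $ vert + hnorm x - 1) / (5 + hnorm x)) *\<^sub>R x)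
       ((1 + (2 * x $ vert + hnorm x - 1) / (5 + hnorm x)) * (1 - hnorm x))" if "x \<in> ?U2" for x
      using that by (simp add: slab_chart_def slab_factor_def min_def max_def)
    fix r z :: real assume rz: "(r, z) \<in> {(r, z). 0 \<le> r \<and> r < 1 \<and> 0 < z \<and> z < 3 \<and> 1 < 2 * z + r}"
    then have r: "0 \<le> r" "r < 1" and z: "0 < z" "z < 3" and rz1: "1 < 2 * z + r" by auto
    define f where "f = 1 + (2 * z + r - 1) / (5 + r)"
    define fr where "fr = (6 - 2 * z) / (5 + r)\<^sup>2"
    define fz where "fz = 2 / (5 + r)"
    have f: "1 \<le> f" "f \<le> 2" using r z rz1 by (auto simp: f_def field_simps)
    have fz: "1/3 \<le> fz" "fz \<le> 1" using r by (auto simp: fz_def field_simps)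
    have fr: "0 \<le> fr" "fr \<le> 1"
    proof -
      have "5\<^sup>2 \<le> (5 + r)\<^sup>2" using r by (intro power_mono) auto
      then show "0 \<le> fr" "fr \<le> 1" using z by (auto simp: fr_def divide_le_eq)
    qed
    have D: "((\<lambda>p. 1 + (2 * snd p + fst p - 1) / (5 + fst p)) has_derivative (\<lambda>p. fr * fst p + fz * snd p)) (at (r, z))"
    proof -
      have "((\<lambda>p. 1 + (2 * snd p + fst p - 1) / (5 + fst p)) has_derivative
          (\<lambda>p. ((2 * snd p + fst p) * (5 + r) - (2 * z + r - 1) * fst p) / ((5 + r) * (5 + r)))) (at (r, z))"
        using r by (auto intro!: derivative_eq_intros)
      moreover have "((2 * b + a) * (5 + r) - (2 * z + r - 1) * a) / ((5 + r) * (5 + r)) = fr * a + fz * b" for a b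
      proof -
        have "fz = 2 * (5 + r) / ((5 + r) * (5 + r))" using r by (simp add: fz_def divide_simps)
        moreover have "fr = (6 - 2 * z) / ((5 + r) * (5 + r))" by (simp add: fr_def power2_eq_square)
        ultimately show ?thesis by (simp only: times_divide_eq_left add_divide_distrib[symmetric]) (simp add: algebra_simps)
      qed
      ultimately show ?thesis by simp
    qed
    show "((\<lambda>p. 1 + (2 * snd p + fst p - 1) / (5 + fst p)) has_derivative
        (\<lambda>p. (6 - 2 * z) / (5 + r)\<^sup>2 * fst p + 2 / (5 + r) * snd p)) (at (r, z))"
      using D unfolding fr_def fz_def .
    have D1: "((\<lambda>p::real \<times> real. 1 - fst p) has_derivative (\<lambda>p. - fst p)) (at (r, z))"
      by (auto intro!: derivative_eq_intros)
    have "((\<lambda>p. (1 + (2 * snd p + fst p - 1) / (5 + fst p)) * (1 - fst p)) has_derivative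
        (\<lambda>p. f * (- fst p) + (fr * fst p + fz * snd p) * (1 - r))) (at (r, z))"
      using has_derivative_mult[OF D D1] by (simp add: f_def)
    moreover have "(\<lambda>p. f * (- fst p) + (fr * fst p + fz * snd p) * (1 - r))
        = (\<lambda>p. (fr * (1 - r) - f) * fst p + fz * (1 - r) * snd p)"
      by (simp add: fun_eq_iff algebra_simps)
    ultimately have "((\<lambda>p. (1 + (2 * snd p + fst p - 1) / (5 + fst p)) * (1 - fst p)) has_derivative
        (\<lambda>p. (fr * (1 - r) - f) * fst p + fz * (1 - r) * snd p)) (at (r, z))"
      by (simp only:)
    then show "((\<lambda>p. (1 + (2 * snd p + fst p - 1) / (5 + fst p)) * (1 - fst p)) has_derivative
        (\<lambda>p. ((6 - 2 * z) / (5 + r)\<^sup>2 * (1 - r) - (1 + (2 * z + r - 1) / (5 + r))) * fst p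
          + 2 / (5 + r) * (1 - r) * snd p)) (at (r, z))"
      unfolding fr_def fz_def f_def .
    show "(1::real) \<le> 4 * (1 + (2 * z + r - 1) / (5 + r))" "1 + (2 * z + r - 1) / (5 + r) \<le> 4 * 1"
      unfolding f_def[symmetric] using f by simp_all
    have m1: "0 \<le> a * b \<and> a * b \<le> 1" if "0 \<le> a" "a \<le> 1" "0 \<le> b" "b \<le> 1" for a b :: real
      using that by (simp add: mult_le_one)
    show "\<bar>r * ((6 - 2 * z) / (5 + r)\<^sup>2)\<bar> \<le> 4 * 1" "\<bar>r * (2 / (5 + r))\<bar> \<le> 4 * 1"
      "\<bar>2 / (5 + r) * (1 - r)\<bar> \<le> 4 * 1"
      unfolding fr_def[symmetric] fz_def[symmetric]
      using m1[of r fr] m1[of r fz] m1[of fz "1 - r"] r fr fz by auto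
    show "\<bar>(6 - 2 * z) / (5 + r)\<^sup>2 * (1 - r) - (1 + (2 * z + r - 1) / (5 + r))\<bar> \<le> 4 * 1"
      unfolding fr_def[symmetric] f_def[symmetric] using m1[of fr "1 - r"] r fr f by linarith
    have "(f + r * fr) * (fz * (1 - r)) - r * fz * (fr * (1 - r) - f) = fz * f" by (simp add: algebra_simps)
    moreover have "1/3 * 1 \<le> fz * f" using f fz by (intro mult_mono) auto
    ultimately show "1\<^sup>2 \<le> 4 * ((1 + (2 * z + r - 1) / (5 + r) + r * ((6 - 2 * z) / (5 + r)\<^sup>2)) * (2 / (5 + r) * (1 - r))
       - r * (2 / (5 + r)) * ((6 - 2 * z) / (5 + r)\<^sup>2 * (1 - r) - (1 + (2 * z + r - 1) / (5 + r))))"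
      unfolding fr_def[symmetric] fz_def[symmetric] f_def[symmetric] by simp
    show "0 \<le> 1 + (2 * z + r - 1) / (5 + r) + r * ((6 - 2 * z) / (5 + r)\<^sup>2) + 2 / (5 + r) * (1 - r)"
      unfolding fr_def[symmetric] fz_def[symmetric] f_def[symmetric]
      using m1[of r fr] m1[of fz "1 - r"] r fr fz f by auto
  qed auto
  ultimately show ?thesis
    by (rule ae_distortion_Un[OF _ _ negligible_hnorm_level[OF n, of 2 1]]) auto
qed

lemma ae_distortion_inner_chart:
  assumes n: "CARD('n) \<ge> 2"
  shows "ae_distortion (profile_bound TYPE('n) 4) inner_chart {x::real^'n. 0 < x $ vert \<and> cnorm x < 2}"
proof -
  let ?U1 = "{x::real^'n. 0 < x $ vert} \<inter> {x. cnorm x < 1}"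
  let ?U2 = "{x::real^'n. 0 < x $ vert} \<inter> {x. 1 < cnorm x} \<inter> {x. cnorm x < 2}"
  have open1: "open ?U1" and open2: "open ?U2"
    by (intro open_Int open_Collect_less continuous_intros)+
  have "ae_distortion (profile_bound TYPE('n) 4) inner_chart ?U1"
  proof (rule profile_ae_distortion[OF n _ open1, where R = UNIV
    and k = "\<lambda>r z. 1" and g = "\<lambda>r z. z / 2"
    and kr = "\<lambda>r z. 0" and kz = "\<lambda>r z. 0" and gr = "\<lambda>r z. 0" and gz = "\<lambda>r z. 1/2" and s = "\<lambda>r z. 1"])
    show "inner_chart x = with_height (1 *\<^sub>R x) (x $ vert / 2)" if "x \<in> ?U1" for x
      using that by (simp add: inner_chart_def)
    show "((\<lambda>p. snd p / 2) has_derivative (\<lambda>p. 0 * fst p + 1/2 * snd p)) (at (r, z))" for r z :: real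
      by (auto intro!: derivative_eq_intros)
  qed auto
  moreover have "ae_distortion (profile_bound TYPE('n) 4) inner_chart ?U2"
  proof (rule profile_ae_distortion[OF n _ open2, where R = "{(r, z). 0 \<le> r \<and> 0 < z \<and> 1 < r + z \<and> r + z < 2}"
    and k = "\<lambda>r z. 1 / (r + z)" and g = "\<lambda>r z. (r + z) / 2 + r / 2 - r / (r + z)"
    and kr = "\<lambda>r z. - 1 / (r + z)\<^sup>2" and kz = "\<lambda>r z. - 1 / (r + z)\<^sup>2"
    and gr = "\<lambda>r z. 1 - 1 / (r + z) + r / (r + z)\<^sup>2" and gz = "\<lambda>r z. 1/2 + r / (r + z)\<^sup>2" and s = "\<lambda>r z. 1"])
    show "inner_chart x = with_height ((1 / (hnorm x + x $ vert)) *\<^sub>R x)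
       ((hnorm x + x $ vert) / 2 + hnorm x / 2 - hnorm x / (hnorm x + x $ vert))" if "x \<in> ?U2" for x
    proof -
      have "cnorm x = hnorm x + x $ vert" "cnorm x > 1" using that by (auto simp: cnorm_def)
      then show ?thesis by (simp add: inner_chart_def field_simps)
    qed
    show "(hnorm x, x $ vert) \<in> {(r, z). 0 \<le> r \<and> 0 < z \<and> 1 < r + z \<and> r + z < 2}" if "x \<in> ?U2" for x
      using that by (auto simp: cnorm_def)
    fix r z :: real assume rz: "(r, z) \<in> {(r, z). 0 \<le> r \<and> 0 < z \<and> 1 < r + z \<and> r + z < 2}"
    then have r: "0 \<le> r" "0 < z" "1 < r + z" "r + z < 2" by auto
    define a where "a = 1 / (r + z)"
    define b where "b = r / (r + z)\<^sup>2"
    have a: "1/2 \<le> a" "a \<le> 1" using r by (auto simp: a_def field_simps)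
    have "b = (r / (r + z)) * a" by (simp add: a_def b_def power2_eq_square)
    moreover have "0 \<le> r / (r + z)" "r / (r + z) \<le> 1" using r by auto
    ultimately have b: "0 \<le> b" "b \<le> a" using a
      mult_left_le_one_le[of a "r / (r + z)"] by (auto simp del: times_divide_eq_left)
    have ne: "r + z \<noteq> 0" using r by simp
    have rk: "r * (- 1 / (r + z)\<^sup>2) = - b" by (simp add: b_def)
    show D: "((\<lambda>p. 1 / (fst p + snd p)) has_derivative (\<lambda>p. - 1 / (r + z)\<^sup>2 * fst p + - 1 / (r + z)\<^sup>2 * snd p)) (at (r, z))"
      using ne by (auto intro!: derivative_eq_intros simp: field_simps power2_eq_square)
        (simp add: diff_divide_distrib)
    have D2: "((\<lambda>p. fst p * (1 / (fst p + snd p))) has_derivative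
        (\<lambda>p. r * (- 1 / (r + z)\<^sup>2 * fst p + - 1 / (r + z)\<^sup>2 * snd p) + fst p * (1 / (r + z)))) (at (r, z))"
      using has_derivative_mult[OF has_derivative_fst[OF has_derivative_ident] D] by simp
    have D3: "((\<lambda>p::real \<times> real. (fst p + snd p) / 2 + fst p / 2) has_derivative (\<lambda>p. fst p + snd p / 2)) (at (r, z))"
      by (auto intro!: derivative_eq_intros simp: add_divide_distrib)
    show "((\<lambda>p. (fst p + snd p) / 2 + fst p / 2 - fst p / (fst p + snd p)) has_derivative
       (\<lambda>p. (1 - 1 / (r + z) + r / (r + z)\<^sup>2) * fst p + (1/2 + r / (r + z)\<^sup>2) * snd p)) (at (r, z))"
      using has_derivative_diff[OF D3 D2] by (simp add: algebra_simps)
    show "(1::real) \<le> 4 * (1 / (r + z))" "1 / (r + z) \<le> 4 * 1"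
      unfolding a_def[symmetric] using a by simp_all
    show "\<bar>r * (- 1 / (r + z)\<^sup>2)\<bar> \<le> 4 * 1" "\<bar>r * (- 1 / (r + z)\<^sup>2)\<bar> \<le> 4 * 1" unfolding rk using a b by auto
    show "\<bar>1 - 1 / (r + z) + r / (r + z)\<^sup>2\<bar> \<le> 4 * 1" "\<bar>1/2 + r / (r + z)\<^sup>2\<bar> \<le> 4 * 1"
      unfolding a_def[symmetric] b_def[symmetric] using a b by auto
    have "(a - b) * (1/2 + b) + b * (1 - a + b) = a / 2 + b / 2" by (simp add: field_simps)
    then show "1\<^sup>2 \<le> 4 * ((1 / (r + z) + r * (- 1 / (r + z)\<^sup>2)) * (1/2 + r / (r + z)\<^sup>2) -
        r * (- 1 / (r + z)\<^sup>2) * (1 - 1 / (r + z) + r / (r + z)\<^sup>2))"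
      unfolding rk a_def[symmetric] b_def[symmetric] using a b by simp
    show "0 \<le> 1 / (r + z) + r * (- 1 / (r + z)\<^sup>2) + (1/2 + r / (r + z)\<^sup>2)"
      unfolding rk a_def[symmetric] b_def[symmetric] using a b by simp
  qed auto
  ultimately show ?thesis
    by (rule ae_distortion_Un[OF _ _ negligible_cnorm_level[OF n, of 1]]) auto
qed

lemma inner_chart_height:
  assumes x: "0 < x $ vert" "cnorm x < 2"
  shows "inner_chart x $ vert \<in> {0<..<1}"
proof -
  define M where "M = max 1 (cnorm x)"
  define z where "z = x $ vert"
  have "z \<le> cnorm x" using x(1) by (simp add: cnorm_def z_def)
  then have M: "1 \<le> M" "M < 2" "0 < z" "z \<le> M" using x by (auto simp: M_def z_def)
  have "z * M < z * 2" using M by simp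
  then have lo: "z / 2 < z / M" using M by (simp add: field_simps)
  have "z * (1 / M - 1 / 2) \<le> M * (1 / M - 1 / 2)"
    using M by (intro mult_right_mono) (auto simp: field_simps)
  also have "\<dots> = 1 - M / 2" using M by (simp add: right_diff_distrib)
  finally have hi: "z / M - z / 2 \<le> 1 - M / 2" by (simp add: right_diff_distrib)
  have "inner_chart x $ vert = M - 1 + z / M - z / 2"
    by (simp add: inner_chart_def Let_def M_def z_def)
  then show ?thesis using lo hi M by simp
qed

lemma ae_distortion_transition_map:
  fixes B :: real
  assumes n: "CARD('n) \<ge> 2"
  defines "B \<equiv> profile_bound TYPE('n) 4"
  shows "ae_distortion (B * B) (transition_map :: real^'n \<Rightarrow> real^'n) UNIV"
proof -
  have B: "B \<ge> 0" using profile_bound_ge_1[of 4, where 'n='n] by (simp add: B_def)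
  have 1: "ae_distortion B (beam_extension slab_chart) {x::real^'n. x $ vert \<in> {0<..<3}}"
    unfolding B_def by (rule ae_distortion_beam_extension[OF ae_distortion_slab_chart[OF n]])
  have 2: "ae_distortion (1 * B) (\<lambda>x::real^'n. 3 *\<^sub>R inner_chart x) {x. 0 < x $ vert \<and> cnorm x < 2}"
    unfolding B_def
    by (intro ae_distortion_compose[OF ae_distortion_scaleR[of 3 UNIV] ae_distortion_inner_chart[OF n]]) auto
  have "ae_distortion (B * (1 * B)) (\<lambda>x::real^'n. beam_extension slab_chart (3 *\<^sub>R inner_chart x))
      {x. 0 < x $ vert \<and> cnorm x < 2}"
    by (rule ae_distortion_compose[OF 1 2 _ B]) (use inner_chart_height in force)
  then have "ae_distortion (B * B) (\<lambda>x::real^'n. beam_extension slab_chart (3 *\<^sub>R inner_chart x))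
      {x. 0 < x $ vert \<and> cnorm x \<in> {..<2}}"
    by (rule ae_distortion_mono) auto
  then have 3: "ae_distortion (B * B) (inner_map :: real^'n \<Rightarrow> real^'n) {x. cnorm x \<in> {..<2}}"
    unfolding inner_map_def by (rule ae_distortion_half_space_extension)
  have 4: "ae_distortion (B * B) (transition_map :: real^'n \<Rightarrow> real^'n) {x. cnorm x \<in> {..<2}}"
    by (rule ae_distortion_cong_open[OF 3]) (auto intro!: open_Collect_less continuous_intros simp: transition_map_def)
  let ?B = "profile_bound TYPE('n) 1"
  have le: "?B \<le> B" by (simp add: B_def profile_bound_def)
  have "ae_distortion (1 * (?B * ?B)) (\<lambda>x::real^'n. (1/4) *\<^sub>R power_map 3 x) UNIV"
    by (rule ae_distortion_compose[OF ae_distortion_scaleR[of "1/4" UNIV] ae_distortion_power_map[OF n, of 3]]) auto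
  then have "ae_distortion (B * B) (\<lambda>x::real^'n. (1/4) *\<^sub>R power_map 3 x) {x. 2 < cnorm x}"
    by (rule ae_distortion_mono) (use le profile_bound_ge_1[of 1, where 'n='n] in \<open>auto intro!: mult_mono\<close>)
  then have 5: "ae_distortion (B * B) (transition_map :: real^'n \<Rightarrow> real^'n) {x. 2 < cnorm x}"
    by (rule ae_distortion_cong_open) (auto intro!: open_Collect_less continuous_intros simp: transition_map_def)
  show ?thesis
    by (rule ae_distortion_Un[OF 4 5 negligible_cnorm_level[OF n, of 2]]) auto
qed

section \<open>Closed sets as zero sets of small differentiable functions\<close>

lemma DERIV_max_0_squared: "((\<lambda>s::real. (max 0 s)\<^sup>2) has_real_derivative 2 * max 0 s) (at s)"
proof -
  consider "s > 0" | "s < 0" | "s = 0" by linarith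
  then show ?thesis
  proof cases
    case 1
    have "((\<lambda>s. s\<^sup>2) has_real_derivative 2 * s) (at s)" by (auto intro!: derivative_eq_intros)
    then have "((\<lambda>s::real. (max 0 s)\<^sup>2) has_real_derivative 2 * s) (at s)"
      by (rule has_field_derivative_transform_within_open[where S = "{0<..}"]) (use 1 in auto)
    then show ?thesis using 1 by simp
  next
    case 2
    have "((\<lambda>s. 0) has_real_derivative 0) (at s)" by simp
    then have "((\<lambda>s::real. (max 0 s)\<^sup>2) has_real_derivative 0) (at s)"
      by (rule has_field_derivative_transform_within_open[where S = "{..<0}"]) (use 2 in auto)
    then show ?thesis using 2 by simp
  next
    case 3
    have "((\<lambda>h::real. ((max 0 (0 + h))\<^sup>2 - (max 0 0)\<^sup>2) / h) \<longlongrightarrow> 0) (at 0)"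
    proof (rule Lim_null_comparison[where g = abs])
      have "norm (((max 0 (0 + h))\<^sup>2 - (max 0 0)\<^sup>2) / h) \<le> \<bar>h\<bar>" for h :: real
        by (simp add: max_def power2_eq_square)
      then show "\<forall>\<^sub>F h in at 0. norm (((max 0 (0 + h))\<^sup>2 - (max 0 0)\<^sup>2) / h) \<le> \<bar>h::real\<bar>" by simp
      show "(abs \<longlongrightarrow> 0) (at (0::real))" by (intro tendsto_rabs_zero tendsto_ident_at)
    qed
    then show ?thesis using 3 by (simp add: DERIV_def)
  qed
qed

text \<open>The square of the positive part of a paraboloid. Its support is bounded, so a small multiple meets the bound on the
derivative even with the weight \<open>1 + norm x\<close>.\<close>

lemma bump_function:
  fixes a :: "'a::euclidean_space"
  assumes \<rho>: "\<rho> > 0" and \<delta>: "\<delta> > 0"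
  obtains b :: "'a \<Rightarrow> real" and b' :: "'a \<Rightarrow> 'a \<Rightarrow> real" where
    "\<And>x. 0 \<le> b x" "\<And>x. b x \<le> \<delta>" "\<And>x. b x \<noteq> 0 \<longleftrightarrow> x \<in> ball a \<rho>"
    "\<And>x. (b has_derivative b' x) (at x)" "\<And>x h. (1 + norm x) * \<bar>b' x h\<bar> \<le> \<delta> * norm h"
proof -
  define m where "m = (1 + norm a + \<rho>) * (1 + \<rho> ^ 4 + 4 * \<rho> ^ 3)"
  define c where "c = \<delta> / m"
  define q where "q x = \<rho>\<^sup>2 - (x - a) \<bullet> (x - a)" for x
  define b where "b x = c * (max 0 (q x))\<^sup>2" for x
  define b' where "b' x h = c * (- 4 * max 0 (q x) * ((x - a) \<bullet> h))" for x h
  have "1 + \<rho> ^ 4 + 4 * \<rho> ^ 3 \<ge> 1" "1 + norm a + \<rho> \<ge> 1" using \<rho> by (auto simp: add_nonneg_nonneg)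
  then have m: "m \<ge> 1 + \<rho> ^ 4 + 4 * \<rho> ^ 3"
    unfolding m_def using mult_right_mono[of 1 "1 + norm a + \<rho>" "1 + \<rho> ^ 4 + 4 * \<rho> ^ 3"] by simp
  then have m: "m > 0" "m \<ge> 1 + \<rho> ^ 4 + 4 * \<rho> ^ 3"
    using \<open>1 + \<rho> ^ 4 + 4 * \<rho> ^ 3 \<ge> 1\<close> by linarith+
  have c: "c > 0" using \<delta> m by (simp add: c_def)
  have q: "q x \<le> \<rho>\<^sup>2" "q x > 0 \<longleftrightarrow> x \<in> ball a \<rho>" for x
  proof -
    show "q x \<le> \<rho>\<^sup>2" by (simp add: q_def)
    have "q x > 0 \<longleftrightarrow> (norm (x - a))\<^sup>2 < \<rho>\<^sup>2" by (simp add: q_def power2_norm_eq_inner)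
    also have "\<dots> \<longleftrightarrow> norm (x - a) < \<rho>" 
    proof
      show "(norm (x - a))\<^sup>2 < \<rho>\<^sup>2 \<Longrightarrow> norm (x - a) < \<rho>"
        using \<rho> by (intro power2_less_imp_less[of _ \<rho>]) auto
      show "norm (x - a) < \<rho> \<Longrightarrow> (norm (x - a))\<^sup>2 < \<rho>\<^sup>2"
        by (intro power_strict_mono) auto
    qed
    finally show "q x > 0 \<longleftrightarrow> x \<in> ball a \<rho>" by (simp add: dist_norm norm_minus_commute)
  qed
  show thesis
  proof (rule that[of b b'])
    fix x
    show "0 \<le> b x" using c by (simp add: b_def)
    show "b x \<le> \<delta>"
    proof -
      have "(max 0 (q x))\<^sup>2 \<le> (\<rho>\<^sup>2)\<^sup>2" using q(1)[of x] by (intro power_mono) auto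
      also have "\<dots> \<le> m" using m(2) \<rho> by (simp add: power2_eq_square power4_eq_xxxx) (smt (verit) zero_less_power mult.assoc)
      finally have "c * (max 0 (q x))\<^sup>2 \<le> c * m" using c by simp
      then show ?thesis using m by (simp add: b_def c_def)
    qed
    show "b x \<noteq> 0 \<longleftrightarrow> x \<in> ball a \<rho>" using c q(2)[of x] by (auto simp: b_def max_def)
    have Dq: "(q has_derivative (\<lambda>h. - 2 * ((x - a) \<bullet> h))) (at x)"
      unfolding q_def by (auto intro!: derivative_eq_intros simp: inner_commute)
    then have "((\<lambda>x. (max 0 (q x))\<^sup>2) has_derivative (\<lambda>h. (- 2 * ((x - a) \<bullet> h)) * (2 * max 0 (q x)))) (at x)"
      using has_derivative_compose[OF Dq DERIV_max_0_squared[unfolded has_field_derivative_def]]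
      by (simp only: mult.commute[of "2 * max 0 (q x)"])
    then have "(b has_derivative (\<lambda>h. c * ((- 2 * ((x - a) \<bullet> h)) * (2 * max 0 (q x))))) (at x)"
      unfolding b_def by (rule has_derivative_mult_right)
    then show "(b has_derivative b' x) (at x)"
      by (simp add: b'_def[abs_def] mult_ac)
    fix h
    show "(1 + norm x) * \<bar>b' x h\<bar> \<le> \<delta> * norm h"
    proof (cases "x \<in> ball a \<rho>")
      case False
      then have "max 0 (q x) = 0" using q(2)[of x] by simp
      then show ?thesis using \<delta> by (simp add: b'_def)
    next
      case True
      then have d: "norm (x - a) \<le> \<rho>" by (simp add: dist_norm norm_minus_commute)
      have nx: "1 + norm x \<le> 1 + norm a + \<rho>" using norm_triangle_sub[of x a] d by simp
      have "\<bar>b' x h\<bar> = c * (4 * max 0 (q x) * \<bar>(x - a) \<bullet> h\<bar>)" using c by (simp add: b'_def abs_mult)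
      also have "\<dots> \<le> c * (4 * \<rho>\<^sup>2 * (\<rho> * norm h))"
      proof -
        have "\<bar>(x - a) \<bullet> h\<bar> \<le> norm (x - a) * norm h" by (rule Cauchy_Schwarz_ineq2)
        also have "\<dots> \<le> \<rho> * norm h" using d by (intro mult_right_mono) auto
        finally show ?thesis using c q(1)[of x] \<rho> by (intro mult_left_mono mult_mono) auto
      qed
      finally have "(1 + norm x) * \<bar>b' x h\<bar> \<le> (1 + norm a + \<rho>) * (c * (4 * \<rho>\<^sup>2 * (\<rho> * norm h)))"
        using nx c \<rho> by (intro mult_mono) auto
      also have "\<dots> = c * ((1 + norm a + \<rho>) * (4 * \<rho> ^ 3)) * norm h"
        by (simp add: power2_eq_square power3_eq_cube)
      also have "\<dots> \<le> c * m * norm h"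
      proof -
        have "(1 + norm a + \<rho>) * (4 * \<rho> ^ 3) \<le> m"
          unfolding m_def using \<rho> by (intro mult_left_mono) (auto simp: add_nonneg_nonneg)
        then show ?thesis using c by (intro mult_right_mono mult_left_mono) auto
      qed
      finally show ?thesis using m by (simp add: c_def)
    qed
  qed
qed

text \<open>The complement is a countable union of balls; the bumps of these balls are summed with bounds
\<open>\<delta> / 2 ^ Suc k\<close>. The weight \<open>1 + norm x\<close> makes \<open>v\<close> vary slowly relative to the
distance from the origin, which is the relevant scale for a radial stretching.\<close>

lemma closed_zero_set:
  fixes T :: "'a::euclidean_space set"
  assumes T: "closed T" and \<delta>: "\<delta> > 0"
  obtains v :: "'a \<Rightarrow> real" and v' :: "'a \<Rightarrow> 'a \<Rightarrow> real" where
    "\<And>x. 0 \<le> v x" "\<And>x. v x \<le> \<delta>" "\<And>x. v x = 0 \<longleftrightarrow> x \<in> T"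
    "\<And>x. (v has_derivative v' x) (at x)" "\<And>x h. (1 + norm x) * \<bar>v' x h\<bar> \<le> \<delta> * norm h"
proof (cases "T = UNIV")
  case True
  show thesis by (rule that[of "\<lambda>_. 0" "\<lambda>_ _. 0"]) (use True \<delta> in auto)
next
  case False
  let ?U = "- T"
  let ?F = "{ball x e |x e. e > 0 \<and> ball x e \<subseteq> ?U}"
  have "open ?U" using T by auto
  have "\<Union>?F = ?U"
  proof
    show "?U \<subseteq> \<Union>?F"
    proof
      fix x assume "x \<in> ?U"
      then obtain e where "e > 0" "ball x e \<subseteq> ?U" using \<open>open ?U\<close> by (meson openE)
      then show "x \<in> \<Union>?F" by (intro UnionI[of "ball x e"]) auto
    qed
  qed auto
  moreover obtain F' where F': "F' \<subseteq> ?F" "countable F'" "\<Union>F' = \<Union>?F"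
    by (rule Lindelof[of ?F]) auto
  ultimately have cov: "\<Union>F' = ?U" by simp
  then have ne: "F' \<noteq> {}" using False by auto
  define B where "B = from_nat_into F'"
  have rB: "range B = F'" unfolding B_def using ne F'(2) by (rule range_from_nat_into)
  have "\<forall>k. \<exists>a \<rho>. \<rho> > 0 \<and> B k = ball a \<rho>" using F'(1) rB by blast
  then obtain a \<rho> where B: "\<And>k. \<rho> k > 0" "\<And>k. B k = ball (a k) (\<rho> k)" by metis
  have U: "x \<in> T \<longleftrightarrow> (\<forall>k. x \<notin> ball (a k) (\<rho> k))" for x
    using cov rB B(2) by (metis ComplD ComplI UN_iff rangeI imageE)
  define e where "e k = \<delta> * (1/2) ^ Suc k" for k :: nat
  have e: "e k > 0" for k using \<delta> by (simp add: e_def)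
  have es: "e sums \<delta>" unfolding e_def using sums_mult[OF power_half_series, of \<delta>] by simp
  have "\<forall>k. \<exists>b b'. (\<forall>x. 0 \<le> b x) \<and> (\<forall>x. b x \<le> e k) \<and> (\<forall>x. b x \<noteq> 0 \<longleftrightarrow> x \<in> ball (a k) (\<rho> k)) \<and>
    (\<forall>x. (b has_derivative b' x) (at x)) \<and> (\<forall>x h. (1 + norm x) * \<bar>b' x h\<bar> \<le> e k * norm h)"
    using bump_function[OF B(1) e] by metis
  then obtain b b' where b: "\<And>k x. 0 \<le> b k x" "\<And>k x. b k x \<le> e k"
      "\<And>k x. b k x \<noteq> 0 \<longleftrightarrow> x \<in> ball (a k) (\<rho> k)"
      "\<And>k x. (b k has_derivative b' k x) (at x)"
      "\<And>k x h. (1 + norm x) * \<bar>b' k x h\<bar> \<le> e k * norm h"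
    by metis
  have b'1: "\<bar>b' k x h\<bar> \<le> e k * norm h" for k x h
    using b(5)[of x k h] mult_right_mono[of 1 "1 + norm x" "\<bar>b' k x h\<bar>"] by simp
  have se: "summable e" using es by (rule sums_summable)
  have sb: "summable (\<lambda>k. b k x)" for x
    by (rule summable_comparison_test'[OF se, of 0]) (use b in auto)
  have sb': "summable (\<lambda>k. b' k x h)" for x h
    by (rule summable_comparison_test'[of "\<lambda>k. e k * norm h" 0])
       (use b'1 se summable_mult2 in auto)
  define v' where "v' x h = (\<Sum>k. b' k x h)" for x h
  have tail: "\<bar>(\<Sum>k<n. b' k x h) - v' x h\<bar> \<le> (\<Sum>k. e (k + n)) * norm h" for n x h
  proof -
    have "(\<Sum>k<n. b' k x h) - v' x h = - (\<Sum>k. b' (k + n) x h)"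
      unfolding v'_def using suminf_minus_initial_segment[OF sb'] by simp
    moreover have "norm (\<Sum>k. b' (k + n) x h) \<le> (\<Sum>k. e (k + n) * norm h)"
      by (rule norm_suminf_le) (use b'1 summable_mult2[OF summable_ignore_initial_segment[OF se]] in auto)
    moreover have "(\<Sum>k. e (k + n) * norm h) = (\<Sum>k. e (k + n)) * norm h"
      using suminf_mult2[OF summable_ignore_initial_segment[OF se], of n "norm h"] by simp
    ultimately show ?thesis by simp
  qed
  have "(\<lambda>n. \<Sum>k. e (k + n)) \<longlonglongrightarrow> 0" using suminf_exist_split2[OF se] .
  then have "\<exists>g. \<forall>x\<in>UNIV. (\<lambda>k. b k x) sums g x \<and> (g has_derivative v' x) (at x within UNIV)"
  proof (intro has_derivative_series)
    fix \<epsilon> :: real assume lim: "(\<lambda>n. \<Sum>k. e (k + n)) \<longlonglongrightarrow> 0" and \<epsilon>: "\<epsilon> > 0"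
    have "\<forall>\<^sub>F n in sequentially. (\<Sum>k. e (k + n)) < \<epsilon>" using order_tendstoD(2)[OF lim \<epsilon>] .
    then show "\<forall>\<^sub>F n in sequentially. \<forall>x\<in>UNIV. \<forall>h. norm ((\<Sum>k<n. b' k x h) - v' x h) \<le> \<epsilon> * norm h"
    proof (rule eventually_mono)
      fix n assume "(\<Sum>k. e (k + n)) < \<epsilon>"
      then have "(\<Sum>k. e (k + n)) * norm h \<le> \<epsilon> * norm h" for h :: 'a by (intro mult_right_mono) auto
      then show "\<forall>x\<in>UNIV. \<forall>h. norm ((\<Sum>k<n. b' k x h) - v' x h) \<le> \<epsilon> * norm h"
        using tail[where n = n] unfolding real_norm_def by (meson order_trans)
    qed
  next
    show "(\<lambda>k. b k 0) sums (\<Sum>k. b k 0)" using sb by (rule summable_sums)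
  qed (use b(4) in auto)
  then obtain v where v: "\<And>x. (\<lambda>k. b k x) sums v x" "\<And>x. (v has_derivative v' x) (at x)" by auto
  show thesis
  proof (rule that[of v v'])
    fix x
    have vs: "v x = (\<Sum>k. b k x)" using v(1) by (rule sums_unique)
    show "0 \<le> v x" unfolding vs by (rule suminf_nonneg[OF sb]) (rule b)
    show "v x \<le> \<delta>" unfolding vs sums_unique[OF es] by (rule suminf_le[OF b(2) sb se])
    have "v x = 0 \<longleftrightarrow> (\<forall>k. b k x = 0)" unfolding vs by (rule suminf_eq_zero_iff[OF sb]) (rule b)
    then show "v x = 0 \<longleftrightarrow> x \<in> T" unfolding U using b(3) by blast
    show "(v has_derivative v' x) (at x)" by (rule v)
    fix h
    have "summable (\<lambda>k. (1 + norm x) * \<bar>b' k x h\<bar>)"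
      by (rule summable_comparison_test'[of "\<lambda>k. e k * norm h" 0])
         (use b(5) se summable_mult2 in auto)
    then have sa: "summable (\<lambda>k. \<bar>b' k x h\<bar>)" by (subst (asm) summable_cmult_iff) (smt (verit) norm_ge_zero)
    have "\<bar>v' x h\<bar> \<le> (\<Sum>k. \<bar>b' k x h\<bar>)" unfolding v'_def by (rule summable_rabs[OF sa])
    then have "(1 + norm x) * \<bar>v' x h\<bar> \<le> (1 + norm x) * (\<Sum>k. \<bar>b' k x h\<bar>)"
      by (intro mult_left_mono) (auto simp: add_nonneg_nonneg)
    also have "\<dots> = (\<Sum>k. (1 + norm x) * \<bar>b' k x h\<bar>)" by (rule suminf_mult[OF sa, symmetric])
    also have "\<dots> \<le> (\<Sum>k. e k * norm h)"
      by (rule suminf_le) (use b(5) sa summable_mult summable_mult2[OF se] in auto)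
    also have "\<dots> = \<delta> * norm h" using sums_unique[OF sums_mult2[OF es, of "norm h"]] by simp
    finally show "(1 + norm x) * \<bar>v' x h\<bar> \<le> \<delta> * norm h" .
  qed
qed

section \<open>Between spheres and level sets of the adapted norm\<close>

text \<open>The last property is Euler's identity for homogeneous functions; by it the radial derivatives of
\<open>round_map\<close> and of \<open>cone_map\<close> do not see the change of norms.\<close>

lemma cnorm_has_derivative:
  fixes x :: "real^'n"
  assumes "dominant x j" "x $ vert \<noteq> 0"
  obtains N' where "(cnorm has_derivative N') (at x)" "\<And>h. \<bar>N' h\<bar> \<le> 2 * norm h" "N' x = cnorm x"
proof (rule that)
  let ?N' = "\<lambda>v. sgn (x $ j) * v $ j + sgn (x $ vert) * v $ vert"
  have "((\<lambda>y. \<bar>y $ vert\<bar>) has_derivative (\<lambda>v. sgn (x $ vert) * v $ vert)) (at x)"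
  proof (rule has_derivative_transform_within_open)
    show "((\<lambda>y. sgn (x $ vert) * y $ vert) has_derivative (\<lambda>v. sgn (x $ vert) * v $ vert)) (at x)"
      by (intro bounded_linear_imp_has_derivative bounded_linear_mult_right[THEN bounded_linear_compose]
          bounded_linear_vec_nth)
    show "open {y::real^'n. 0 < sgn (x $ vert) * y $ vert}"
      by (intro open_Collect_less continuous_intros)
    show "x \<in> {y. 0 < sgn (x $ vert) * y $ vert}" using assms(2) by (auto simp: sgn_if)
    show "sgn (x $ vert) * y $ vert = \<bar>y $ vert\<bar>" if "y \<in> {y. 0 < sgn (x $ vert) * y $ vert}" for y
      using that by (auto simp: sgn_if split: if_splits)
  qed
  then show "(cnorm has_derivative ?N') (at x)"
    unfolding cnorm_def by (intro has_derivative_add hnorm_has_derivative assms)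
  show "\<bar>?N' h\<bar> \<le> 2 * norm h" for h
    using component_le_norm_cart[of h j] component_le_norm_cart[of h vert]
    by (auto simp: sgn_if abs_if split: if_splits)
  show "?N' x = cnorm x"
    unfolding cnorm_def hnorm_dominant[OF assms(1)] by (auto simp: sgn_if abs_if)
qed

text \<open>Radial maps with \<open>norm (round_map x) = cnorm x\<close> and \<open>cnorm (cone_map w x) = w x * norm x\<close>.\<close>

definition round_map :: "real^'n \<Rightarrow> real^'n" where
  "round_map x = cnorm x *\<^sub>R (x /\<^sub>R norm x)"

definition cone_map :: "(real^'n \<Rightarrow> real) \<Rightarrow> real^'n \<Rightarrow> real^'n" where
  "cone_map w x = (w x * norm x) *\<^sub>R (x /\<^sub>R cnorm x)"

lemma norm_round_map [simp]: "norm (round_map x) = cnorm x"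
  by (cases "x = 0") (simp_all add: round_map_def)

lemma cnorm_cone_map: "0 \<le> w x \<Longrightarrow> cnorm (cone_map w x) = w x * norm x"
  by (cases "x = 0") (simp_all add: cone_map_def)

lemma locally_lipschitz_norm: "locally_lipschitz (norm :: 'a::euclidean_space \<Rightarrow> real)"
  by (rule locally_lipschitz_global[of 1], rule lipschitz_onI) (auto simp: dist_norm norm_triangle_ineq3)

lemma locally_lipschitz_id: "locally_lipschitz (\<lambda>x::'a::euclidean_space. x)"
  by (rule locally_lipschitz_bounded_linear) (rule bounded_linear_ident)

lemma locally_lipschitz_round_map: "locally_lipschitz (round_map :: real^'n \<Rightarrow> real^'n)"
  unfolding round_map_def
  by (rule locally_lipschitz_polar[OF locally_lipschitz_cnorm locally_lipschitz_norm zero_less_one _ _ locally_lipschitz_id])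
     (use cnorm_le_norm in auto)

lemma locally_lipschitz_cone_map:
  fixes w :: "real^'n \<Rightarrow> real"
  assumes w: "locally_lipschitz w" "\<And>x. 0 \<le> w x" "\<And>x. w x \<le> 1"
  shows "locally_lipschitz (cone_map w)"
  unfolding cone_map_def
proof (rule locally_lipschitz_polar[OF _ locally_lipschitz_cnorm _ _ _ locally_lipschitz_id])
  show "locally_lipschitz (\<lambda>x. w x * norm x)" by (rule locally_lipschitz_mult[OF w(1) locally_lipschitz_norm])
  show "0 < 1 / real CARD('n)" by simp
  show "(1 / real CARD('n)) * norm x \<le> cnorm x" for x :: "real^'n"
    using norm_le_cnorm[of x] by (simp add: field_simps)
  have "\<bar>w x * norm x\<bar> \<le> real CARD('n) * cnorm x" for x
    using w(2,3)[of x] norm_le_cnorm[of x] mult_left_le_one_le[of "norm x" "w x"] by (simp add: abs_mult)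
  then show "\<exists>C. \<forall>x. norm x \<le> R \<longrightarrow> \<bar>w x * norm x\<bar> \<le> C * cnorm x" for R by blast
qed

definition radial_bound :: "'n::finite itself \<Rightarrow> real" where
  "radial_bound _ = (1 + (2 * real CARD('n) + 2)\<^sup>2) * (1 + (2 * real CARD('n) + 2)\<^sup>2)"

lemma radial_bound_ge_1: "radial_bound TYPE('n::finite) \<ge> 1"
proof -
  have "1 \<le> 1 + (2 * real CARD('n) + 2)\<^sup>2" by simp
  then have "1 * 1 \<le> radial_bound TYPE('n)" unfolding radial_bound_def by (intro mult_mono) auto
  then show ?thesis by simp
qed

lemma negligible_not_dominant_or_flat:
  assumes "CARD('n) \<ge> 2"
  shows "negligible ({x::real^'n. \<nexists>j. dominant x j} \<union> {x. x $ vert = 0})"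
  by (intro negligible_Un negligible_not_dominant assms negligible_component_level)

lemma ae_distortion_round_map:
  assumes n: "CARD('n) \<ge> 2"
  shows "ae_distortion (radial_bound TYPE('n)) (round_map :: real^'n \<Rightarrow> real^'n) UNIV"
proof (rule ae_distortionI[OF negligible_not_dominant_or_flat[OF n]])
  fix x :: "real^'n" assume "x \<notin> {x. \<nexists>j. dominant x j} \<union> {x. x $ vert = 0}"
  then obtain j where j: "dominant x j" "x $ vert \<noteq> 0" by blast
  have x0: "x \<noteq> 0" using j(2) by auto
  obtain N' where N': "(cnorm has_derivative N') (at x)" "\<And>h. \<bar>N' h\<bar> \<le> 2 * norm h" "N' x = cnorm x"
    using cnorm_has_derivative[OF j] by blast
  define \<kappa>' where "\<kappa>' h = N' h / norm x - cnorm x * (x \<bullet> h) / norm x ^ 3" for h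
  have eq: "round_map = (\<lambda>x. (cnorm x / norm x) *\<^sub>R x)" by (simp add: round_map_def fun_eq_iff divide_inverse)
  have pos: "norm x > 0" "cnorm x > 0" using x0 cnorm_pos by auto
  have D: "((\<lambda>x. cnorm x / norm x) has_derivative \<kappa>') (at x)"
  proof -
    have "(norm has_derivative (\<lambda>h. x \<bullet> h / norm x)) (at x)"
      using has_derivative_norm[OF x0] by (simp add: sgn_div_norm inner_commute divide_inverse mult.commute)
    from has_derivative_divide'[OF N'(1) this] pos
    have "((\<lambda>x. cnorm x / norm x) has_derivative
        (\<lambda>h. (N' h * norm x - cnorm x * (x \<bullet> h / norm x)) / (norm x * norm x))) (at x)" by simp
    moreover have "(N' h * norm x - cnorm x * (x \<bullet> h / norm x)) / (norm x * norm x) = \<kappa>' h" for h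
      using pos by (simp add: \<kappa>'_def field_simps power3_eq_cube)
    ultimately show ?thesis by simp
  qed
  show "differentiable_with_distortion (radial_bound TYPE('n)) round_map x"
    unfolding eq radial_bound_def
  proof (rule radial_distortion[OF D])
    show "cnorm x / norm x > 0" using pos by simp
    show "1 \<le> 2 * real CARD('n) + 2" by simp
    show "norm x * \<bar>\<kappa>' h\<bar> \<le> (2 * real CARD('n) + 2) * (cnorm x / norm x) * norm h" for h
    proof -
      have "norm x * \<kappa>' h = N' h - cnorm x * (x \<bullet> h) / (norm x * norm x)"
        using pos by (simp add: \<kappa>'_def field_simps power3_eq_cube)
      then have "norm x * \<bar>\<kappa>' h\<bar> = \<bar>N' h - cnorm x * (x \<bullet> h) / (norm x * norm x)\<bar>"
        using pos by (metis abs_mult abs_norm_cancel)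
      also have "\<dots> \<le> 2 * norm h + (cnorm x / norm x) * norm h"
      proof -
        have "\<bar>cnorm x * (x \<bullet> h) / (norm x * norm x)\<bar> \<le> cnorm x * (norm x * norm h) / (norm x * norm x)"
          unfolding abs_divide abs_mult using pos Cauchy_Schwarz_ineq2[of x h]
          by (simp only: abs_norm_cancel abs_of_nonneg[OF cnorm_ge_0]) (intro divide_right_mono mult_left_mono, auto)
        also have "\<dots> = (cnorm x / norm x) * norm h" using pos by simp
        finally show ?thesis using N'(2)[of h] by linarith
      qed
      also have "2 * norm h \<le> 2 * (real CARD('n) * (cnorm x / norm x)) * norm h"
      proof -
        have "1 \<le> real CARD('n) * (cnorm x / norm x)" using norm_le_cnorm[of x] pos by (simp add: field_simps)
        then show ?thesis by (intro mult_right_mono) auto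
      qed
      finally have "norm x * \<bar>\<kappa>' h\<bar> \<le> 2 * (real CARD('n) * (cnorm x / norm x)) * norm h + cnorm x / norm x * norm h"
        by simp
      also have "\<dots> \<le> 2 * (real CARD('n) * (cnorm x / norm x)) * norm h + 2 * (cnorm x / norm x) * norm h"
      proof -
        have "0 \<le> cnorm x / norm x" using pos by simp
        then have "cnorm x / norm x \<le> 2 * (cnorm x / norm x)" by linarith
        then show ?thesis by (intro add_left_mono mult_right_mono) auto
      qed
      also have "\<dots> = (2 * real CARD('n) + 2) * (cnorm x / norm x) * norm h"
        by (simp only: distrib_right mult.assoc)
      finally show ?thesis .
    qed
    have "\<kappa>' x = 0" using pos N'(3) by (simp add: \<kappa>'_def power2_norm_eq_inner[symmetric] power2_eq_square power3_eq_cube)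
    then show "cnorm x / norm x \<le> (2 * real CARD('n) + 2) * (cnorm x / norm x + \<kappa>' x)"
      using pos by (simp add: mult_left_mono field_simps)
  qed
qed

text \<open>In the radial direction the derivative is \<open>(w x + w' x x) * norm x / cnorm x\<close>, which stays positive
because \<open>w \<ge> 3/4\<close> and \<open>\<bar>w' x x\<bar> \<le> 1/4\<close>.\<close>

lemma ae_distortion_cone_map:
  fixes w :: "real^'n \<Rightarrow> real"
  assumes n: "CARD('n) \<ge> 2"
    and w: "\<And>x. 3/4 \<le> w x" "\<And>x. w x \<le> 1"
    and D: "\<And>x. (w has_derivative w' x) (at x)" "\<And>x h. (1 + norm x) * \<bar>w' x h\<bar> \<le> 1/4 * norm h"
  shows "ae_distortion (radial_bound TYPE('n)) (cone_map w) UNIV"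
proof (rule ae_distortionI[OF negligible_not_dominant_or_flat[OF n]])
  fix x :: "real^'n" assume "x \<notin> {x. \<nexists>j. dominant x j} \<union> {x. x $ vert = 0}"
  then obtain j where j: "dominant x j" "x $ vert \<noteq> 0" by blast
  have x0: "x \<noteq> 0" using j(2) by auto
  obtain N' where N': "(cnorm has_derivative N') (at x)" "\<And>h. \<bar>N' h\<bar> \<le> 2 * norm h" "N' x = cnorm x"
    using cnorm_has_derivative[OF j] by blast
  define t where "t = norm x / cnorm x"
  define \<kappa>' where "\<kappa>' h = w' x h * t + w x * (x \<bullet> h) / (norm x * cnorm x) - w x * t * N' h / cnorm x" for h
  have eq: "cone_map w = (\<lambda>x. (w x * norm x / cnorm x) *\<^sub>R x)" by (simp add: cone_map_def fun_eq_iff divide_inverse)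
  have "norm x > 0" "cnorm x > 0" using x0 cnorm_pos by auto
  then have pos: "norm x > 0" "cnorm x > 0" "t > 0" by (auto simp: t_def)
  have tn: "t \<le> real CARD('n)" using norm_le_cnorm[of x] pos by (simp add: t_def field_simps)
  have wx: "w x > 0" using w(1)[of x] by linarith
  have k: "w x * norm x / cnorm x = w x * t" by (simp add: t_def)
  have Dk: "((\<lambda>x. w x * norm x / cnorm x) has_derivative \<kappa>') (at x)"
  proof -
    have "(norm has_derivative (\<lambda>h. x \<bullet> h / norm x)) (at x)"
      using has_derivative_norm[OF x0] by (simp add: sgn_div_norm inner_commute divide_inverse mult.commute)
    from has_derivative_divide'[OF has_derivative_mult[OF D(1) this] N'(1)] pos
    have "((\<lambda>x. w x * norm x / cnorm x) has_derivative
        (\<lambda>h. ((w x * (x \<bullet> h / norm x) + w' x h * norm x) * cnorm x - w x * norm x * N' h) / (cnorm x * cnorm x))) (at x)"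
      by simp
    moreover have "((w x * (x \<bullet> h / norm x) + w' x h * norm x) * cnorm x - w x * norm x * N' h) / (cnorm x * cnorm x) = \<kappa>' h" for h
      using pos by (simp add: \<kappa>'_def t_def field_simps)
    ultimately show ?thesis by simp
  qed
  show "differentiable_with_distortion (radial_bound TYPE('n)) (cone_map w) x"
    unfolding eq radial_bound_def
  proof (rule radial_distortion[OF Dk])
    show "0 < w x * norm x / cnorm x" using pos wx by simp
    show "1 \<le> 2 * real CARD('n) + 2" by simp
    show "norm x * \<bar>\<kappa>' h\<bar> \<le> (2 * real CARD('n) + 2) * (w x * norm x / cnorm x) * norm h" for h
    proof -
      have "norm x * \<kappa>' h = norm x * w' x h * t + w x * (x \<bullet> h) / cnorm x - w x * t * (t * N' h)"
        using pos by (simp add: \<kappa>'_def t_def field_simps)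
      then have "norm x * \<bar>\<kappa>' h\<bar> = \<bar>norm x * w' x h * t + w x * (x \<bullet> h) / cnorm x - w x * t * (t * N' h)\<bar>"
        using pos by (metis abs_mult abs_norm_cancel)
      also have "\<dots> \<le> \<bar>norm x * w' x h * t\<bar> + \<bar>w x * (x \<bullet> h) / cnorm x\<bar> + \<bar>w x * t * (t * N' h)\<bar>" by linarith
      also have "\<dots> \<le> w x * t * norm h + w x * t * norm h + w x * t * (real CARD('n) * (2 * norm h))"
      proof (intro add_mono)
        have "norm x * \<bar>w' x h\<bar> \<le> 1/4 * norm h" using D(2)[of x h] abs_ge_zero[of "w' x h"] by (simp add: distrib_right) 
        also have "\<dots> \<le> w x * norm h" using w(1)[of x] by (intro mult_right_mono) auto
        finally show "\<bar>norm x * w' x h * t\<bar> \<le> w x * t * norm h"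
          using pos by (simp add: abs_mult mult_ac)
        show "\<bar>w x * (x \<bullet> h) / cnorm x\<bar> \<le> w x * t * norm h"
          using pos wx Cauchy_Schwarz_ineq2[of x h] by (simp add: abs_mult t_def divide_right_mono)
        have "\<bar>t * N' h\<bar> \<le> real CARD('n) * (2 * norm h)"
          unfolding abs_mult using N'(2)[of h] tn pos by (intro mult_mono) auto
        then show "\<bar>w x * t * (t * N' h)\<bar> \<le> w x * t * (real CARD('n) * (2 * norm h))"
          using pos wx by (simp add: abs_mult[of "w x * t"])
      qed
      finally show ?thesis unfolding k by (simp add: algebra_simps)
    qed
    have "\<kappa>' x = w' x x * t"
      using pos N'(3) by (simp add: \<kappa>'_def t_def power2_norm_eq_inner[symmetric] power2_eq_square)
    moreover have "\<bar>w' x x\<bar> \<le> 1/4"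
    proof -
      have "(1 + norm x) * \<bar>w' x x\<bar> \<le> (1 + norm x) * (1/4)" using D(2)[of x x] norm_ge_zero[of x] by simp
      then show ?thesis using pos by (simp add: mult_le_cancel_left_pos add_pos_pos)
    qed
    moreover have "w x * t \<le> 2 * ((w x + w' x x) * t)"
    proof -
      have "w x \<le> 2 * (w x + w' x x)" using w(1)[of x] calculation(2) by (simp add: abs_le_iff)
      then show ?thesis using pos mult_right_mono[of "w x" "2 * (w x + w' x x)" t] by simp
    qed
    moreover have "2 * ((w x + w' x x) * t) \<le> (2 * real CARD('n) + 2) * ((w x + w' x x) * t)"
      using w(1)[of x] calculation(2) pos by (intro mult_right_mono) auto
    ultimately show "w x * norm x / cnorm x \<le> (2 * real CARD('n) + 2) * (w x * norm x / cnorm x + \<kappa>' x)"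
      unfolding k by (simp add: algebra_simps)
  qed
qed

text \<open>The intermediate value theorem on each ray.\<close>

lemma surj_cone_map:
  fixes w :: "real^'n \<Rightarrow> real"
  assumes w: "continuous_on UNIV w" "\<And>x. 3/4 \<le> w x" "\<And>x. w x \<le> 1"
  shows "surj (cone_map w)"
proof (rule surjI[of _ "inv (cone_map w)"])
  fix y :: "real^'n"
  have "\<exists>x. cone_map w x = y"
  proof (cases "y = 0")
    case True
    then show ?thesis by (intro exI[of _ 0]) (simp add: cone_map_def)
  next
    case False
    define g where "g s = w (s *\<^sub>R y) * s * (norm y / cnorm y)" for s
    have pos: "norm y > 0" "cnorm y > 0" using False cnorm_pos by auto
    define b where "b = 2 * cnorm y / norm y"
    have b: "b > 0" using pos by (simp add: b_def)
    have "continuous_on {0..b} g"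
      unfolding g_def by (intro continuous_intros continuous_on_compose2[OF w(1)]) auto
    moreover have "g 0 \<le> 1" by (simp add: g_def)
    moreover have "1 \<le> g b"
    proof -
      have "g b = 2 * w (b *\<^sub>R y)" using pos by (simp add: g_def b_def)
      then show ?thesis using w(2)[of "b *\<^sub>R y"] by linarith
    qed
    ultimately obtain s where s: "0 \<le> s" "g s = 1" using IVT'[of g 0 1 b] b by auto
    then have "s > 0" by (cases "s = 0") (auto simp: g_def)
    then have "cone_map w (s *\<^sub>R y) = g s *\<^sub>R y"
      using pos by (simp add: cone_map_def g_def field_simps)
    then show ?thesis using s by auto
  qed
  then show "cone_map w (inv (cone_map w) y) = y" by (meson f_inv_into_f rangeI UNIV_I image_eqI)
qed

section \<open>Infinitely many transitions and the main theorem\<close>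

text \<open>The \<open>k\<close>-th piece \<open>G k\<close> is a multiple of \<open>transition_map (lam k *\<^sub>R power_map (d k) x)\<close>. The number \<open>lam k\<close> is such that
the transition begins at \<open>cnorm x = a k\<close>, and by the assumption \<open>ratio\<close> it is finished at \<open>b k\<close>. Between \<open>b k\<close>
and \<open>a (Suc k)\<close> both \<open>G k\<close> and \<open>G (Suc k)\<close> are multiples of the same power map, and the constants
\<open>c k\<close> are chosen to make them equal. So \<open>g\<close> coincides with one of the \<open>G k\<close> near every point, and
all these have the same distortion bound.\<close>

lemma transition_chain:
  fixes a b :: "nat \<Rightarrow> real" and k0 :: nat
  assumes n: "CARD('n::finite) \<ge> 2"
    and ab: "\<And>k. 0 < a k" "\<And>k. a k < b k" "\<And>k. b k < a (Suc k)"
    and lim: "filterlim b at_top sequentially"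
    and ratio: "\<And>k. 8 \<le> (b k / a k) ^ (3 ^ (k + k0))"
  obtains g :: "real^'n \<Rightarrow> real^'n" and L :: real and C :: "nat \<Rightarrow> real" where
    "locally_lipschitz g" "ae_distortion L g UNIV" "L \<ge> 1" "\<And>k. C k > 0"
    "\<And>k x. (\<And>j. k = Suc j \<Longrightarrow> b j \<le> cnorm x) \<Longrightarrow> cnorm x \<le> a k \<Longrightarrow>
       g x = C k *\<^sub>R power_map (3 ^ (k + k0)) x"
proof -
  define d :: "nat \<Rightarrow> nat" where "d k = 3 ^ (k + k0)" for k
  have d: "odd (d k)" "d k > 0" "d (Suc k) = 3 * d k" for k by (auto simp: d_def)
  define lam where "lam k = (1/4) / a k ^ d k" for k
  have lam: "lam k > 0" for k using ab(1) by (simp add: lam_def)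
  define c where "c = rec_nat (1::real) (\<lambda>k ck. ck * lam k ^ 3 / (12 * lam (Suc k)))"
  have c_Suc: "c (Suc k) = c k * lam k ^ 3 / (12 * lam (Suc k))" for k by (simp add: c_def)
  have c: "c k > 0" for k
    by (induction k) (simp_all add: c_def lam)
  define G where "G k x = c k *\<^sub>R transition_map (lam k *\<^sub>R power_map (d k) x)" for k and x :: "real^'n"
  have cn: "cnorm (lam k *\<^sub>R power_map (d k) x) = lam k * cnorm x ^ d k" for k and x :: "real^'n"
    using lam[of k] d(1)[of k] by (simp add: cnorm_power_map)
  have low: "G k x = (3 * c k * lam k) *\<^sub>R power_map (d k) x" if "cnorm x \<le> a k" for k x
  proof -
    have "cnorm x ^ d k \<le> a k ^ d k" using that by (intro power_mono) auto
    then have "lam k * cnorm x ^ d k \<le> 1/4" using ab(1)[of k] by (simp add: lam_def field_simps)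
    then have "cnorm (lam k *\<^sub>R power_map (d k) x) \<le> 1/4" unfolding cn .
    from transition_map_near_0[OF this] show ?thesis unfolding G_def by simp
  qed
  have high: "G k x = (c k * lam k ^ 3 / 4) *\<^sub>R power_map (d (Suc k)) x" if "b k \<le> cnorm x" for k x
  proof -
    have "2 \<le> lam k * cnorm x ^ d k"
    proof -
      have "(b k / a k) ^ d k \<le> (cnorm x / a k) ^ d k"
        using that ab(1)[of k] ab(2)[of k] by (intro power_mono divide_right_mono) auto
      then have "8 \<le> (cnorm x / a k) ^ d k" using ratio[of k] unfolding d_def by linarith
      also have "\<dots> = 4 * (lam k * cnorm x ^ d k)" by (simp add: lam_def power_divide)
      finally show ?thesis by simp
    qed
    then have "2 \<le> cnorm (lam k *\<^sub>R power_map (d k) x)" unfolding cn .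
    from transition_map_far[OF this]
    have "G k x = c k *\<^sub>R ((1/4) *\<^sub>R power_map 3 (lam k *\<^sub>R power_map (d k) x))"
      unfolding G_def by simp
    also have "power_map 3 (lam k *\<^sub>R power_map (d k) x) = lam k ^ 3 *\<^sub>R power_map (d (Suc k)) x"
      unfolding power_map_scaleR[OF lam] d(3) by (simp add: power_map_compose d(1))
    finally show ?thesis by simp
  qed
  have agree: "G k x = G (Suc k) x" if "b k \<le> cnorm x" "cnorm x \<le> a (Suc k)" for k x
    using high[OF that(1)] low[OF that(2)] lam[of "Suc k"] by (simp add: c_Suc)
  have mono_b: "b i \<le> b j" if "i \<le> j" for i j
    by (rule lift_Suc_mono_le[OF _ that]) (meson ab less_imp_le order_trans less_trans)
  define idx where "idx x = (LEAST k. cnorm x \<le> b k)" for x :: "real^'n"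
  have ex: "\<exists>k. cnorm x \<le> b k" for x :: "real^'n"
    using lim by (metis eventually_sequentially filterlim_at_top order_refl)
  have idx_eq: "idx x = k" if "cnorm x \<le> b k" "\<And>j. k = Suc j \<Longrightarrow> b j < cnorm x" for x k
    unfolding idx_def
  proof (rule Least_equality)
    show "cnorm x \<le> b k" by (rule that)
    fix l assume l: "cnorm x \<le> b l"
    show "k \<le> l"
    proof (rule ccontr)
      assume "\<not> k \<le> l"
      then obtain j where j: "k = Suc j" "l \<le> j" by (cases k) auto
      then show False using that(2)[OF j(1)] mono_b[OF j(2)] l by linarith
    qed
  qed
  define g where "g x = G (idx x) x" for x
  \<comment> \<open>the open sets \<open>U k\<close> overlap where two consecutive pieces agree\<close>
  define U where "U k = {x::real^'n. (\<forall>j. k = Suc j \<longrightarrow> b j < cnorm x) \<and> cnorm x < a (Suc k)}" for k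
  have gU: "g x = G k x" if "x \<in> U k" for x k
  proof (cases "cnorm x \<le> b k")
    case True
    then show ?thesis using that idx_eq[of x k] by (simp add: g_def U_def)
  next
    case False
    then have "idx x = Suc k"
      using that ab(2)[of "Suc k"] by (intro idx_eq) (auto simp: U_def)
    then show ?thesis using agree[of k x] False that by (simp add: g_def U_def)
  qed
  have cover: "x \<in> U (idx x)" for x
  proof -
    have "cnorm x \<le> b (idx x)" unfolding idx_def using ex by (rule LeastI_ex)
    moreover have "b j < cnorm x" if "idx x = Suc j" for j
      using not_less_Least[of j "\<lambda>k. cnorm x \<le> b k"] that by (simp add: idx_def)
    ultimately show ?thesis using ab(3)[of "idx x"] by (auto simp: U_def)
  qed
  have openU: "open (U k)" for k
  proof (cases k)
    case 0
    then have "U k = {x. cnorm x < a (Suc k)}" by (auto simp: U_def)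
    then show ?thesis by (auto intro!: open_Collect_less continuous_intros)
  next
    case (Suc j)
    then have "U k = {x. b j < cnorm x} \<inter> {x. cnorm x < a (Suc k)}" by (auto simp: U_def)
    then show ?thesis by (auto intro!: open_Int open_Collect_less continuous_intros)
  qed
  have lipG: "locally_lipschitz (G k)" for k
    unfolding G_def
    by (intro locally_lipschitz_scaleR locally_lipschitz_const
        locally_lipschitz_compose[OF locally_lipschitz_transition_map] locally_lipschitz_power_map d)
  have lip: "locally_lipschitz g"
    by (rule locally_lipschitz_if_locally_equal) (metis openU cover lipG gU)
  define B where "B M = profile_bound TYPE('n) M" for M
  have B: "B 1 \<ge> 1" "B 4 \<ge> 1" unfolding B_def by (rule profile_bound_ge_1, simp)+
  define L where "L = (B 4 * B 4) * (B 1 * B 1)"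
  have BB: "1 \<le> B 4 * B 4" "1 \<le> B 1 * B 1"
    using mult_mono[OF B(2) B(2)] mult_mono[OF B(1) B(1)] B by auto
  have L: "L \<ge> 1" unfolding L_def using mult_mono[OF BB] BB by simp
  have aeG: "ae_distortion L (G k) UNIV" for k
  proof -
    have "ae_distortion (1 * (B 1 * B 1)) (\<lambda>x::real^'n. lam k *\<^sub>R power_map (d k) x) UNIV"
      unfolding B_def
      by (rule ae_distortion_compose[OF ae_distortion_scaleR[OF lam, where U = UNIV] ae_distortion_power_map[OF n d(2)]]) auto
    from ae_distortion_compose[OF ae_distortion_transition_map[OF n, folded B_def] this]
    have "ae_distortion ((B 4 * B 4) * (1 * (B 1 * B 1))) (\<lambda>x::real^'n. transition_map (lam k *\<^sub>R power_map (d k) x)) UNIV"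
      using BB by auto
    from ae_distortion_compose[OF ae_distortion_scaleR[OF c, where U = UNIV] this]
    show ?thesis unfolding G_def L_def by simp
  qed
  have ae: "ae_distortion L g UNIV"
  proof (rule ae_distortionI)
    show "negligible (\<Union>k. {x \<in> UNIV. \<not> differentiable_with_distortion L (G k) x})"
      using aeG unfolding ae_distortion_def by (intro negligible_countable_Union) auto
    fix x assume "x \<notin> (\<Union>k. {x \<in> UNIV. \<not> differentiable_with_distortion L (G k) x})"
    then have "differentiable_with_distortion L (G (idx x)) x" by simp
    then show "differentiable_with_distortion L g x"
      by (rule differentiable_with_distortion_cong[OF _ openU cover]) (rule gU)
  qed
  define C where "C k = 3 * c k * lam k" for k
  show thesis
  proof (rule that[OF lip ae L])
    show "C k > 0" for k using c lam by (simp add: C_def)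
    fix k and x :: "real^'n" assume x: "\<And>j. k = Suc j \<Longrightarrow> b j \<le> cnorm x" "cnorm x \<le> a k"
    show "g x = C k *\<^sub>R power_map (3 ^ (k + k0)) x"
    proof (cases "\<exists>j. k = Suc j \<and> b j = cnorm x")
      case False
      then have "x \<in> U k" using x ab(2)[of k] ab(3)[of k] by (force simp: U_def)
      then show ?thesis using gU low[OF x(2)] by (simp add: C_def d_def)
    next
      case True
      then obtain j where j: "k = Suc j" "b j = cnorm x" by blast
      have "x \<in> U j"
      proof -
        have "b i < b j" if "j = Suc i" for i using that ab(2)[of j] ab(3)[of i] by simp
        then show ?thesis using j(2) ab(3)[of j] by (auto simp: U_def)
      qed
      then have "g x = G k x" using gU agree[of j x] j ab(3)[of j] by simp
      then show ?thesis using low[OF x(2)] by (simp add: C_def d_def)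
    qed
  qed
qed

text \<open>The points are the centres of every second subbeam in a row along one horizontal axis. In these cells the sheet sign
is positive, and the folding maps them all to the axis of the beam.\<close>

lemma power_map_many_preimages:
  fixes s :: real
  assumes n: "CARD('n::finite) \<ge> 2" and s: "s > 0" and m: "4 * m < d"
  obtains p :: "nat \<Rightarrow> real^'n" where "inj_on p {..<m}" "\<And>i. i < m \<Longrightarrow> cnorm (p i) = s"
    "\<And>i. i < m \<Longrightarrow> power_map d (p i) = with_height 0 (s ^ d)"
proof -
  have "\<exists>j. j \<noteq> (vert::'n)"
  proof (rule ccontr)
    assume "\<nexists>j. j \<noteq> (vert::'n)"
    then have "(UNIV::'n set) = {vert}" by auto
    then have "CARD('n) = 1" by (metis card_1_singleton_iff One_nat_def)
    then show False using n by simp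
  qed
  then obtain j where j: "j \<noteq> (vert::'n)" by blast
  define t where "t i = 4 * real i / real d" for i
  define p where "p i = s *\<^sub>R with_height (axis j (t i)) (1 - t i)" for i
  have d: "d > 0" using m by simp
  have t: "0 \<le> t i" "t i < 1" if "i < m" for i
    using that m by (auto simp: t_def divide_less_eq)
  have ax: "hnorm (axis j u :: real^'n) = \<bar>u\<bar>" for u
    using j component_le_hnorm[OF j, of "axis j u"]
    by (intro order_antisym hnorm_le) (auto simp: axis_def)
  have cp: "cnorm (p i) = s" if "i < m" for i
    using t[OF that] s by (simp add: p_def) (simp add: cnorm_def ax)
  show thesis
  proof (rule that[of p])
    show "inj_on p {..<m}"
    proof (rule inj_onI)
      fix i l assume "p i = p l"
      then have "p i $ vert = p l $ vert" by simp
      then show "i = l" using s d by (simp add: p_def t_def)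
    qed
    fix i assume i: "i < m"
    show "cnorm (p i) = s" by (rule cp[OF i])
    let ?u = "real d *\<^sub>R (p i /\<^sub>R cnorm (p i))"
    have u: "?u $ l = (if l = j then 2 * of_int (2 * int i) else 0)" if "l \<noteq> vert" for l
      using that s d j by (simp add: cp[OF i]) (simp add: p_def axis_def t_def)
    have tw: "triangle_wave (?u $ l) = 0" "cell_sign (?u $ l) = 1" if "l \<noteq> vert" for l
      using triangle_wave_unique(1)[of "2 * of_int (2 * int i)" "2 * int i" 0]
        triangle_wave_unique(2)[of "2 * of_int (2 * int i)" "2 * int i" 0]
        triangle_wave_unique(1)[of 0 0 0] triangle_wave_unique(2)[of 0 0 0]
      unfolding u[OF that] by (auto simp: parity_sign_def)
    have fold: "beam_fold ?u $ l = 0" if "l \<noteq> vert" for l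
      unfolding beam_fold_nth(2)[OF that] by (rule tw(1)[OF that])
    have h: "hnorm (beam_fold ?u) = 0"
    proof (rule order_antisym[OF hnorm_le hnorm_ge_0])
      show "\<bar>beam_fold ?u $ l\<bar> \<le> 0" if "l \<noteq> vert" for l unfolding fold[OF that] by simp
    qed simp
    have sh: "sheet_sign ?u = 1" unfolding sheet_sign_def by (rule prod.neutral) (use tw(2) in auto)
    have sg: "sgn (p i $ vert) = 1" using t[OF i] s by (simp add: p_def)
    show "power_map d (p i) = with_height 0 (s ^ d)"
      unfolding power_map_def Let_def h sh sg
    proof (subst vec_eq_iff, rule allI)
      fix l
      show "with_height (cnorm (p i) ^ d *\<^sub>R beam_fold ?u) (1 * 1 * (cnorm (p i) ^ d * (1 - 0))) $ l
          = with_height 0 (s ^ d) $ l"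
      proof (cases "l = vert")
        case False
        show ?thesis
          unfolding with_height_simps(3)[OF False] vector_scaleR_component fold[OF False] by simp
      qed (simp add: cp[OF i])
    qed
  qed
qed

lemma map_degree_eq_infinity:
  assumes "\<And>m. \<exists>y S. S \<subseteq> f -` {y} \<and> finite S \<and> card S = m"
  shows "map_degree f = \<infinity>"
proof -
  have "enat m \<le> map_degree f" for m
  proof -
    obtain y S where S: "S \<subseteq> f -` {y}" "finite S" "card S = m" using assms by blast
    have "enat m \<le> num_elements (f -` {y})"
      using S card_mono[of "f -` {y}" S] by (auto simp: num_elements_def)
    also have "\<dots> \<le> map_degree f" unfolding map_degree_def by (rule SUP_upper) simp
    finally show ?thesis .
  qed
  then show ?thesis by (metis enat_iless enat_ord_simps(4) less_irrefl linorder_not_le not_infinity_eq order_less_le lessI enat_ord_code(2))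
qed

text \<open>The radii \<open>R k\<close> are chosen among the given ones so sparsely that the shells \<open>(\<epsilon> * R k, R k)\<close> are disjoint.
The degree changes only for \<open>cnorm\<close> between \<open>\<epsilon> * R k\<close> and \<open>q * R k\<close> with \<open>q = sqrt \<epsilon>\<close>. The margin between
\<open>q * R k\<close> and \<open>R k\<close> is reserved for \<open>cone_map w\<close>, where \<open>q \<le> w x \<le> 1\<close>: a sphere outside the
shells is mapped to a region where \<open>g\<close> is a multiple of a single power map.\<close>

theorem theorem1p2:
  fixes T :: "(real^'n) set" and r :: "nat \<Rightarrow> real" and \<epsilon> :: real
  assumes "CARD('n) \<ge> 2"
    and "closed T"
    and "\<forall>\<rho>\<ge>0. T \<inter> sphere 0 \<rho> \<noteq> {}"
    and "\<forall>k. r k > 0"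
    and "filterlim r at_top sequentially"
    and "0 < \<epsilon>" and "\<epsilon> < 1"
  shows "\<exists>h :: real^'n \<Rightarrow> real^'n. transcendental_type h \<and>
           T - S_eps \<epsilon> r = max_modulus_set h - S_eps \<epsilon> r"
proof -
  note n = assms(1)
  have "\<exists>R. \<forall>k::nat. R k \<in> range r \<and> R k + 1 < \<epsilon> * R (Suc k)"
  proof (rule dependent_nat_choice)
    fix x :: real and k :: nat assume "x \<in> range r"
    have "\<forall>\<^sub>F i in sequentially. (x + 1) / \<epsilon> < r i" using assms(5) by (simp add: filterlim_at_top_dense)
    then obtain i where "(x + 1) / \<epsilon> < r i" by (metis eventually_sequentially order_refl)
    then have "x + 1 < \<epsilon> * r i" using assms(6) by (simp add: field_simps)
    then show "\<exists>y. y \<in> range r \<and> x + 1 < \<epsilon> * y" by blast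
  qed auto
  then obtain R where R: "\<And>k. R k \<in> range r" "\<And>k. R k + 1 < \<epsilon> * R (Suc k)" by blast
  have Rpos: "R k > 0" for k using R(1)[of k] assms(4) by auto
  define q where "q = sqrt \<epsilon>"
  have q: "0 < q" "q < 1" "q * q = \<epsilon>" "\<epsilon> < q"
    using assms(6,7) by (auto simp: q_def real_less_rsqrt power2_eq_square)
  define a where "a k = \<epsilon> * R k" for k
  define b where "b k = q * R k" for k
  have ab: "0 < a k" "a k < b k" "b k < a (Suc k)" for k
  proof -
    show "0 < a k" "a k < b k" using Rpos[of k] assms(6) q by (auto simp: a_def b_def)
    have "q * R k < 1 * R k" using Rpos q by (intro mult_strict_right_mono) auto
    then show "b k < a (Suc k)" using R(2)[of k] by (simp add: a_def b_def)
  qed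
  have Rk: "real k \<le> R k" for k
  proof (induction k)
    case (Suc k)
    have "\<epsilon> * R (Suc k) \<le> 1 * R (Suc k)" using Rpos[of "Suc k"] assms(7) by (intro mult_right_mono) auto
    then show ?case using Suc R(2)[of k] by simp
  qed (use Rpos[of 0] in simp)
  have lim_c: "filterlim (\<lambda>k. c * R k) at_top sequentially" if "c > 0" for c
  proof (rule filterlim_at_top_mono)
    show "filterlim (\<lambda>k. c * real k) at_top sequentially"
      using that by (intro filterlim_tendsto_pos_mult_at_top[OF tendsto_const _ filterlim_real_sequentially]) auto
    show "\<forall>\<^sub>F k in sequentially. c * real k \<le> c * R k" using that Rk by (simp add: mult_left_mono)
  qed
  \<comment> \<open>the initial exponent \<open>3 ^ k0\<close> must be so large that a transition fits between \<open>\<epsilon> * R k\<close> and \<open>q * R k\<close>\<close>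
  obtain k0 where k0: "8 < (1 / q) ^ k0" using real_arch_pow[of "1/q" 8] q by auto
  have ratio: "8 \<le> (b k / a k) ^ (3 ^ (k + k0))" for k
  proof -
    have "b k / a k = 1 / q" using Rpos[of k] q by (simp add: a_def b_def q(3)[symmetric])
    moreover have "k0 \<le> 3 ^ (k + k0)"
      using less_exp[of "k + k0"] power_mono[of "2::nat" 3 "k + k0"] by linarith
    moreover have "(1 / q) ^ k0 \<le> (1 / q) ^ (3 ^ (k + k0))"
      using calculation(2) q by (intro power_increasing) auto
    ultimately show ?thesis using k0 by simp
  qed
  obtain g :: "real^'n \<Rightarrow> real^'n" and L C where g: "locally_lipschitz g" "ae_distortion L g UNIV" "L \<ge> 1"
    "\<And>k. C k > 0"
    "\<And>k x. (\<And>j. k = Suc j \<Longrightarrow> b j \<le> cnorm x) \<Longrightarrow> cnorm x \<le> a k \<Longrightarrow>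
       g x = C k *\<^sub>R power_map (3 ^ (k + k0)) x"
    using transition_chain[OF n ab _ ratio] lim_c[OF q(1)] unfolding b_def[symmetric] by metis
  define \<delta> where "\<delta> = min (1/4) (1 - q)"
  have \<delta>: "\<delta> > 0" "\<delta> \<le> 1/4" "\<delta> \<le> 1 - q" unfolding \<delta>_def using q by (simp_all only: min.cobounded1 min.cobounded2)
  obtain v v' where v: "\<And>x. 0 \<le> v x" "\<And>x. v x \<le> \<delta>" "\<And>x. v x = 0 \<longleftrightarrow> x \<in> T"
    "\<And>x. (v has_derivative v' x) (at x)" "\<And>x h. (1 + norm x) * \<bar>v' x h\<bar> \<le> \<delta> * norm h"
    using closed_zero_set[OF assms(2) \<delta>(1)] by metis
  define w where "w x = 1 - v x" for x
  have w: "3/4 \<le> w x" "w x \<le> 1" "q \<le> w x" "w x = 1 \<longleftrightarrow> x \<in> T" for x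
    using v(1-3)[of x] \<delta> by (auto simp: w_def)
  have Dw: "(w has_derivative (\<lambda>h. - v' x h)) (at x)" for x
    unfolding w_def using has_derivative_diff[OF has_derivative_const v(4)] by simp
  have Dw_bd: "(1 + norm x) * \<bar>- v' x h\<bar> \<le> 1/4 * norm h" for x h
    using v(5)[of x h] mult_right_mono[OF \<delta>(2), of "norm h"] by simp
  have lip_w: "locally_lipschitz w"
  proof (rule locally_lipschitz_global[of 1], rule bounded_derivative_imp_lipschitz)
    show "(w has_derivative (\<lambda>h. - v' x h)) (at x within UNIV)" for x using Dw by simp
    show "onorm (\<lambda>h. - v' x h) \<le> 1" for x
    proof (rule onorm_bound)
      fix h
      have "1 * \<bar>- v' x h\<bar> \<le> (1 + norm x) * \<bar>- v' x h\<bar>" by (intro mult_right_mono) auto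
      then show "norm (- v' x h) \<le> 1 * norm h" using Dw_bd[of x h] by simp
    qed simp
  qed auto
  define h where "h x = round_map (g (cone_map w x))" for x
  have norm_h: "norm (h x) = cnorm (g (cone_map w x))" for x by (simp add: h_def)
  have cc: "cnorm (cone_map w x) = w x * norm x" for x
    using w(1)[of x] by (intro cnorm_cone_map) linarith
  have lip_h: "locally_lipschitz h"
    unfolding h_def
    by (intro locally_lipschitz_compose[OF locally_lipschitz_round_map] locally_lipschitz_compose[OF g(1)]
        locally_lipschitz_cone_map lip_w) (use w in \<open>auto intro: order_trans[of _ "3/4"]\<close>)
  define K where "K = radial_bound TYPE('n)"
  have K: "K \<ge> 1" unfolding K_def by (rule radial_bound_ge_1)
  have "ae_distortion (L * K) (\<lambda>x. g (cone_map w x)) UNIV"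
    unfolding K_def
    by (rule ae_distortion_compose[OF g(2) ae_distortion_cone_map[OF n w(1) w(2) Dw Dw_bd]]) (use g(3) in auto)
  from ae_distortion_compose[OF ae_distortion_round_map[OF n, folded K_def] this]
  have ae_h: "ae_distortion (K * (L * K)) h UNIV" unfolding h_def using K by auto
  have "1 * (1 * 1) \<le> K * (L * K)" using K g(3) by (intro mult_mono) auto
  then have qr: "quasiregular h" using quasiregular_if_ae_distortion[OF lip_h ae_h] by simp
  \<comment> \<open>on spheres outside the shells, \<open>norm (h y)\<close> depends on \<open>norm y\<close> and \<open>w y\<close> only\<close>
  have h_eq: "norm (h y) = C k * (w y * norm y) ^ (3 ^ (k + k0))"
    if "\<And>j. k = Suc j \<Longrightarrow> R j \<le> norm y" "norm y \<le> a k" for k y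
  proof -
    have "w y * norm y \<le> a k" using that(2) w(2)[of y] w(1)[of y] mult_left_le_one_le[of "norm y" "w y"] by simp
    moreover have "b j \<le> w y * norm y" if "k = Suc j" for j
      unfolding b_def using \<open>\<And>j. k = Suc j \<Longrightarrow> R j \<le> norm y\<close>[OF that] w(3)[of y] q Rpos[of j]
      by (intro mult_mono) auto
    ultimately have "g (cone_map w y) = C k *\<^sub>R power_map (3 ^ (k + k0)) (cone_map w y)"
      by (intro g(5)) (simp_all add: cc)
    then show ?thesis using g(4)[of k] by (simp add: norm_h cnorm_power_map cc)
  qed
  \<comment> \<open>a radius outside the shells lies between two consecutive selected shells or before the first one\<close>
  have level: "\<exists>k. (\<forall>j. k = Suc j \<longrightarrow> R j \<le> \<rho>) \<and> \<rho> \<le> a k" if "\<rho> \<notin> E_eps \<epsilon> r" for \<rho>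
  proof -
    have "\<exists>k. \<rho> \<le> a k"
      using lim_c[OF assms(6)] unfolding a_def by (metis eventually_sequentially filterlim_at_top order_refl)
    define k where "k = (LEAST k. \<rho> \<le> a k)"
    have k: "\<rho> \<le> a k" unfolding k_def using \<open>\<exists>k. \<rho> \<le> a k\<close> by (rule LeastI_ex)
    moreover have "R j \<le> \<rho>" if j: "k = Suc j" for j
    proof -
      have "a j < \<rho>" using not_less_Least[of j "\<lambda>k. \<rho> \<le> a k"] j by (simp add: k_def)
      moreover obtain i where i: "R j = r i" using R(1)[of j] by blast
      moreover have "\<not> (\<epsilon> * r i < \<rho> \<and> \<rho> < r i)"
        using \<open>\<rho> \<notin> E_eps \<epsilon> r\<close> by (auto simp: E_eps_def)
      ultimately show ?thesis by (auto simp: a_def)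
    qed
    ultimately show ?thesis by blast
  qed
  have mem: "x \<in> max_modulus_set h \<longleftrightarrow> x \<in> T" if x: "x \<notin> S_eps \<epsilon> r" for x
  proof -
    have "norm x \<notin> E_eps \<epsilon> r" using x by (auto simp: S_eps_def)
    then obtain k where k: "\<And>j. k = Suc j \<Longrightarrow> R j \<le> norm x" "norm x \<le> a k" using level by blast
    let ?d = "3 ^ (k + k0) :: nat"
    have val: "norm (h y) = C k * (w y * norm x) ^ ?d" if "norm y = norm x" for y
      using h_eq[of k y] k that by simp
    obtain y where y: "y \<in> T" "norm y = norm x"
      using assms(3)[rule_format, of "norm x"] by auto
    have "max_modulus (norm x) h = C k * norm x ^ ?d"
      unfolding max_modulus_def
    proof (rule cSup_eq_maximum)
      have "norm (h y) = C k * norm x ^ ?d" using val[OF y(2)] w(4)[of y] y(1) by simp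
      then show "C k * norm x ^ ?d \<in> (\<lambda>x. norm (h x)) ` sphere 0 (norm x)"
        using y(2) by (intro image_eqI[of _ _ y]) auto
      fix t assume "t \<in> (\<lambda>x. norm (h x)) ` sphere 0 (norm x)"
      then obtain z where z: "norm z = norm x" "t = norm (h z)" by auto
      have "(w z * norm x) ^ ?d \<le> norm x ^ ?d"
        using w(1)[of z] w(2)[of z] by (intro power_mono mult_left_le_one_le) auto
      then show "t \<le> C k * norm x ^ ?d" using g(4)[of k] by (simp add: z val[OF z(1)])
    qed
    then have "x \<in> max_modulus_set h \<longleftrightarrow> C k * (w x * norm x) ^ ?d = C k * norm x ^ ?d"
      by (simp add: max_modulus_set_def val)
    also have "\<dots> \<longleftrightarrow> w x * norm x = norm x"
    proof -
      have "0 \<le> w x * norm x" using w(1)[of x] by simp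
      then have "(w x * norm x) ^ ?d = norm x ^ ?d \<longleftrightarrow> w x * norm x = norm x"
        by (intro power_eq_iff_eq_base) auto
      then show ?thesis using g(4)[of k] by simp
    qed
    \<comment> \<open>the sphere of radius zero is a point, which gives \<open>0 \<in> T\<close>\<close>
    also have "\<dots> \<longleftrightarrow> x \<in> T"
    proof (cases "x = 0")
      case True
      then show ?thesis using y by simp
    next
      case False
      then show ?thesis using w(4)[of x] by simp
    qed
    finally show ?thesis .
  qed
  have surj: "surj (cone_map w)"
    using locally_lipschitz_continuous_on[OF lip_w] w(1,2) by (rule surj_cone_map)
  have preimages: "\<exists>y S. S \<subseteq> h -` {y} \<and> finite S \<and> card S = m \<and> y \<noteq> 0" for m
  proof -
    define k where "k = 4 * m"
    let ?d = "3 ^ (k + k0) :: nat"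
    have "4 * m < ?d" using less_exp[of "k + k0"] power_mono[of "2::nat" 3 "k + k0"] unfolding k_def by linarith
    then obtain p :: "nat \<Rightarrow> real^'n" where p: "inj_on p {..<m}" "\<And>i. i < m \<Longrightarrow> cnorm (p i) = a k"
      "\<And>i. i < m \<Longrightarrow> power_map ?d (p i) = with_height 0 (a k ^ ?d)"
      using power_map_many_preimages[OF n ab(1)] by metis
    define s where "s i = inv (cone_map w) (p i)" for i
    have s: "cone_map w (s i) = p i" for i unfolding s_def by (rule surj_f_inv_f[OF surj])
    let ?z = "C k *\<^sub>R with_height 0 (a k ^ ?d) :: real^'n"
    have "g (p i) = ?z" if "i < m" for i
    proof -
      have "b j \<le> a k" if "k = Suc j" for j using ab(3)[of j] that by simp
      then show ?thesis using g(5)[of k "p i"] p(2,3)[OF that] by simp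
    qed
    then have "s ` {..<m} \<subseteq> h -` {round_map ?z}" by (auto simp: h_def s)
    moreover have "card (s ` {..<m}) = m"
    proof -
      have "inj_on s {..<m}" by (rule inj_onI) (metis inj_onD p(1) s)
      then show ?thesis by (simp add: card_image)
    qed
    moreover have "round_map ?z \<noteq> 0"
    proof -
      have "?z $ vert \<noteq> 0" using g(4)[of k] ab(1)[of k] by simp
      then have "?z \<noteq> 0" by (metis zero_index)
      then have "norm (round_map ?z) \<noteq> 0" unfolding norm_round_map cnorm_eq_0 .
      then show ?thesis by (metis norm_zero)
    qed
    ultimately show ?thesis by blast
  qed
  have "map_degree h = \<infinity>" by (rule map_degree_eq_infinity) (use preimages in blast)
  moreover have "\<not> h constant_on UNIV"
  proof
    assume "h constant_on UNIV"
    then obtain y where y: "\<And>x. h x = y" unfolding constant_on_def by blast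
    have "norm (h 0) = C 0 * (w 0 * norm (0::real^'n)) ^ (3 ^ (0 + k0))"
      by (rule h_eq) (use ab(1)[of 0] in auto)
    then have "norm y = 0" using y[of 0] by (simp add: zero_power)
    then have "y = 0" by simp
    obtain z S where "S \<subseteq> h -` {z}" "card S = 1" "z \<noteq> 0" using preimages[of 1] by blast
    then obtain x where "h x = z" by (metis card_1_singletonE insert_subset vimage_singleton_eq)
    then show False using y \<open>y = 0\<close> \<open>z \<noteq> 0\<close> by simp
  qed
  ultimately have "transcendental_type h" using qr by (simp add: transcendental_type_def)
  moreover have "T - S_eps \<epsilon> r = max_modulus_set h - S_eps \<epsilon> r" using mem by blast
  ultimately show ?thesis by blast
qed

end
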